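(* The doublet graph is non-soluble; that is, for its normalised generic constraint equations with variety $V\subseteq\mathbb{C}^8$, it is not the case that every coordinate of every point of $V$ lies in a radical extension of the base field $\mathbb{Q}(\{d_e\})$.
   Context: The doublet is the graph with vertices $v_1,\dots,v_6$ and the nine edges $v_1v_2$, $v_1v_4$, $v_1v_5$, $v_4v_5$, $v_2v_3$, $v_2v_6$, $v_3v_6$, $v_3v_4$, $v_5v_6$ (two triangles joined by three disjoint edges). Take $v_1v_2$ as base edge, with $v_1=(0,0)$, $v_2=(1,0)$, and let $(x_i,y_i)$, $3\le i\le 6$, be the coordinate variables of the other vertices. The normalised generic constraint equations are $(x_v-x_w)^2+(y_v-y_w)^2-d_e=0$ for the eight non-base edges $e=(vw)$, where the (squared) dimensions $d_e$ are algebraically independent over $\mathbb{Q}$; $V\subseteq\mathbb{C}^8$ is the complex affine variety they define. A radical extension of a field is one obtained by a finite tower of adjunctions of roots of arbitrary order. *)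

theory Defs
  imports
    Complex_Main
    "HOL-Library.FuncSet"
    "HOL-Library.Poly_Mapping"
    "HOL-Algebra.Generated_Fields"
    "HOL-Algebra.Algebraic_Closure_Type"
begin

(* A monomial is its finitely supported exponent function; a polynomial is a finitely
   supported family of rational coefficients of monomials. *)
type_synonym 'i rat_mpoly = "('i \<Rightarrow>\<^sub>0 nat) \<Rightarrow>\<^sub>0 rat"

definition rat_mpoly_eval :: "('i \<Rightarrow> 'a) \<Rightarrow> 'i rat_mpoly \<Rightarrow> 'a :: field_char_0" where
  "rat_mpoly_eval d p =
     (\<Sum>m\<in>Poly_Mapping.keys p.
        of_rat (Poly_Mapping.lookup p m) *
        (\<Prod>i\<in>Poly_Mapping.keys m. d i ^ Poly_Mapping.lookup m i))"

(* Algebraic independence of the indexed family (d i), i in I. The variables of a polynomial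
   are the indices, so equal values at distinct indices are excluded. *)
definition algebraically_independent_over_rat :: "('i \<Rightarrow> 'a :: field_char_0) \<Rightarrow> 'i set \<Rightarrow> bool" where
  "algebraically_independent_over_rat d I \<longleftrightarrow>
     (\<forall>p :: 'i rat_mpoly.
        (\<forall>m\<in>Poly_Mapping.keys p. Poly_Mapping.keys m \<subseteq> I) \<longrightarrow>
        rat_mpoly_eval d p = 0 \<longrightarrow> p = 0)"

abbreviation generated_subfield :: "'a :: field set \<Rightarrow> 'a set" where
  "generated_subfield S \<equiv> generate_field ring_of_type_algebra S"

(* Extensions are taken inside the ambient field 'a; for 'a = complex, which is algebraically
   closed, this loses nothing. *)
inductive radical_extension :: "'a :: field set \<Rightarrow> 'a set \<Rightarrow> bool" for K where
  base: "radical_extension K K"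
| adjoin_root:
    "\<lbrakk>radical_extension K L; n > 0; a ^ n \<in> L\<rbrakk>
       \<Longrightarrow> radical_extension K (generated_subfield (insert a L))"

(* A graph is given by a vertex set Vs and a set E of two-element vertex sets; {a, b} is the
   base edge. A point of the affine space (here (C^2)^(Vs - {a, b})) assigns coordinates to the
   remaining vertices only; the base vertices are placed by the normalisation. *)
definition place :: "'v \<Rightarrow> 'v \<Rightarrow> ('v \<Rightarrow> complex \<times> complex) \<Rightarrow> 'v \<Rightarrow> complex \<times> complex" where
  "place a b p v = (if v = a then (0, 0) else if v = b then (1, 0) else p v)"

definition constraint_variety ::
    "'v set \<Rightarrow> 'v set set \<Rightarrow> 'v \<Rightarrow> 'v \<Rightarrow> ('v set \<Rightarrow> complex) \<Rightarrow> ('v \<Rightarrow> complex \<times> complex) set" where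
  "constraint_variety Vs E a b d =
     {p \<in> (Vs - {a, b}) \<rightarrow>\<^sub>E UNIV.
        \<forall>v w. {v, w} \<in> E - {{a, b}} \<longrightarrow>
          (fst (place a b p v) - fst (place a b p w))\<^sup>2
          + (snd (place a b p v) - snd (place a b p w))\<^sup>2 - d {v, w} = 0}"

definition soluble_by_radicals ::
    "'v set \<Rightarrow> 'v set set \<Rightarrow> 'v \<Rightarrow> 'v \<Rightarrow> ('v set \<Rightarrow> complex) \<Rightarrow> bool" where
  "soluble_by_radicals Vs E a b d \<longleftrightarrow>
     (\<forall>p \<in> constraint_variety Vs E a b d. \<forall>v \<in> Vs - {a, b}. \<forall>c \<in> {fst (p v), snd (p v)}.
        \<exists>L. radical_extension (generated_subfield (d ` (E - {{a, b}}))) L \<and> c \<in> L)"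

definition doublet_vertices :: "nat set" where
  "doublet_vertices = {1..6}"

definition doublet_edges :: "nat set set" where
  "doublet_edges = {{1,2}, {1,4}, {1,5}, {4,5}, {2,3}, {2,6}, {3,6}, {3,4}, {5,6}}"

end

theory Submission
  imports
    Defs
    "HOL-Computational_Algebra.Fundamental_Theorem_Algebra"
    "HOL-Analysis.Continuum_Not_Denumerable"
    "HOL-Library.Countable"
begin


text \<open>In isotropic coordinates x + iy, x - iy a squared distance is a product, and a rotation
  about a vertex multiplies one coordinate by a scalar and divides the other by it. Two
  configurations whose triangles at v1 and v2 have the same shapes differ by two such scalars x and
  y, and the two remaining edges give two equations quadratic in y. Their resultant is, up to a
  power of x, a sextic in x. Relative to a known configuration \<open>w\<close> it has the root 1,
  and the other factor is \<open>quintic w\<close>. A root r of it gives a second configuration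
  \<open>u\<close> with the same edge lengths and \<open>u 0 = w 0 * r\<close>
  (\<open>ex_second_configuration\<close>). If the coordinates of \<open>u\<close> were obtainable
  by radicals, r would lie in a radical extension of Q(w), a field containing the base field.

  This is excluded by Galois theory. For a suitable generic \<open>z\<close> the quintic is
  irreducible over Q(z), by specialising to an Eisenstein polynomial
  (\<open>irreducible_quintic\<close>), and has exactly three real roots. Complex conjugation is
  then a transposition of the roots, and since 5 is prime all transpositions, hence all 3-cycles,
  occur (\<open>swaps_all\<close>, \<open>three_cycles_real\<close>,
  \<open>ex_generic_three_cycles\<close>). A 3-cycle on five letters is a commutator of 3-cycles, so
  all of them survive the adjunction of radicals
  (\<open>three_cycles_over_radical_extension\<close>), whereas a field containing one of the roots
  cannot admit them (\<open>three_cycles_over_disjoint\<close>).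

  The configuration \<open>z\<close> is special, while the dimensions \<open>d\<close> are arbitrary
  independent numbers. The map \<open>sq_lengths\<close> is dominant
  (\<open>sq_lengths_dominant\<close>), so the lengths of \<open>z\<close> are independent too. The
  isomorphism taking them to \<open>d\<close> extends to the coordinates of \<open>z\<close>; their
  images form a configuration \<open>w\<close> with lengths \<open>d\<close>
  (\<open>generic_configuration_corr\<close>), and the 3-cycles are conjugated along
  (\<open>three_cycles_over_transport\<close>).\<close>

section \<open>Isomorphisms between subfields, encoded as relations\<close>

definition ring_corr :: "('a::field \<times> 'a) set \<Rightarrow> bool" where
  "ring_corr \<Phi> \<longleftrightarrow> (1, 1) \<in> \<Phi> \<and>
     (\<forall>x y x' y'. (x, y) \<in> \<Phi> \<longrightarrow> (x', y') \<in> \<Phi> \<longrightarrow> (x - x', y - y') \<in> \<Phi> \<and> (x * x', y * y') \<in> \<Phi>) \<and>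
     (\<forall>x y. (x, y) \<in> \<Phi> \<longrightarrow> (x = 0 \<longleftrightarrow> y = 0))"

text \<open>Such a relation is the graph of an isomorphism between two subfields: the zero condition
  in \<open>ring_corr\<close> makes it single-valued and injective. These partial maps replace
  automorphisms of splitting fields. As relations they are composed, inverted and enlarged without
  any bookkeeping of domains.\<close>

definition field_corr :: "('a::field \<times> 'a) set \<Rightarrow> bool" where
  "field_corr \<Phi> \<longleftrightarrow> ring_corr \<Phi> \<and> (\<forall>x y. (x, y) \<in> \<Phi> \<longrightarrow> (inverse x, inverse y) \<in> \<Phi>)"

lemma field_corr_ring [dest]: "field_corr \<Phi> \<Longrightarrow> ring_corr \<Phi>"
  by (simp add: field_corr_def)

context
  fixes \<Phi> :: "('a::field \<times> 'a) set"
  assumes rc: "ring_corr \<Phi>"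
begin

lemma corr_one: "(1, 1) \<in> \<Phi>"
  using rc by (simp add: ring_corr_def)

lemma corr_diff: "(x, y) \<in> \<Phi> \<Longrightarrow> (x', y') \<in> \<Phi> \<Longrightarrow> (x - x', y - y') \<in> \<Phi>"
  using rc by (simp add: ring_corr_def)

lemma corr_mult: "(x, y) \<in> \<Phi> \<Longrightarrow> (x', y') \<in> \<Phi> \<Longrightarrow> (x * x', y * y') \<in> \<Phi>"
  using rc by (simp add: ring_corr_def)

lemma corr_eq_0_iff: "(x, y) \<in> \<Phi> \<Longrightarrow> x = 0 \<longleftrightarrow> y = 0"
  using rc by (simp add: ring_corr_def)

lemma corr_zero: "(0, 0) \<in> \<Phi>"
  using corr_diff[OF corr_one corr_one] by simp

lemma corr_uminus: "(x, y) \<in> \<Phi> \<Longrightarrow> (- x, - y) \<in> \<Phi>"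
  using corr_diff[OF corr_zero, of x y] by simp

lemma corr_add: "(x, y) \<in> \<Phi> \<Longrightarrow> (x', y') \<in> \<Phi> \<Longrightarrow> (x + x', y + y') \<in> \<Phi>"
  using corr_diff[OF _ corr_uminus, of x y x' y'] by simp

lemma corr_power: "(x, y) \<in> \<Phi> \<Longrightarrow> (x ^ n, y ^ n) \<in> \<Phi>"
  by (induction n) (auto intro: corr_one corr_mult)

lemma corr_of_nat: "(of_nat n, of_nat n) \<in> \<Phi>"
  by (induction n) (auto intro: corr_zero corr_one corr_add)

lemma corr_of_int: "(of_int n, of_int n) \<in> \<Phi>"
  by (cases n) (auto intro: corr_of_nat corr_uminus simp flip: of_nat_Suc simp del: of_nat_Suc)

lemma corr_sum: "(\<And>i. i \<in> A \<Longrightarrow> (f i, g i) \<in> \<Phi>) \<Longrightarrow> (sum f A, sum g A) \<in> \<Phi>"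
  by (induction A rule: infinite_finite_induct) (auto intro: corr_zero corr_add)

lemma corr_left_unique: "(x, y) \<in> \<Phi> \<Longrightarrow> (x, y') \<in> \<Phi> \<Longrightarrow> y = y'"
  using corr_diff[of x y x y'] corr_eq_0_iff[of "x - x" "y - y'"] by simp

lemma corr_right_unique: "(x, y) \<in> \<Phi> \<Longrightarrow> (x', y) \<in> \<Phi> \<Longrightarrow> x = x'"
  using corr_diff[of x y x' y] corr_eq_0_iff[of "x - x'" "y - y"] by simp

end

lemma corr_inverse: "field_corr \<Phi> \<Longrightarrow> (x, y) \<in> \<Phi> \<Longrightarrow> (inverse x, inverse y) \<in> \<Phi>"
  by (simp add: field_corr_def)

lemma corr_divide:
  "field_corr \<Phi> \<Longrightarrow> (x, y) \<in> \<Phi> \<Longrightarrow> (x', y') \<in> \<Phi> \<Longrightarrow> (x / x', y / y') \<in> \<Phi>"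
  by (simp add: divide_inverse corr_inverse corr_mult field_corr_ring)

lemma field_corr_converse: "field_corr \<Phi> \<Longrightarrow> field_corr (\<Phi>\<inverse>)"
  by (auto simp: field_corr_def ring_corr_def)

lemma field_corr_relcomp:
  assumes "field_corr \<Phi>" "field_corr \<Psi>"
  shows "field_corr (\<Phi> O \<Psi>)"
  unfolding field_corr_def ring_corr_def
proof (intro conjI allI impI)
  note F = field_corr_ring[OF assms(1)] and G = field_corr_ring[OF assms(2)]
  show "(1, 1) \<in> \<Phi> O \<Psi>"
    using corr_one[OF F] corr_one[OF G] by blast
  fix x z assume "(x, z) \<in> \<Phi> O \<Psi>"
  then obtain y where xyz: "(x, y) \<in> \<Phi>" "(y, z) \<in> \<Psi>" by auto
  show "x = 0 \<longleftrightarrow> z = 0"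
    using corr_eq_0_iff[OF F xyz(1)] corr_eq_0_iff[OF G xyz(2)] by simp
  show "(inverse x, inverse z) \<in> \<Phi> O \<Psi>"
    using corr_inverse[OF assms(1) xyz(1)] corr_inverse[OF assms(2) xyz(2)] by auto
  fix x' z' assume "(x', z') \<in> \<Phi> O \<Psi>"
  then obtain y' where xyz': "(x', y') \<in> \<Phi>" "(y', z') \<in> \<Psi>" by auto
  show "(x - x', z - z') \<in> \<Phi> O \<Psi>"
    using corr_diff[OF F xyz(1) xyz'(1)] corr_diff[OF G xyz(2) xyz'(2)] by auto
  show "(x * x', z * z') \<in> \<Phi> O \<Psi>"
    using corr_mult[OF F xyz(1) xyz'(1)] corr_mult[OF G xyz(2) xyz'(2)] by auto
qed

text \<open>An isomorphism of domains extends to the fraction fields; a denominator vanishes on one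
  side exactly when it does on the other.\<close>

lemma fraction_corr:
  assumes "ring_corr \<Phi>"
  obtains \<Psi> where "field_corr \<Psi>" "\<Phi> \<subseteq> \<Psi>"
proof -
  note intros = corr_one[OF assms] corr_diff[OF assms] corr_mult[OF assms] corr_zero[OF assms]
  define \<Psi> where "\<Psi> = {(x / u, y / v) | x y u v. (x, y) \<in> \<Phi> \<and> (u, v) \<in> \<Phi> \<and> u \<noteq> 0}"
  have nz: "u \<noteq> 0 \<longleftrightarrow> v \<noteq> 0" if "(u, v) \<in> \<Phi>" for u v
    using corr_eq_0_iff[OF assms that] by simp
  have sub: "\<Phi> \<subseteq> \<Psi>"
  proof
    fix p assume p: "p \<in> \<Phi>"
    obtain x y where p_eq: "p = (x, y)" by force
    have "x = x / 1 \<and> y = y / 1 \<and> (x, y) \<in> \<Phi> \<and> (1, 1) \<in> \<Phi> \<and> (1::'a) \<noteq> 0"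
      using p intros(1) p_eq by simp
    then show "p \<in> \<Psi>" unfolding \<Psi>_def p_eq by blast
  qed
  have "field_corr \<Psi>"
    unfolding field_corr_def ring_corr_def
  proof (intro conjI allI impI)
    show "(1, 1) \<in> \<Psi>" using sub intros(1) by auto
    fix a b assume "(a, b) \<in> \<Psi>"
    then obtain x y u v where ab: "a = x / u" "b = y / v" "(x, y) \<in> \<Phi>" "(u, v) \<in> \<Phi>" "u \<noteq> 0" "v \<noteq> 0"
      unfolding \<Psi>_def using nz by auto
    show "a = 0 \<longleftrightarrow> b = 0"
      using ab nz[of x y] by auto
    show "(inverse a, inverse b) \<in> \<Psi>"
    proof (cases "x = 0")
      case True
      then have "y = 0" using nz ab by auto
      with True show ?thesis using ab intros(4) sub by auto
    next
      case False
      have "inverse a = u / x" "inverse b = v / y" using ab by auto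
      then show ?thesis using False ab unfolding \<Psi>_def by blast
    qed
    fix a' b' assume "(a', b') \<in> \<Psi>"
    then obtain x' y' u' v' where ab': "a' = x' / u'" "b' = y' / v'" "(x', y') \<in> \<Phi>" "(u', v') \<in> \<Phi>" "u' \<noteq> 0" "v' \<noteq> 0"
      unfolding \<Psi>_def using nz by auto
    have "a - a' = (x * u' - x' * u) / (u * u')" "b - b' = (y * v' - y' * v) / (v * v')"
      using ab ab' by (simp_all add: diff_frac_eq)
    moreover have "(x * u' - x' * u, y * v' - y' * v) \<in> \<Phi>" "(u * u', v * v') \<in> \<Phi>" "u * u' \<noteq> 0"
      using ab ab' intros by simp_all
    ultimately show "(a - a', b - b') \<in> \<Psi>" unfolding \<Psi>_def by blast
    have "a * a' = (x * x') / (u * u')" "b * b' = (y * y') / (v * v')"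
      using ab ab' by auto
    moreover have "(x * x', y * y') \<in> \<Phi>" "(u * u', v * v') \<in> \<Phi>" "u * u' \<noteq> 0"
      using ab ab' intros by simp_all
    ultimately show "(a * a', b * b') \<in> \<Psi>" unfolding \<Psi>_def by blast
  qed
  with sub show thesis using that by blast
qed

section \<open>Corresponding polynomials and extension to algebraic elements\<close>

definition poly_corr :: "('a::field \<times> 'a) set \<Rightarrow> ('a poly \<times> 'a poly) set" where
  "poly_corr \<Phi> = {(p, q). \<forall>i. (coeff p i, coeff q i) \<in> \<Phi>}"

context
  fixes \<Phi> :: "('a::field \<times> 'a) set"
  assumes rc: "ring_corr \<Phi>"
begin

lemma poly_corr_diff: "(p, q) \<in> poly_corr \<Phi> \<Longrightarrow> (p', q') \<in> poly_corr \<Phi> \<Longrightarrow> (p - p', q - q') \<in> poly_corr \<Phi>"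
  by (auto simp: poly_corr_def intro: corr_diff[OF rc])

lemma poly_corr_add: "(p, q) \<in> poly_corr \<Phi> \<Longrightarrow> (p', q') \<in> poly_corr \<Phi> \<Longrightarrow> (p + p', q + q') \<in> poly_corr \<Phi>"
  by (auto simp: poly_corr_def intro: corr_add[OF rc])

lemma poly_corr_mult: "(p, q) \<in> poly_corr \<Phi> \<Longrightarrow> (p', q') \<in> poly_corr \<Phi> \<Longrightarrow> (p * p', q * q') \<in> poly_corr \<Phi>"
  by (auto simp: poly_corr_def coeff_mult intro!: corr_sum[OF rc] corr_mult[OF rc])

lemma poly_corr_pCons: "(x, y) \<in> \<Phi> \<Longrightarrow> (p, q) \<in> poly_corr \<Phi> \<Longrightarrow> (pCons x p, pCons y q) \<in> poly_corr \<Phi>"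
  by (auto simp: poly_corr_def coeff_pCons split: nat.split)

lemma poly_corr_0: "(0, 0) \<in> poly_corr \<Phi>"
  by (auto simp: poly_corr_def corr_zero[OF rc])

lemma poly_corr_monom: "(x, y) \<in> \<Phi> \<Longrightarrow> (monom x n, monom y n) \<in> poly_corr \<Phi>"
  by (auto simp: poly_corr_def corr_zero[OF rc])

lemma poly_corr_degree: "(p, q) \<in> poly_corr \<Phi> \<Longrightarrow> degree p = degree q"
  using corr_eq_0_iff[OF rc] by (fastforce simp: poly_corr_def intro: degree_cong)

lemma poly_corr_eq_0_iff: "(p, q) \<in> poly_corr \<Phi> \<Longrightarrow> p = 0 \<longleftrightarrow> q = 0"
  using corr_eq_0_iff[OF rc] by (fastforce simp: poly_corr_def poly_eq_iff)

end

text \<open>Long division runs in lockstep on both sides: degrees agree, and the quotients of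
  leading coefficients correspond.\<close>

lemma poly_corr_divide:
  assumes fc: "field_corr \<Phi>" and pq: "(p, q) \<in> poly_corr \<Phi>" and p0: "p \<noteq> 0"
    and uv: "(u, v) \<in> poly_corr \<Phi>"
  shows "\<exists>h k r s. (h, k) \<in> poly_corr \<Phi> \<and> (r, s) \<in> poly_corr \<Phi> \<and> u = h * p + r \<and> v = k * q + s
           \<and> (r = 0 \<or> degree r < degree p)"
  using uv
\<comment> \<open>The measure is 0 for the zero polynomial and degree plus one otherwise, so that a
  constant reduced to zero still counts as a decrease.\<close>
proof (induction "if u = 0 then 0 else Suc (degree u)" arbitrary: u v rule: less_induct)
  case less
  note rc = field_corr_ring[OF fc]
  show ?case
  proof (cases "u = 0 \<or> degree u < degree p")
    case True
    then show ?thesis using less.prems poly_corr_0[OF rc] 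
      by (intro exI[of _ 0] exI[of _ u] exI[of _ v]) auto
  next
    case False
    then have u0: "u \<noteq> 0" and deg: "degree p \<le> degree u" by auto
    define x where "x = coeff u (degree u) / coeff p (degree p)"
    define y where "y = coeff v (degree u) / coeff q (degree p)"
    define n where "n = degree u - degree p"
    have "(x, y) \<in> \<Phi>" unfolding x_def y_def using less.prems pq
      by (intro corr_divide[OF fc]) (auto simp: poly_corr_def)
    then have hk: "(monom x n, monom y n) \<in> poly_corr \<Phi>" by (rule poly_corr_monom[OF rc])
    let ?u = "u - monom x n * p" and ?v = "v - monom y n * q"
    have uv': "(?u, ?v) \<in> poly_corr \<Phi>"
      using less.prems pq hk by (intro poly_corr_diff[OF rc] poly_corr_mult[OF rc])
    have "x \<noteq> 0" unfolding x_def using u0 p0 by simp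
    then have degm: "degree (monom x n * p) = degree u" 
      using p0 deg by (simp add: degree_mult_eq degree_monom_eq n_def)
    have "coeff ?u (degree u) = 0"
      using deg p0 by (simp add: coeff_monom_mult n_def x_def)
    moreover have "degree ?u \<le> degree u"
      using degm by (metis degree_diff_le order_refl)
    ultimately have "?u = 0 \<or> degree ?u < degree u"
      by (metis coeff_0_degree_minus_1 bot_nat_0.not_eq_extremum coeff_0 
          leading_coeff_0_iff order_le_imp_less_or_eq)
    then have "(if ?u = 0 then 0 else Suc (degree ?u)) < (if u = 0 then 0 else Suc (degree u))"
      using u0 by auto
    from less.hyps[OF this uv'] obtain h k r s where
      *: "(h, k) \<in> poly_corr \<Phi>" "(r, s) \<in> poly_corr \<Phi>" "?u = h * p + r" "?v = k * q + s"
        "r = 0 \<or> degree r < degree p" by blast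
    have "u = (monom x n + h) * p + r" "v = (monom y n + k) * q + s"
      using *(3,4) by (simp_all add: algebra_simps)
    then show ?thesis using *(1,2,5) poly_corr_add[OF rc hk *(1)] by blast
  qed
qed

text \<open>The hypothesis says that sending p(a) to q(b) is well defined and injective; it is then
  a ring isomorphism, and fractions turn it into a field isomorphism.\<close>

lemma ring_corr_adjoin:
  assumes rc: "ring_corr \<Phi>"
    and iff: "\<And>p q. (p, q) \<in> poly_corr \<Phi> \<Longrightarrow> poly p a = 0 \<longleftrightarrow> poly q b = 0"
  shows "\<exists>\<Psi>. field_corr \<Psi> \<and> \<Phi> \<subseteq> \<Psi> \<and> (a, b) \<in> \<Psi>"
proof -
  define \<Psi> where "\<Psi> = {(poly p a, poly q b) | p q. (p, q) \<in> poly_corr \<Phi>}"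
  have "ring_corr \<Psi>"
    unfolding ring_corr_def
  proof (intro conjI allI impI)
    have "(pCons 1 0, pCons 1 0) \<in> poly_corr \<Phi>"
      by (intro poly_corr_pCons corr_one poly_corr_0 rc)
    then have "(poly [:1:] a, poly [:1:] b) \<in> \<Psi>" unfolding \<Psi>_def by blast
    then show "(1, 1) \<in> \<Psi>" by simp
    fix x y assume xy: "(x, y) \<in> \<Psi>"
    then show "x = 0 \<longleftrightarrow> y = 0" using iff by (auto simp: \<Psi>_def)
    fix x' y' assume xy': "(x', y') \<in> \<Psi>"
    from xy xy' obtain p q p' q' where
      *: "(p, q) \<in> poly_corr \<Phi>" "(p', q') \<in> poly_corr \<Phi>" "x = poly p a" "y = poly q b" "x' = poly p' a" "y' = poly q' b"
      unfolding \<Psi>_def by blast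
    then show "(x - x', y - y') \<in> \<Psi>" "(x * x', y * y') \<in> \<Psi>"
      using poly_corr_diff[OF rc *(1,2)] poly_corr_mult[OF rc *(1,2)]
      unfolding \<Psi>_def *(3-6) poly_diff[symmetric] poly_mult[symmetric] by blast+
  qed
  moreover have "\<Phi> \<subseteq> \<Psi>"
  proof
    fix p assume p: "p \<in> \<Phi>"
    obtain x y where [simp]: "p = (x, y)" by force
    have "([:x:], [:y:]) \<in> poly_corr \<Phi>" using p by (auto intro: poly_corr_pCons poly_corr_0 rc)
    then have "(poly [:x:] a, poly [:y:] b) \<in> \<Psi>" unfolding \<Psi>_def by blast
    then show "p \<in> \<Psi>" by simp
  qed
  moreover have "([:0, 1:], [:0, 1:]) \<in> poly_corr \<Phi>"
    by (intro poly_corr_pCons corr_one corr_zero poly_corr_0 rc)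
  then have "(poly [:0, 1:] a, poly [:0, 1:] b) \<in> \<Psi>" unfolding \<Psi>_def by blast
  then have "(a, b) \<in> \<Psi>" by simp
  ultimately show ?thesis using fraction_corr[of \<Psi>] by (metis subset_iff)
qed

text \<open>The classical extension step: carry the minimal polynomial of \<open>a\<close> across,
  take any complex root \<open>b\<close> of the image, and check that \<open>a\<close> and
  \<open>b\<close> satisfy corresponding equations.\<close>

lemma field_corr_extend:
  fixes a :: complex
  assumes fc: "field_corr \<Phi>" and ex: "(p0, q0) \<in> poly_corr \<Phi>" "p0 \<noteq> 0" "poly p0 a = 0"
  shows "\<exists>b \<Psi>. field_corr \<Psi> \<and> \<Phi> \<subseteq> \<Psi> \<and> (a, b) \<in> \<Psi>"
proof -
  note rc = field_corr_ring[OF fc]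
  define P where "P = (\<lambda>(p, q). (p, q) \<in> poly_corr \<Phi> \<and> p \<noteq> 0 \<and> poly p a = 0)"
  obtain p q where pq: "(p, q) \<in> poly_corr \<Phi>" "p \<noteq> 0" "poly p a = 0"
    and pmin: "\<And>u v. (u, v) \<in> poly_corr \<Phi> \<Longrightarrow> u \<noteq> 0 \<Longrightarrow> poly u a = 0 \<Longrightarrow> degree p \<le> degree u"
    using arg_min_nat_lemma[of P "(p0, q0)" "\<lambda>(p, q). degree p"] ex
    by (cases "arg_min (\<lambda>(p, q). degree p) P") (auto simp: P_def)
  have deg: "degree q = degree p" using poly_corr_degree[OF rc pq(1)] by simp
  have "degree p \<noteq> 0" using pq by (metis degree_eq_zeroE pCons_0_0 poly_const_conv)
  then have "\<not> constant (poly q)" using deg by (simp add: constant_degree)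
  then obtain b where b: "poly q b = 0" using fundamental_theorem_of_algebra by blast
  \<comment> \<open>A relation at \<open>b\<close> might a priori have smaller degree than
    \<open>q\<close>; a least one is chosen and then shown to vanish at \<open>a\<close> as
    well.\<close>
  define Q where "Q = (\<lambda>(p, q). (p, q) \<in> poly_corr \<Phi> \<and> q \<noteq> 0 \<and> poly q b = 0)"
  have q0: "q \<noteq> 0" using poly_corr_eq_0_iff[OF rc pq(1)] pq by simp
  obtain u v where uv: "(u, v) \<in> poly_corr \<Phi>" "v \<noteq> 0" "poly v b = 0"
    and vmin: "\<And>u' v'. (u', v') \<in> poly_corr \<Phi> \<Longrightarrow> v' \<noteq> 0 \<Longrightarrow> poly v' b = 0 \<Longrightarrow> degree v \<le> degree v'"
    using arg_min_nat_lemma[of Q "(p, q)" "\<lambda>(p, q). degree q"] pq b q0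
    by (cases "arg_min (\<lambda>(p, q). degree q) Q") (auto simp: Q_def)
  have u0: "u \<noteq> 0" and degv: "degree v = degree u"
    using poly_corr_eq_0_iff[OF rc uv(1)] poly_corr_degree[OF rc uv(1)] uv by auto
  have deg_uv: "degree v \<noteq> 0" using uv by (metis degree_eq_zeroE pCons_0_0 poly_const_conv)
  have div_left: "\<exists>h k. (h, k) \<in> poly_corr \<Phi> \<and> u' = h * p \<and> v' = k * q"
    if uv': "(u', v') \<in> poly_corr \<Phi>" and "poly u' a = 0" for u' v'
  proof -
    obtain h k r s where *: "(h, k) \<in> poly_corr \<Phi>" "(r, s) \<in> poly_corr \<Phi>" "u' = h * p + r" "v' = k * q + s"
        "r = 0 \<or> degree r < degree p"
      using poly_corr_divide[OF fc pq(1,2) uv'] by blast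
    have "poly r a = 0" using that * pq by simp
    then have "r = 0" using pmin[OF *(2)] *(5) by force
    then show ?thesis using * poly_corr_eq_0_iff[OF rc *(2)] by auto
  qed
  have div_right: "\<exists>h k. (h, k) \<in> poly_corr \<Phi> \<and> u' = h * u \<and> v' = k * v"
    if uv': "(u', v') \<in> poly_corr \<Phi>" and "poly v' b = 0" for u' v'
  proof -
    obtain h k r s where *: "(h, k) \<in> poly_corr \<Phi>" "(r, s) \<in> poly_corr \<Phi>" "u' = h * u + r" "v' = k * v + s"
        "r = 0 \<or> degree r < degree u"
      using poly_corr_divide[OF fc uv(1) u0 uv'] by blast
    have "poly s b = 0" using that * uv by simp
    then have "s = 0" using vmin[OF *(2)] *(5) degv poly_corr_eq_0_iff[OF rc *(2)] poly_corr_degree[OF rc *(2)]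
      by force
    then show ?thesis using * poly_corr_eq_0_iff[OF rc *(2)] by auto
  qed
  text \<open>The minimal relation of \<open>b\<close> divides \<open>p\<close>, hence already annihilates \<open>a\<close>.\<close>
  have "poly u a = 0"
  proof -
    obtain h k where hk: "(h, k) \<in> poly_corr \<Phi>" "p = h * u" "q = k * v"
      using div_right[OF pq(1) b] by blast
    have h0: "h \<noteq> 0" using hk pq by auto
    have "poly h a \<noteq> 0"
    proof
      assume "poly h a = 0"
      then have "degree p \<le> degree h" using pmin hk h0 by blast
      then show False using hk h0 u0 deg_uv degv by (simp add: degree_mult_eq)
    qed
    then show ?thesis using pq hk by auto
  qed
  then have "poly u' a = 0 \<longleftrightarrow> poly v' b = 0" if "(u', v') \<in> poly_corr \<Phi>" for u' v'
    using div_left[OF that] div_right[OF that] b by auto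
  then show ?thesis using ring_corr_adjoin[OF rc] by blast
qed


section \<open>Three-cycles survive radical extensions\<close>

lemma ring_of_type_algebra_simps:
  fixes x y :: "'a::field"
  shows "x \<otimes>\<^bsub>ring_of_type_algebra\<^esub> y = x * y"
    "x \<oplus>\<^bsub>ring_of_type_algebra\<^esub> y = x + y"
    "\<one>\<^bsub>ring_of_type_algebra\<^esub> = (1::'a)"
    "\<zero>\<^bsub>ring_of_type_algebra\<^esub> = (0::'a)"
    "carrier (ring_of_type_algebra :: 'a ring) = UNIV"
  by (simp_all add: ring_of_type_algebra_def)

lemma ring_of_type_algebra_uminus: "\<ominus>\<^bsub>ring_of_type_algebra\<^esub> (x::'a::field) = - x"
proof -
  interpret field "ring_of_type_algebra :: 'a ring" ..
  show ?thesis by (rule minus_equality) (simp_all add: ring_of_type_algebra_simps)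
qed

lemma ring_of_type_algebra_inverse:
  assumes "(x::'a::field) \<noteq> 0"
  shows "inv\<^bsub>ring_of_type_algebra\<^esub> x = inverse x"
proof -
  interpret field "ring_of_type_algebra :: 'a ring" ..
  show ?thesis
    by (rule comm_inv_char) (use assms in \<open>simp_all add: ring_of_type_algebra_simps\<close>)
qed

lemma generated_subfield_add:
  "(x::'a::field) \<in> generated_subfield S \<Longrightarrow> y \<in> generated_subfield S \<Longrightarrow> x + y \<in> generated_subfield S"
  using generate_field.eng_add[of x "ring_of_type_algebra :: 'a ring" S y]
  by (simp add: ring_of_type_algebra_simps)

lemma generated_subfield_mult:
  "(x::'a::field) \<in> generated_subfield S \<Longrightarrow> y \<in> generated_subfield S \<Longrightarrow> x * y \<in> generated_subfield S"
  using generate_field.eng_mult[of x "ring_of_type_algebra :: 'a ring" S y]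
  by (simp add: ring_of_type_algebra_simps)

lemma generated_subfield_uminus:
  "(x::'a::field) \<in> generated_subfield S \<Longrightarrow> - x \<in> generated_subfield S"
  using generate_field.a_inv[of x "ring_of_type_algebra :: 'a ring" S]
  by (simp add: ring_of_type_algebra_uminus)

lemma generated_subfield_inverse:
  assumes "(x::'a::field) \<in> generated_subfield S"
  shows "inverse x \<in> generated_subfield S"
proof (cases "x = 0")
  case True
  then show ?thesis using assms by simp
next
  case False
  then show ?thesis
    using generate_field.m_inv[OF assms] ring_of_type_algebra_inverse[of x]
    by (simp add: ring_of_type_algebra_simps)
qed

lemmas generated_subfield_closed =
  generated_subfield_add generated_subfield_mult generated_subfield_uminus generated_subfield_inverse

lemma generated_subfield_one: "(1::'a::field) \<in> generated_subfield S"
  using generate_field.one[of "ring_of_type_algebra :: 'a ring" S] by (simp add: ring_of_type_algebra_simps)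

lemma generated_subfield_induct [consumes 1, case_names one incl uminus inverse add mult]:
  assumes "(x::'a::field) \<in> generated_subfield S"
    and "P 1" "\<And>x. x \<in> S \<Longrightarrow> P x" "\<And>x. P x \<Longrightarrow> P (- x)" "\<And>x. P x \<Longrightarrow> P (inverse x)"
    "\<And>x y. P x \<Longrightarrow> P y \<Longrightarrow> P (x + y)" "\<And>x y. P x \<Longrightarrow> P y \<Longrightarrow> P (x * y)"
  shows "P x"
  using assms(1)
  by (induction rule: generate_field.induct)
    (auto simp: ring_of_type_algebra_simps ring_of_type_algebra_uminus ring_of_type_algebra_inverse
      intro: assms(2-))

lemma generated_subfield_incl: "x \<in> S \<Longrightarrow> x \<in> generated_subfield S"
  by (rule generate_field.incl)

lemma generated_subfield_least:
  fixes S T :: "'a::field set"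
  assumes "S \<subseteq> generated_subfield T"
  shows "generated_subfield S \<subseteq> generated_subfield T"
proof
  fix x assume "x \<in> generated_subfield S"
  then show "x \<in> generated_subfield T"
    by (induction rule: generated_subfield_induct)
      (use assms in \<open>auto intro: generated_subfield_one generated_subfield_closed\<close>)
qed

lemma generated_subfield_fixed:
  assumes fc: "field_corr \<Phi>" and "Id_on S \<subseteq> \<Phi>"
  shows "Id_on (generated_subfield S) \<subseteq> \<Phi>"
proof -
  note rc = field_corr_ring[OF fc]
  have "(x, x) \<in> \<Phi>" if "x \<in> generated_subfield S" for x
    using that
    by (induction rule: generated_subfield_induct)
      (use assms(2) in \<open>auto intro: corr_one[OF rc] corr_uminus[OF rc] corr_inverse[OF fc] corr_add[OF rc] corr_mult[OF rc]\<close>)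
  then show ?thesis by auto
qed

text \<open>For a five-element \<open>R\<close> this plays the role of "the Galois group over
  \<open>K\<close> contains the alternating group on \<open>R\<close>". Quantifying over all
  enumerations yields every 3-cycle.\<close>

definition three_cycles_over :: "'a::field set \<Rightarrow> 'a set \<Rightarrow> bool" where
  "three_cycles_over K R \<longleftrightarrow> (\<forall>a b c e f. R = {a, b, c, e, f} \<longrightarrow> distinct [a, b, c, e, f] \<longrightarrow>
     (\<exists>\<Phi>. field_corr \<Phi> \<and> Id_on K \<subseteq> \<Phi> \<and> {(a, b), (b, c), (c, a), (e, e), (f, f)} \<subseteq> \<Phi>))"

text \<open>Every 3-cycle on five letters is a commutator of two 3-cycles, and extensions of two
  correspondences which commute at \<open>x\<close> have a commutator that fixes \<open>x\<close>.\<close>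

lemma three_cycles_over_insert:
  assumes R: "three_cycles_over K R"
    and ext: "\<And>\<Phi> \<Psi>. field_corr \<Phi> \<Longrightarrow> field_corr \<Psi> \<Longrightarrow> Id_on K \<subseteq> \<Phi> \<Longrightarrow> Id_on K \<subseteq> \<Psi> \<Longrightarrow>
      \<exists>\<Phi>' \<Psi>' w. field_corr \<Phi>' \<and> field_corr \<Psi>' \<and> \<Phi> \<subseteq> \<Phi>' \<and> \<Psi> \<subseteq> \<Psi>' \<and>
        (x, w) \<in> \<Phi>' O \<Psi>' \<and> (x, w) \<in> \<Psi>' O \<Phi>'"
  shows "three_cycles_over (generated_subfield (insert x K)) R"
  unfolding three_cycles_over_def
proof (intro allI impI)
  fix a b c e f assume abc: "R = {a, b, c, e, f}" "distinct [a, b, c, e, f]"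
  \<comment> \<open>The two 3-cycles are (e a b) and (b f c), which share only \<open>b\<close>;
    their commutator is (a b c).\<close>
  have *: "R = {e, a, b, c, f}" "R = {b, f, c, a, e}" using abc by auto
  obtain \<Phi> where \<Phi>: "field_corr \<Phi>" "Id_on K \<subseteq> \<Phi>" "{(e, a), (a, b), (b, e), (c, c), (f, f)} \<subseteq> \<Phi>"
    using R[unfolded three_cycles_over_def, rule_format, OF *(1)] abc(2) by auto
  obtain \<Psi> where \<Psi>: "field_corr \<Psi>" "Id_on K \<subseteq> \<Psi>" "{(b, f), (f, c), (c, b), (a, a), (e, e)} \<subseteq> \<Psi>"
    using R[unfolded three_cycles_over_def, rule_format, OF *(2)] abc(2) by auto
  obtain \<Phi>' \<Psi>' w where ext': "field_corr \<Phi>'" "field_corr \<Psi>'" "\<Phi> \<subseteq> \<Phi>'" "\<Psi> \<subseteq> \<Psi>'"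
        "(x, w) \<in> \<Phi>' O \<Psi>'" "(x, w) \<in> \<Psi>' O \<Phi>'"
    using ext[OF \<Phi>(1) \<Psi>(1) \<Phi>(2) \<Psi>(2)] by blast
  have \<Phi>': "(e, a) \<in> \<Phi>'" "(a, b) \<in> \<Phi>'" "(b, e) \<in> \<Phi>'" "(c, c) \<in> \<Phi>'" "(f, f) \<in> \<Phi>'" "Id_on K \<subseteq> \<Phi>'"
    and \<Psi>': "(b, f) \<in> \<Psi>'" "(f, c) \<in> \<Psi>'" "(c, b) \<in> \<Psi>'" "(a, a) \<in> \<Psi>'" "(e, e) \<in> \<Psi>'" "Id_on K \<subseteq> \<Psi>'"
    using \<Phi> \<Psi> ext'(3,4) by auto
  define \<Theta> where "\<Theta> = (\<Phi>' O \<Psi>') O (\<Psi>' O \<Phi>')\<inverse>"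
  have \<Theta>: "field_corr \<Theta>"
    unfolding \<Theta>_def by (intro field_corr_relcomp field_corr_converse ext')
  have "(k, k) \<in> \<Theta>" if "k \<in> insert x K" for k
  proof (cases "k = x")
    case True
    then show ?thesis using ext'(5,6) unfolding \<Theta>_def by auto
  next
    case False
    then have "(k, k) \<in> \<Phi>'" "(k, k) \<in> \<Psi>'" using that \<Phi>'(6) \<Psi>'(6) by auto
    then show ?thesis unfolding \<Theta>_def by (meson converseI relcompI)
  qed
  then have "Id_on (generated_subfield (insert x K)) \<subseteq> \<Theta>"
    by (intro generated_subfield_fixed \<Theta>) auto
  moreover have comp: "(u, v) \<in> \<Theta>" if "(u, p) \<in> \<Phi>'" "(p, q) \<in> \<Psi>'" "(r, q) \<in> \<Phi>'" "(v, r) \<in> \<Psi>'" for u p q r v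
    unfolding \<Theta>_def using that by blast
  have "(a, b) \<in> \<Theta>" by (rule comp[OF \<Phi>'(2) \<Psi>'(1) \<Phi>'(5) \<Psi>'(1)])
  moreover have "(b, c) \<in> \<Theta>" by (rule comp[OF \<Phi>'(3) \<Psi>'(5) \<Phi>'(3) \<Psi>'(3)])
  moreover have "(c, a) \<in> \<Theta>" by (rule comp[OF \<Phi>'(4) \<Psi>'(3) \<Phi>'(2) \<Psi>'(4)])
  moreover have "(e, e) \<in> \<Theta>" by (rule comp[OF \<Phi>'(1) \<Psi>'(4) \<Phi>'(1) \<Psi>'(5)])
  moreover have "(f, f) \<in> \<Theta>" by (rule comp[OF \<Phi>'(5) \<Psi>'(2) \<Phi>'(4) \<Psi>'(2)])
  ultimately show "\<exists>\<Phi>. field_corr \<Phi> \<and> Id_on (generated_subfield (insert x K)) \<subseteq> \<Phi> \<and>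
      {(a, b), (b, c), (c, a), (e, e), (f, f)} \<subseteq> \<Phi>"
    using \<Theta> by (intro exI[of _ \<Theta>]) auto
qed

text \<open>\<open>a\<close> is a root of X^n - a^n, whose coefficients correspond to themselves, so
  its image is a root of the same polynomial.\<close>

lemma field_corr_extend_root:
  fixes a :: complex
  assumes fc: "field_corr \<Phi>" and n: "n > 0" and a: "(a ^ n, a ^ n) \<in> \<Phi>"
  obtains \<Psi> b where "field_corr \<Psi>" "\<Phi> \<subseteq> \<Psi>" "(a, b) \<in> \<Psi>" "b ^ n = a ^ n"
proof -
  note rc = field_corr_ring[OF fc]
  let ?p = "monom 1 n - [:a ^ n:]"
  have "(?p, ?p) \<in> poly_corr \<Phi>"
    by (intro poly_corr_diff poly_corr_monom poly_corr_pCons poly_corr_0 corr_one rc a)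
  moreover have "coeff ?p n = 1" using n by (cases n) auto
  then have "?p \<noteq> 0" by (metis coeff_0 zero_neq_one)
  moreover have "poly ?p a = 0" by (simp add: poly_monom)
  ultimately obtain b \<Psi> where *: "field_corr \<Psi>" "\<Phi> \<subseteq> \<Psi>" "(a, b) \<in> \<Psi>"
    using field_corr_extend[OF fc] by blast
  moreover have "(a ^ n, b ^ n) \<in> \<Psi>"
    using corr_power[OF field_corr_ring[OF *(1)] *(3)] .
  ultimately show thesis
    using that corr_left_unique[OF field_corr_ring[OF *(1)]] a by blast
qed

lemma root_of_unity_power:
  fixes z :: complex
  assumes "n > 0" "z ^ n = 1"
  obtains k where "z = cis (2 * pi / n) ^ k"
proof -
  have "z \<in> (\<lambda>k. cis (2 * pi * real k / real n)) ` {..<n}"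
    using bij_betw_roots_unity[OF assms(1)] assms(2) by (auto simp: bij_betw_def)
  then show thesis using that by (auto simp: Complex.DeMoivre mult.commute)
qed

text \<open>A primitive n-th root of unity is adjoined before \<open>a\<close>. Correspondences act
  on it by power maps, and once it is fixed they multiply \<open>a\<close> by roots of unity. Both
  actions commute, as \<open>three_cycles_over_insert\<close> demands.\<close>

lemma three_cycles_over_root:
  fixes a :: complex
  assumes R: "three_cycles_over K R" and n: "n > 0" and a: "a ^ n \<in> K"
  obtains K' where "three_cycles_over (generated_subfield K') R" "K \<subseteq> K'" "a \<in> K'"
proof -
  define \<zeta> where "\<zeta> = cis (2 * pi / n)"
  have \<zeta>n: "\<zeta> ^ n = 1" unfolding \<zeta>_def using n by (simp add: Complex.DeMoivre)
  have \<zeta>: "\<exists>k. z = \<zeta> ^ k" if "z ^ n = 1" for z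
    using root_of_unity_power[OF n that] unfolding \<zeta>_def by metis
  have 1: "three_cycles_over (generated_subfield (insert \<zeta> K)) R"
  proof (rule three_cycles_over_insert[OF R])
    fix \<Phi> \<Psi> :: "complex rel"
    assume fc: "field_corr \<Phi>" "field_corr \<Psi>"
    have ex: "\<exists>\<Phi>' i. field_corr \<Phi>' \<and> \<Phi> \<subseteq> \<Phi>' \<and> (\<zeta>, \<zeta> ^ i) \<in> \<Phi>'" if fc: "field_corr \<Phi>" for \<Phi>
    proof -
      obtain \<Phi>' b where *: "field_corr \<Phi>'" "\<Phi> \<subseteq> \<Phi>'" "(\<zeta>, b) \<in> \<Phi>'" "b ^ n = \<zeta> ^ n"
        using field_corr_extend_root[OF fc n, of \<zeta>] corr_one[OF field_corr_ring[OF fc]] \<zeta>n by metis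
      then show ?thesis using \<zeta>[of b] \<zeta>n by auto
    qed
    obtain \<Phi>' i where 1: "field_corr \<Phi>'" "\<Phi> \<subseteq> \<Phi>'" "(\<zeta>, \<zeta> ^ i) \<in> \<Phi>'" using ex[OF fc(1)] by blast
    obtain \<Psi>' j where 2: "field_corr \<Psi>'" "\<Psi> \<subseteq> \<Psi>'" "(\<zeta>, \<zeta> ^ j) \<in> \<Psi>'" using ex[OF fc(2)] by blast
    have "(\<zeta>, \<zeta> ^ (i * j)) \<in> \<Phi>' O \<Psi>'"
      using 1(3) corr_power[OF field_corr_ring[OF 2(1)] 2(3), of i]
      by (auto simp: mult.commute simp flip: power_mult)
    moreover have "(\<zeta>, \<zeta> ^ (i * j)) \<in> \<Psi>' O \<Phi>'"
      using 2(3) corr_power[OF field_corr_ring[OF 1(1)] 1(3), of j]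
      by (auto simp: mult.commute simp flip: power_mult)
    ultimately show "\<exists>\<Phi>' \<Psi>' w. field_corr \<Phi>' \<and> field_corr \<Psi>' \<and> \<Phi> \<subseteq> \<Phi>' \<and> \<Psi> \<subseteq> \<Psi>' \<and>
        (\<zeta>, w) \<in> \<Phi>' O \<Psi>' \<and> (\<zeta>, w) \<in> \<Psi>' O \<Phi>'"
      using 1 2 by blast
  qed
  define L where "L = generated_subfield (insert \<zeta> K)"
  have L: "a ^ n \<in> L" "\<zeta> \<in> L" "K \<subseteq> L"
    using a by (auto simp: L_def intro: generated_subfield_incl)
  have "three_cycles_over (generated_subfield (insert a L)) R"
  proof (rule three_cycles_over_insert[OF 1[folded L_def]])
    fix \<Phi> \<Psi> :: "complex rel"
    assume fc: "field_corr \<Phi>" "field_corr \<Psi>" and sub: "Id_on L \<subseteq> \<Phi>" "Id_on L \<subseteq> \<Psi>"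
    have ex: "\<exists>\<Phi>' i. field_corr \<Phi>' \<and> \<Phi> \<subseteq> \<Phi>' \<and> (a, \<zeta> ^ i * a) \<in> \<Phi>' \<and> (\<zeta>, \<zeta>) \<in> \<Phi>'"
      if fc: "field_corr \<Phi>" and sub: "Id_on L \<subseteq> \<Phi>" for \<Phi>
    proof -
      obtain \<Phi>' b where *: "field_corr \<Phi>'" "\<Phi> \<subseteq> \<Phi>'" "(a, b) \<in> \<Phi>'" "b ^ n = a ^ n"
        using field_corr_extend_root[OF fc n, of a] sub L by (metis Id_onI subsetD)
      have "\<exists>i. b = \<zeta> ^ i * a"
      proof (cases "a = 0")
        case True
        then show ?thesis using * n by (auto simp: power_0_left)
      next
        case False
        then have "(b / a) ^ n = 1" using * by (simp add: power_divide)
        then show ?thesis using \<zeta>[of "b / a"] False by (auto simp: divide_eq_eq)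
      qed
      then show ?thesis using * sub L by (metis Id_onI subsetD)
    qed
    obtain \<Phi>' i where 1: "field_corr \<Phi>'" "\<Phi> \<subseteq> \<Phi>'" "(a, \<zeta> ^ i * a) \<in> \<Phi>'" "(\<zeta>, \<zeta>) \<in> \<Phi>'"
      using ex[OF fc(1) sub(1)] by blast
    obtain \<Psi>' j where 2: "field_corr \<Psi>'" "\<Psi> \<subseteq> \<Psi>'" "(a, \<zeta> ^ j * a) \<in> \<Psi>'" "(\<zeta>, \<zeta>) \<in> \<Psi>'"
      using ex[OF fc(2) sub(2)] by blast
    have "(\<zeta> ^ i * a, \<zeta> ^ i * (\<zeta> ^ j * a)) \<in> \<Psi>'" "(\<zeta> ^ j * a, \<zeta> ^ j * (\<zeta> ^ i * a)) \<in> \<Phi>'"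
      by (intro corr_mult corr_power field_corr_ring 1 2)+
    then have "(a, \<zeta> ^ i * (\<zeta> ^ j * a)) \<in> \<Phi>' O \<Psi>'" "(a, \<zeta> ^ i * (\<zeta> ^ j * a)) \<in> \<Psi>' O \<Phi>'"
      using 1(3) 2(3) by (auto simp: mult.left_commute)
    then show "\<exists>\<Phi>' \<Psi>' w. field_corr \<Phi>' \<and> field_corr \<Psi>' \<and> \<Phi> \<subseteq> \<Phi>' \<and> \<Psi> \<subseteq> \<Psi>' \<and>
        (a, w) \<in> \<Phi>' O \<Psi>' \<and> (a, w) \<in> \<Psi>' O \<Phi>'"
      using 1 2 by blast
  qed
  then show thesis using that[of "insert a L"] L by blast
qed

text \<open>The tower over \<open>F\<close> is absorbed into a growing field that keeps all
  3-cycles. The starting field may be larger than \<open>F\<close>, so that several towers over the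
  same base can be absorbed one after another.\<close>

lemma three_cycles_over_radical_extension:
  fixes F :: "complex set"
  assumes "radical_extension F L" and "three_cycles_over (generated_subfield K) R" "F \<subseteq> generated_subfield K"
  shows "\<exists>K'. three_cycles_over (generated_subfield K') R \<and> generated_subfield K \<subseteq> generated_subfield K' \<and> L \<subseteq> generated_subfield K'"
  using assms(1)
proof (induction rule: radical_extension.induct)
  case base
  then show ?case using assms(2,3) by blast
next
  case (adjoin_root L n a)
  then obtain K1 where K1: "three_cycles_over (generated_subfield K1) R"
      "generated_subfield K \<subseteq> generated_subfield K1" "L \<subseteq> generated_subfield K1" by blast
  then have "a ^ n \<in> generated_subfield K1" using adjoin_root by blast
  from three_cycles_over_root[OF K1(1) \<open>n > 0\<close> this] obtain K2 where
    K2: "three_cycles_over (generated_subfield K2) R" "generated_subfield K1 \<subseteq> K2" "a \<in> K2" by blast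
  have sub: "K2 \<subseteq> generated_subfield K2" by (auto intro: generated_subfield_incl)
  have "generated_subfield (insert a L) \<subseteq> generated_subfield K2"
    using K1 K2 sub by (intro generated_subfield_least) blast
  then show ?case using K1 K2 sub by (meson subset_trans)
qed

text \<open>An element of \<open>R\<close> inside \<open>K\<close> would be fixed by a
  correspondence that moves it to another element.\<close>

lemma three_cycles_over_disjoint:
  assumes "three_cycles_over K R" "card R = 5"
  shows "K \<inter> R = {}"
proof (rule ccontr)
  assume "K \<inter> R \<noteq> {}"
  then obtain a where a: "a \<in> K" "a \<in> R" by blast
  have "card (R - {a}) = 4" using assms(2) a by (simp add: card_Diff_singleton)
  then obtain b c e f where bcef: "R - {a} = {b, c, e, f}" "distinct [b, c, e, f]"
    by (auto simp: numeral_eq_Suc card_Suc_eq)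
  then have "R = {a, b, c, e, f}" "distinct [a, b, c, e, f]" using a by auto
  then obtain \<Phi> where "field_corr \<Phi>" "Id_on K \<subseteq> \<Phi>" "(a, b) \<in> \<Phi>"
    using assms(1) unfolding three_cycles_over_def by (metis insert_subset)
  then have "a = b" using a corr_left_unique[OF field_corr_ring] by blast
  then show False using bcef(1) by blast
qed


section \<open>Irreducible quintics with three real roots\<close>

lemma field_corr_Id_on_generated_subfield: "field_corr (Id_on (generated_subfield S))"
proof -
  have "x - y \<in> generated_subfield S" if "x \<in> generated_subfield S" "y \<in> generated_subfield S" for x y
    using generated_subfield_add[OF that(1) generated_subfield_uminus[OF that(2)]] by simp
  then show ?thesis
    unfolding field_corr_def ring_corr_def
    by (auto intro: generated_subfield_one generated_subfield_closed)
qed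

lemma field_corr_cnj: "field_corr {(x, cnj x) | x. True}"
  unfolding field_corr_def ring_corr_def by (auto simp flip: complex_cnj_inverse)

lemma corr_poly:
  assumes rc: "ring_corr \<Phi>" and "(p, q) \<in> poly_corr \<Phi>" "(x, y) \<in> \<Phi>"
  shows "(poly p x, poly q y) \<in> \<Phi>"
proof -
  have "degree p = degree q" using poly_corr_degree[OF rc assms(2)] .
  then show ?thesis
    using assms unfolding poly_altdef poly_corr_def
    by (auto intro!: corr_sum[OF rc] corr_mult[OF rc] corr_power[OF rc])
qed

lemma poly_corr_fixed:
  assumes "Id_on K \<subseteq> \<Phi>" "\<And>i. coeff p i \<in> K"
  shows "(p, p) \<in> poly_corr \<Phi>"
  using assms by (auto simp: poly_corr_def)

lemma field_corr_extend_finite: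
  fixes f :: "complex poly"
  assumes "finite A" "field_corr \<Phi>" "(f, g) \<in> poly_corr \<Phi>" "f \<noteq> 0" "\<And>x. x \<in> A \<Longrightarrow> poly f x = 0"
  shows "\<exists>\<Psi>. field_corr \<Psi> \<and> \<Phi> \<subseteq> \<Psi> \<and> A \<subseteq> Domain \<Psi>"
  using assms(1,5)
proof (induction A rule: finite_induct)
  case empty
  then show ?case using assms(2) by blast
next
  case (insert a A)
  then obtain \<Psi> where \<Psi>: "field_corr \<Psi>" "\<Phi> \<subseteq> \<Psi>" "A \<subseteq> Domain \<Psi>" by auto
  have "(f, g) \<in> poly_corr \<Psi>" using assms(3) \<Psi>(2) by (auto simp: poly_corr_def)
  then obtain b \<Theta> where "field_corr \<Theta>" "\<Psi> \<subseteq> \<Theta>" "(a, b) \<in> \<Theta>"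
    using field_corr_extend[OF \<Psi>(1) _ assms(4)] insert.prems by blast
  then show ?case using \<Psi> by blast
qed

text \<open>Irreducibility in the form in which it is used: up to a scalar, \<open>f\<close> is the
  minimal polynomial of each of its roots.\<close>

locale irreducible_over =
  fixes S :: "complex set" and f :: "complex poly"
  assumes coeffs: "coeff f i \<in> generated_subfield S"
    and nonzero: "f \<noteq> 0"
    and minimal: "\<lbrakk>\<And>i. coeff p i \<in> generated_subfield S; p \<noteq> 0; poly p x = 0; poly f x = 0\<rbrakk>
      \<Longrightarrow> degree f \<le> degree p"
begin

abbreviation K where "K \<equiv> generated_subfield S"

definition roots where "roots = {x. poly f x = 0}"

lemma finite_roots: "finite roots"
  unfolding roots_def using nonzero by (rule poly_roots_finite)

text \<open>A polynomial over \<open>K\<close> that vanishes at one root of \<open>f\<close> is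
  divisible by \<open>f\<close>, so any two roots satisfy the same equations over
  \<open>K\<close>.\<close>

lemma transitive:
  assumes "x \<in> roots" "y \<in> roots"
  obtains \<Phi> where "field_corr \<Phi>" "Id_on K \<subseteq> \<Phi>" "(x, y) \<in> \<Phi>"
proof -
  note fc = field_corr_Id_on_generated_subfield[of S]
  have f: "(f, f) \<in> poly_corr (Id_on K)"
    by (rule poly_corr_fixed[OF order_refl coeffs])
  have *: "poly p y = 0" if p: "(p, q) \<in> poly_corr (Id_on K)" and x: "poly p x = 0" "poly f x = 0" and y: "poly f y = 0"
    for p q x y
  proof -
    obtain h k r s where hk: "(h, k) \<in> poly_corr (Id_on K)" "(r, s) \<in> poly_corr (Id_on K)" "p = h * f + r"
      "r = 0 \<or> degree r < degree f"
      using poly_corr_divide[OF fc f nonzero p] by blast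
    have "poly r x = 0" using x hk(3) by simp
    moreover have "coeff r i \<in> K" for i using hk(2) by (auto simp: poly_corr_def)
    ultimately have "r = 0" using minimal[of r x] x hk(4) by fastforce
    then show ?thesis using hk(3) y by simp
  qed
  have "p = q" if "(p, q) \<in> poly_corr (Id_on K)" for p q
    using that by (auto simp: poly_corr_def poly_eq_iff Id_on_iff)
  then have "poly p x = 0 \<longleftrightarrow> poly q y = 0" if "(p, q) \<in> poly_corr (Id_on K)" for p q
    using *[OF that, of x y] *[OF that, of y x] assms that unfolding roots_def by auto
  then show thesis using ring_corr_adjoin[OF field_corr_ring[OF fc]] that by blast
qed

lemma transitive_permutation:
  assumes "x \<in> roots" "y \<in> roots"
  obtains \<Phi> \<sigma> where "field_corr \<Phi>" "Id_on K \<subseteq> \<Phi>" "\<sigma> x = y" "bij_betw \<sigma> roots roots"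
    "\<And>w. w \<in> roots \<Longrightarrow> (w, \<sigma> w) \<in> \<Phi>"
proof -
  obtain \<Phi> where \<Phi>: "field_corr \<Phi>" "Id_on K \<subseteq> \<Phi>" "(x, y) \<in> \<Phi>"
    using transitive[OF assms] .
  obtain \<Psi> where \<Psi>: "field_corr \<Psi>" "\<Phi> \<subseteq> \<Psi>" "roots \<subseteq> Domain \<Psi>"
    using field_corr_extend_finite[OF finite_roots \<Phi>(1) poly_corr_fixed[OF \<Phi>(2) coeffs] nonzero]
    unfolding roots_def by blast
  note rc = field_corr_ring[OF \<Psi>(1)]
  have K: "Id_on K \<subseteq> \<Psi>" using \<Phi> \<Psi> by blast
  \<comment> \<open>The choice is determined on the roots because \<Psi> is single-valued;
    injectivity on a finite set mapped to itself makes it a permutation.\<close>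
  define \<sigma> where "\<sigma> w = (SOME v. (w, v) \<in> \<Psi>)" for w
  have \<sigma>: "(w, \<sigma> w) \<in> \<Psi>" if "w \<in> roots" for w
    using \<Psi>(3) that unfolding \<sigma>_def by (meson DomainE someI subsetD)
  have into: "\<sigma> w \<in> roots" if "w \<in> roots" for w
    using corr_poly[OF rc poly_corr_fixed[OF K coeffs] \<sigma>[OF that]] corr_eq_0_iff[OF rc] that
    unfolding roots_def by blast
  have "inj_on \<sigma> roots"
    by (rule inj_onI) (metis \<sigma> corr_right_unique[OF rc])
  then have "bij_betw \<sigma> roots roots"
    using into endo_inj_surj[OF finite_roots, of \<sigma>] by (auto simp: bij_betw_def)
  moreover have "\<sigma> x = y" using corr_left_unique[OF rc \<sigma>[OF assms(1)]] \<Phi> \<Psi> by blast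
  ultimately show thesis using that \<Psi>(1) K \<sigma> by blast
qed

definition swaps where
  "swaps x y \<longleftrightarrow> (\<exists>\<Phi>. field_corr \<Phi> \<and> Id_on K \<subseteq> \<Phi> \<and> (x, y) \<in> \<Phi> \<and> (y, x) \<in> \<Phi> \<and>
     (\<forall>w\<in>roots - {x, y}. (w, w) \<in> \<Phi>))"

lemma swaps_refl: "swaps x x"
proof -
  have "field_corr (Id :: complex rel)"
    unfolding field_corr_def ring_corr_def by auto
  then show ?thesis unfolding swaps_def by (intro exI[of _ Id]) auto
qed

lemma swaps_sym: "swaps x y \<Longrightarrow> swaps y x"
  unfolding swaps_def by (simp add: insert_commute conj_commute conj_left_commute)

text \<open>Conjugation: (x y)(y z)(x y) is the transposition (x z).\<close>

lemma swaps_trans: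
  assumes "swaps x y" "swaps y z" "x \<in> roots" "y \<in> roots" "z \<in> roots"
  shows "swaps x z"
proof (cases "x = y \<or> y = z \<or> x = z")
  case True
  then show ?thesis using assms swaps_refl by auto
next
  case False
  obtain \<Phi> where \<Phi>: "field_corr \<Phi>" "Id_on K \<subseteq> \<Phi>" "(x, y) \<in> \<Phi>" "(y, x) \<in> \<Phi>" "\<And>w. w \<in> roots - {x, y} \<Longrightarrow> (w, w) \<in> \<Phi>"
    using assms(1) unfolding swaps_def by blast
  obtain \<Psi> where \<Psi>: "field_corr \<Psi>" "Id_on K \<subseteq> \<Psi>" "(y, z) \<in> \<Psi>" "(z, y) \<in> \<Psi>" "\<And>w. w \<in> roots - {y, z} \<Longrightarrow> (w, w) \<in> \<Psi>"
    using assms(2) unfolding swaps_def by blast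
  have z: "(z, z) \<in> \<Phi>" and x: "(x, x) \<in> \<Psi>" using \<Phi>(5) \<Psi>(5) assms False by auto
  let ?\<Theta> = "(\<Phi> O \<Psi>) O \<Phi>"
  have "field_corr ?\<Theta>" by (intro field_corr_relcomp \<Phi> \<Psi>)
  moreover have "(w, w) \<in> ?\<Theta>" if "(w, w) \<in> \<Phi>" "(w, w) \<in> \<Psi>" for w using that by blast
  then have "Id_on K \<subseteq> ?\<Theta>" using \<Phi>(2) \<Psi>(2) by blast
  moreover have "(x, z) \<in> ?\<Theta>" "(z, x) \<in> ?\<Theta>" using \<Phi>(3,4) \<Psi>(3,4) z by blast+
  moreover have "(w, w) \<in> ?\<Theta>" if "w \<in> roots - {x, z}" for w
  proof (cases "w = y")
    case True
    then show ?thesis using \<Phi>(3,4) x by blast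
  next
    case False
    then show ?thesis using \<Phi>(5)[of w] \<Psi>(5)[of w] that by blast
  qed
  ultimately show ?thesis unfolding swaps_def by blast
qed

lemma swaps_conjugate:
  assumes "swaps x y" "x \<in> roots" "y \<in> roots" and \<Psi>: "field_corr \<Psi>" "Id_on K \<subseteq> \<Psi>" "bij_betw \<sigma> roots roots"
    "\<And>w. w \<in> roots \<Longrightarrow> (w, \<sigma> w) \<in> \<Psi>"
  shows "swaps (\<sigma> x) (\<sigma> y)"
proof -
  obtain \<Phi> where \<Phi>: "field_corr \<Phi>" "Id_on K \<subseteq> \<Phi>" "(x, y) \<in> \<Phi>" "(y, x) \<in> \<Phi>" "\<And>w. w \<in> roots - {x, y} \<Longrightarrow> (w, w) \<in> \<Phi>"
    using assms(1) unfolding swaps_def by blast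
  let ?\<Theta> = "(\<Psi>\<inverse> O \<Phi>) O \<Psi>"
  have "field_corr ?\<Theta>" by (intro field_corr_relcomp field_corr_converse \<Phi> \<Psi>)
  moreover have \<Theta>: "(v', w') \<in> ?\<Theta>" if "(v, v') \<in> \<Psi>" "(w, w') \<in> \<Psi>" "(v, w) \<in> \<Phi>" for v v' w w'
    using that by blast
  then have "Id_on K \<subseteq> ?\<Theta>" using \<Phi>(2) \<Psi>(2) by blast
  moreover have "(\<sigma> x, \<sigma> y) \<in> ?\<Theta>" "(\<sigma> y, \<sigma> x) \<in> ?\<Theta>"
    using \<Theta> \<Phi>(3,4) \<Psi>(4)[OF assms(2)] \<Psi>(4)[OF assms(3)] by blast+
  moreover have "(w', w') \<in> ?\<Theta>" if "w' \<in> roots - {\<sigma> x, \<sigma> y}" for w'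
  proof -
    obtain w where "w \<in> roots" "w' = \<sigma> w"
      using \<Psi>(3) \<open>w' \<in> roots - {\<sigma> x, \<sigma> y}\<close> unfolding bij_betw_def by blast
    then show ?thesis using that \<Theta>[OF \<Psi>(4) \<Psi>(4), of w w] \<Phi>(5)[of w] by blast
  qed
  ultimately show ?thesis unfolding swaps_def by blast
qed

text \<open>\<open>swaps\<close> is an equivalence relation on the roots. Transitivity of the action
  makes its classes equally large, so their size divides the prime number of roots; one class has
  two elements, hence there is a single class.\<close>

lemma swaps_all:
  assumes card: "prime (card roots)" and wv: "swaps w v" "w \<noteq> v" "w \<in> roots" "v \<in> roots"
    and xy: "x \<in> roots" "y \<in> roots"
  shows "swaps x y"
proof -
  define r where "r = {(x, y). x \<in> roots \<and> y \<in> roots \<and> swaps x y}"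
  have eq: "equiv roots r"
    by (rule equivI) (auto simp: r_def refl_on_def sym_def trans_def intro: swaps_refl swaps_sym swaps_trans)
  have le: "card (r `` {x}) \<le> card (r `` {y})" if xy: "x \<in> roots" "y \<in> roots" for x y
  proof -
    obtain \<Phi> \<sigma> where \<Phi>: "field_corr \<Phi>" "Id_on K \<subseteq> \<Phi>" "\<sigma> x = y" "bij_betw \<sigma> roots roots"
      "\<And>w. w \<in> roots \<Longrightarrow> (w, \<sigma> w) \<in> \<Phi>"
      using transitive_permutation[OF xy] by metis
    have sub: "r `` {x} \<subseteq> roots" "r `` {y} \<subseteq> roots" by (auto simp: r_def)
    have "\<sigma> ` (r `` {x}) \<subseteq> r `` {y}"
    proof
      fix u assume "u \<in> \<sigma> ` (r `` {x})"
      then obtain z where z: "u = \<sigma> z" "z \<in> roots" "swaps x z" by (auto simp: r_def)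
      have "\<sigma> z \<in> roots" using \<Phi>(4) z(2) by (auto simp: bij_betw_def)
      then show "u \<in> r `` {y}"
        using swaps_conjugate[OF z(3) xy(1) z(2) \<Phi>(1,2,4,5)] \<Phi>(3) z(1) xy by (auto simp: r_def)
    qed
    then have "card (\<sigma> ` (r `` {x})) \<le> card (r `` {y})"
      using finite_subset[OF sub(2) finite_roots] by (rule card_mono[rotated])
    moreover have "inj_on \<sigma> (r `` {x})"
      using \<Phi>(4) sub(1) unfolding bij_betw_def by (meson inj_on_subset)
    ultimately show ?thesis by (simp add: card_image)
  qed
  then have eq_card: "card (r `` {x}) = card (r `` {w})" if "x \<in> roots" for x
    using that wv(3) by (meson order_antisym)
  have "card (r `` {w}) dvd card roots"
    by (rule equiv_imp_dvd_card[OF finite_roots eq]) (auto simp: quotient_def eq_card)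
  moreover have "card (r `` {w}) \<noteq> 1"
  proof
    assume "card (r `` {w}) = 1"
    then obtain u where u: "r `` {w} = {u}" by (rule card_1_singletonE)
    have "w \<in> r `` {w}" "v \<in> r `` {w}" using wv swaps_refl by (auto simp: r_def)
    then show False using wv(2) unfolding u by simp
  qed
  ultimately have "card (r `` {x}) = card roots"
    using card eq_card[OF xy(1)] by (metis prime_nat_iff)
  then have "r `` {x} = roots"
    by (intro card_subset_eq finite_roots) (auto simp: r_def)
  then show ?thesis using xy by (auto simp: r_def)
qed

lemma three_cycles:
  assumes "card roots = 5" and wv: "swaps w v" "w \<noteq> v" "w \<in> roots" "v \<in> roots"
  shows "three_cycles_over K roots"
  unfolding three_cycles_over_def
proof (intro allI impI)
  fix a b c e g assume abc: "roots = {a, b, c, e, g}" "distinct [a, b, c, e, g]"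
  have "prime (card roots)" using assms(1) by simp
  from swaps_all[OF this wv] have sw: "swaps a b" "swaps a c" using abc(1) by auto
  obtain \<Phi> where \<Phi>: "field_corr \<Phi>" "Id_on K \<subseteq> \<Phi>" "(a, b) \<in> \<Phi>" "(b, a) \<in> \<Phi>" "\<And>w. w \<in> roots - {a, b} \<Longrightarrow> (w, w) \<in> \<Phi>"
    using sw(1) unfolding swaps_def by blast
  obtain \<Psi> where \<Psi>: "field_corr \<Psi>" "Id_on K \<subseteq> \<Psi>" "(a, c) \<in> \<Psi>" "(c, a) \<in> \<Psi>" "\<And>w. w \<in> roots - {a, c} \<Longrightarrow> (w, w) \<in> \<Psi>"
    using sw(2) unfolding swaps_def by blast
  have "(c, c) \<in> \<Phi>" "(e, e) \<in> \<Phi>" "(g, g) \<in> \<Phi>" "(b, b) \<in> \<Psi>" "(e, e) \<in> \<Psi>" "(g, g) \<in> \<Psi>"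
    using \<Phi>(5) \<Psi>(5) abc by auto
  \<comment> \<open>The transposition (a b) followed by (a c) is the 3-cycle a, b, c.\<close>
  then have "{(a, b), (b, c), (c, a), (e, e), (g, g)} \<subseteq> \<Phi> O \<Psi>"
    using \<Phi>(3,4) \<Psi>(3,4) by blast
  moreover have "Id_on K \<subseteq> \<Phi> O \<Psi>" using \<Phi>(2) \<Psi>(2) by blast
  ultimately show "\<exists>\<Phi>. field_corr \<Phi> \<and> Id_on K \<subseteq> \<Phi> \<and> {(a, b), (b, c), (c, a), (e, e), (g, g)} \<subseteq> \<Phi>"
    using field_corr_relcomp[OF \<Phi>(1) \<Psi>(1)] by blast
qed

text \<open>Complex conjugation fixes \<open>K\<close> and the real roots, so on the roots it is the
  transposition of \<open>w\<close> and \<open>cnj w\<close>.\<close>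

lemma three_cycles_real:
  assumes "S \<subseteq> \<real>" "card roots = 5" "w \<in> roots" "w \<notin> \<real>" "roots - {w, cnj w} \<subseteq> \<real>"
  shows "three_cycles_over K roots"
proof -
  define C where "C = {(x, cnj x) | x. True}"
  have C: "field_corr C" unfolding C_def by (rule field_corr_cnj)
  have re: "(x, x) \<in> C" if "x \<in> \<real>" for x
    using that unfolding C_def by (auto simp: Reals_cnj_iff)
  then have K: "Id_on K \<subseteq> C" using assms(1) by (intro generated_subfield_fixed C) auto
  have wC: "(w, cnj w) \<in> C" "(cnj w, w) \<in> C" unfolding C_def by (auto intro: exI[of _ "cnj w"])
  have "swaps w (cnj w)"
    unfolding swaps_def using C K wC re assms(5) by blast
  moreover have "cnj w \<in> roots"
    using corr_poly[OF field_corr_ring[OF C] poly_corr_fixed[OF K coeffs] wC(1)]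
      corr_eq_0_iff[OF field_corr_ring[OF C]] assms(3) unfolding roots_def by blast
  moreover have "w \<noteq> cnj w" using assms(4) by (metis Reals_cnj_iff)
  ultimately show ?thesis using three_cycles assms(2,3) by blast
qed

end


section \<open>Generic points\<close>

text \<open>Integer polynomials as syntax: there are countably many of them, and the same expression
  can be evaluated over the integers, reals and complex numbers.\<close>

datatype int_poly_expr =
  Const int | Var nat | Add int_poly_expr int_poly_expr | Mult int_poly_expr int_poly_expr

instance int_poly_expr :: countable
  by countable_datatype

primrec expr_eval :: "(nat \<Rightarrow> 'a::comm_ring_1) \<Rightarrow> int_poly_expr \<Rightarrow> 'a" where
  "expr_eval z (Const c) = of_int c"
| "expr_eval z (Var i) = z i"
| "expr_eval z (Add e e') = expr_eval z e + expr_eval z e'"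
| "expr_eval z (Mult e e') = expr_eval z e * expr_eval z e'"

primrec expr_subst :: "(nat \<Rightarrow> int_poly_expr) \<Rightarrow> int_poly_expr \<Rightarrow> int_poly_expr" where
  "expr_subst \<sigma> (Const c) = Const c"
| "expr_subst \<sigma> (Var i) = \<sigma> i"
| "expr_subst \<sigma> (Add e e') = Add (expr_subst \<sigma> e) (expr_subst \<sigma> e')"
| "expr_subst \<sigma> (Mult e e') = Mult (expr_subst \<sigma> e) (expr_subst \<sigma> e')"

lemma expr_eval_subst: "expr_eval z (expr_subst \<sigma> e) = expr_eval (\<lambda>i. expr_eval z (\<sigma> i)) e"
  by (induction e) auto

lemma expr_eval_subst_Const:
  "expr_eval z (expr_subst (Var(n := Const c)) e) = expr_eval (z(n := of_int c)) e"
  unfolding expr_eval_subst by (rule arg_cong[where f = "\<lambda>z. expr_eval z e"]) auto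

lemma expr_eval_of_int: "expr_eval (\<lambda>i. of_int (z i)) e = of_int (expr_eval z e)"
  by (induction e) auto

lemma expr_eval_of_real: "expr_eval (\<lambda>i. complex_of_real (z i)) e = complex_of_real (expr_eval z e)"
  by (induction e) auto

lemma expr_eval_univariate: "\<exists>p. \<forall>t. expr_eval (z(i := t)) e = poly p (t :: 'a::comm_ring_1)"
proof (induction e)
  case (Const c)
  then show ?case by (intro exI[of _ "[:of_int c:]"]) simp
next
  case (Var j)
  then show ?case by (cases "j = i") (auto intro: exI[of _ "[:0, 1:]"] exI[of _ "[:z j:]"])
next
  case (Add e e')
  then show ?case by (auto simp flip: poly_add)
next
  case (Mult e e')
  then show ?case by (auto simp flip: poly_mult)
qed

lemma expr_eval_zero_infinite:
  fixes t :: "'a::idom"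
  assumes "infinite A" "\<And>s. s \<in> A \<Longrightarrow> expr_eval (z(i := s)) e = 0"
  shows "expr_eval (z(i := t)) e = 0"
proof -
  obtain p where p: "\<And>t. expr_eval (z(i := t)) e = poly p t"
    using expr_eval_univariate[of z i e] by blast
  have "A \<subseteq> {s. poly p s = 0}" using assms(2) p by auto
  then have "p = 0" using assms(1) poly_roots_finite[of p] finite_subset by blast
  then show ?thesis using p by simp
qed

lemma expr_eval_finitely_many_variables:
  "\<exists>n. \<forall>z z' :: nat \<Rightarrow> 'a::comm_ring_1. (\<forall>i<n. z i = z' i) \<longrightarrow> expr_eval z e = expr_eval z' e"
proof (induction e)
  case (Var i)
  then show ?case by (intro exI[of _ "Suc i"]) auto
next
  case (Add e e')
  then obtain n m where "\<forall>z z' :: nat \<Rightarrow> 'a. (\<forall>i<n. z i = z' i) \<longrightarrow> expr_eval z e = expr_eval z' e"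
    "\<forall>z z' :: nat \<Rightarrow> 'a. (\<forall>i<m. z i = z' i) \<longrightarrow> expr_eval z e' = expr_eval z' e'" by blast
  then show ?case by (intro exI[of _ "max n m"]) (auto simp: less_max_iff_disj intro!: arg_cong2[where f = "(+)"])
next
  case (Mult e e')
  then obtain n m where "\<forall>z z' :: nat \<Rightarrow> 'a. (\<forall>i<n. z i = z' i) \<longrightarrow> expr_eval z e = expr_eval z' e"
    "\<forall>z z' :: nat \<Rightarrow> 'a. (\<forall>i<m. z i = z' i) \<longrightarrow> expr_eval z e' = expr_eval z' e'" by blast
  then show ?case by (intro exI[of _ "max n m"]) (auto simp: less_max_iff_disj intro!: arg_cong2[where f = "(*)"])
qed auto

text \<open>Coordinates are released from the grid one at a time, each by the finiteness of the
  roots of a one-variable polynomial. Finitely many releases suffice, as \<open>e\<close> involves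
  finitely many variables.\<close>

lemma expr_eval_zero_grid:
  fixes z :: "nat \<Rightarrow> 'a::idom" and A :: "nat \<Rightarrow> 'a set"
  assumes inf: "\<And>i. infinite (A i)" and zero: "\<And>z. (\<And>i. z i \<in> A i) \<Longrightarrow> expr_eval z e = 0"
  shows "expr_eval z e = 0"
proof -
  have *: "\<forall>z. (\<forall>i\<ge>n. z i \<in> A i) \<longrightarrow> expr_eval z e = 0" for n
  proof (induction n)
    case 0
    then show ?case using zero by simp
  next
    case (Suc n)
    show ?case
    proof (intro allI impI)
      fix z assume z: "\<forall>i\<ge>Suc n. z i \<in> A i"
      have "expr_eval (z(n := s)) e = 0" if "s \<in> A n" for s
        by (rule Suc.IH[rule_format]) (use z that in \<open>simp add: Suc_le_eq\<close>)
      then have "expr_eval (z(n := z n)) e = 0"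
        by (rule expr_eval_zero_infinite[OF inf])
      then show "expr_eval z e = 0" by simp
    qed
  qed
  obtain n where n: "\<And>z' :: nat \<Rightarrow> 'a. (\<And>i. i < n \<Longrightarrow> z i = z' i) \<Longrightarrow> expr_eval z e = expr_eval z' e"
    using expr_eval_finitely_many_variables[of e, where ?'a = 'a] by blast
  have "\<exists>a. a \<in> A i" for i using inf[of i] by (metis ex_in_conv finite.emptyI)
  then obtain a where a: "\<And>i. a i \<in> A i" by metis
  show ?thesis using n[of "\<lambda>i. if i < n then z i else a i"] *[of n, rule_format, of "\<lambda>i. if i < n then z i else a i"] a
    by simp
qed

text \<open>Independence of the first \<open>n\<close> coordinates in the form "a relation at the
  point is an identity"; the zeros from \<open>n\<close> on are padding, since points are functions
  on all natural numbers.\<close>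

definition generic_point :: "nat \<Rightarrow> (nat \<Rightarrow> 'a::field_char_0) \<Rightarrow> bool" where
  "generic_point n x \<longleftrightarrow> (\<forall>i\<ge>n. x i = 0) \<and>
     (\<forall>e. expr_eval x e = 0 \<longrightarrow> (\<forall>z :: nat \<Rightarrow> complex. (\<forall>i\<ge>n. z i = 0) \<longrightarrow> expr_eval z e = 0))"

text \<open>Given generic earlier coordinates, each of the countably many expressions that do not
  vanish identically in the next coordinate forbids finitely many values of it, and an interval is
  uncountable.\<close>

lemma ex_generic_point:
  fixes a b :: "nat \<Rightarrow> real"
  assumes "\<And>i. a i < b i"
  shows "\<exists>x. generic_point n x \<and> (\<forall>i<n. a i < x i \<and> x i < b i)"
proof (induction n)
  case 0
  have "expr_eval z e = 0" if "expr_eval (\<lambda>i. real_of_int 0) e = 0" "\<forall>i. z i = 0" for e and z :: "nat \<Rightarrow> complex"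
  proof -
    have "z = (\<lambda>i. of_int 0)" using that(2) by auto
    then show ?thesis using that(1) by (simp only: expr_eval_of_int of_int_eq_0_iff)
  qed
  then show ?case
    by (intro exI[of _ "\<lambda>_. 0"]) (auto simp: generic_point_def)
next
  case (Suc n)
  then obtain x where x: "generic_point n x" "\<forall>i<n. a i < x i \<and> x i < b i" by blast
  define B where "B = (\<Union>e\<in>{e. \<exists>t. expr_eval (x(n := t)) e \<noteq> 0}. {t. expr_eval (x(n := t)) e = 0})"
  have "countable B"
    unfolding B_def
  proof (rule countable_UN[OF countableI_type])
    fix e assume "e \<in> {e. \<exists>t. expr_eval (x(n := t)) e \<noteq> 0}"
    then obtain t where t: "expr_eval (x(n := t)) e \<noteq> 0" by blast
    have "finite {t. expr_eval (x(n := t)) e = 0}"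
    proof (rule ccontr)
      assume "infinite {t. expr_eval (x(n := t)) e = 0}"
      from expr_eval_zero_infinite[OF this, of x n e t] t show False by simp
    qed
    then show "countable {t. expr_eval (x(n := t)) e = 0}" by (rule countable_finite)
  qed
  then obtain t where t: "t \<in> {a n<..<b n}" "t \<notin> B"
    using real_interval_avoid_countable_set[OF assms[of n] \<open>countable B\<close>] by blast
  have "expr_eval z e = 0"
    if e: "expr_eval (x(n := t)) e = 0" and z: "\<forall>i\<ge>Suc n. z i = 0" for e and z :: "nat \<Rightarrow> complex"
  proof -
    have all: "expr_eval (x(n := s)) e = 0" for s
      using t(2) e unfolding B_def by auto
    \<comment> \<open>Replacing the new variable by an integer constant leaves a relation among the
      first \<open>n\<close> variables only, to which the genericity of \<open>x\<close> applies.
      Infinitely many integers then suffice.\<close>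
    have "expr_eval (z(n := of_int c)) e = 0" for c
    proof -
      have "expr_eval x (expr_subst (Var(n := Const c)) e) = 0"
        using all by (simp add: expr_eval_subst_Const)
      then have "expr_eval (z(n := 0)) (expr_subst (Var(n := Const c)) e) = 0"
        using x(1) z unfolding generic_point_def by (auto simp: Suc_le_eq)
      then show ?thesis by (simp add: expr_eval_subst_Const)
    qed
    moreover have "infinite (range complex_of_int)"
      using finite_imageD[of complex_of_int UNIV] infinite_UNIV_int by (auto simp: inj_on_def)
    ultimately have "expr_eval (z(n := z n)) e = 0"
      using expr_eval_zero_infinite[of "range of_int" z n e "z n"] by blast
    then show ?thesis by simp
  qed
  then have "generic_point (Suc n) (x(n := t))"
    using x(1) unfolding generic_point_def by auto
  moreover have "\<forall>i<Suc n. a i < (x(n := t)) i \<and> (x(n := t)) i < b i"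
    using x(2) t(1) by (auto simp: less_Suc_eq)
  ultimately show ?case by blast
qed

section \<open>From algebraic independence over the rationals to generic points\<close>

definition monomial_eval :: "('i \<Rightarrow> 'a::field_char_0) \<Rightarrow> ('i \<Rightarrow>\<^sub>0 nat) \<Rightarrow> 'a" where
  "monomial_eval d m = (\<Prod>i\<in>Poly_Mapping.keys m. d i ^ Poly_Mapping.lookup m i)"

lemma monomial_eval_superset:
  assumes "finite A" "Poly_Mapping.keys m \<subseteq> A"
  shows "monomial_eval d m = (\<Prod>i\<in>A. d i ^ Poly_Mapping.lookup m i)"
  unfolding monomial_eval_def using assms
  by (intro prod.mono_neutral_left) (auto simp: in_keys_iff)

lemma monomial_eval_add: "monomial_eval d (m + m') = monomial_eval d m * monomial_eval d m'"
proof -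
  let ?A = "Poly_Mapping.keys m \<union> Poly_Mapping.keys m'"
  have "Poly_Mapping.keys (m + m') \<subseteq> ?A" by (rule Poly_Mapping.keys_add)
  then show ?thesis
    using monomial_eval_superset[of ?A m d] monomial_eval_superset[of ?A m' d] monomial_eval_superset[of ?A "m + m'" d]
    by (simp add: lookup_add power_add prod.distrib)
qed

lemma rat_mpoly_eval_superset:
  assumes "finite A" "Poly_Mapping.keys p \<subseteq> A"
  shows "rat_mpoly_eval d p = (\<Sum>m\<in>A. of_rat (Poly_Mapping.lookup p m) * monomial_eval d m)"
  unfolding rat_mpoly_eval_def monomial_eval_def using assms
  by (intro sum.mono_neutral_left) (auto simp: in_keys_iff)

lemma rat_mpoly_eval_add: "rat_mpoly_eval d (p + q) = rat_mpoly_eval d p + rat_mpoly_eval d q"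
proof -
  let ?A = "Poly_Mapping.keys p \<union> Poly_Mapping.keys q"
  have "Poly_Mapping.keys (p + q) \<subseteq> ?A" by (rule Poly_Mapping.keys_add)
  then show ?thesis
    using rat_mpoly_eval_superset[of ?A p d] rat_mpoly_eval_superset[of ?A q d] rat_mpoly_eval_superset[of ?A "p + q" d]
    by (simp add: lookup_add of_rat_add algebra_simps sum.distrib)
qed

lemma rat_mpoly_eval_zero: "rat_mpoly_eval d 0 = 0"
  by (simp add: rat_mpoly_eval_def)

lemma rat_mpoly_eval_single:
  "rat_mpoly_eval d (Poly_Mapping.single m c) = of_rat c * monomial_eval d m"
  by (cases "c = 0") (simp_all add: rat_mpoly_eval_def monomial_eval_def)

lemma rat_mpoly_eval_sum: "rat_mpoly_eval d (sum f A) = (\<Sum>x\<in>A. rat_mpoly_eval d (f x))"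
  by (induction A rule: infinite_finite_induct) (auto simp: rat_mpoly_eval_add rat_mpoly_eval_zero)

lemma poly_mapping_sum_singles:
  "p = (\<Sum>m\<in>Poly_Mapping.keys p. Poly_Mapping.single m (Poly_Mapping.lookup p m))"
  by (rule poly_mapping_eqI) (auto simp: lookup_sum lookup_single when_def in_keys_iff)

lemma rat_mpoly_eval_mult: "rat_mpoly_eval d (p * q) = rat_mpoly_eval d p * rat_mpoly_eval d q"
proof -
  let ?s = "\<lambda>p m. Poly_Mapping.single m (Poly_Mapping.lookup p m)"
  let ?P = "Poly_Mapping.keys p" and ?Q = "Poly_Mapping.keys q"
  have "p * q = sum (?s p) ?P * sum (?s q) ?Q"
    using poly_mapping_sum_singles[of p] poly_mapping_sum_singles[of q] by simp
  then have "rat_mpoly_eval d (p * q) = (\<Sum>m\<in>?P. \<Sum>m'\<in>?Q. rat_mpoly_eval d (?s p m * ?s q m'))"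
    by (simp add: sum_product rat_mpoly_eval_sum)
  also have "\<dots> = (\<Sum>m\<in>?P. rat_mpoly_eval d (?s p m)) * (\<Sum>m'\<in>?Q. rat_mpoly_eval d (?s q m'))"
    by (simp add: sum_product mult_single rat_mpoly_eval_single monomial_eval_add of_rat_mult mult_ac)
  also have "\<dots> = rat_mpoly_eval d p * rat_mpoly_eval d q"
    using poly_mapping_sum_singles[of p] poly_mapping_sum_singles[of q]
    by (simp flip: rat_mpoly_eval_sum)
  finally show ?thesis .
qed

primrec expr_mpoly :: "(nat \<Rightarrow> 'i rat_mpoly) \<Rightarrow> int_poly_expr \<Rightarrow> 'i rat_mpoly" where
  "expr_mpoly v (Const c) = Poly_Mapping.single 0 (of_int c)"
| "expr_mpoly v (Var i) = v i"
| "expr_mpoly v (Add e e') = expr_mpoly v e + expr_mpoly v e'"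
| "expr_mpoly v (Mult e e') = expr_mpoly v e * expr_mpoly v e'"

lemma rat_mpoly_eval_expr_mpoly:
  "rat_mpoly_eval d (expr_mpoly v e) = expr_eval (\<lambda>i. rat_mpoly_eval d (v i)) e"
  by (induction e)
    (auto simp: rat_mpoly_eval_add rat_mpoly_eval_mult rat_mpoly_eval_single monomial_eval_def simp del: single_of_int)

lemma expr_mpoly_variables:
  assumes "\<And>i m. m \<in> Poly_Mapping.keys (v i) \<Longrightarrow> Poly_Mapping.keys m \<subseteq> I"
    and "m \<in> Poly_Mapping.keys (expr_mpoly v e)"
  shows "Poly_Mapping.keys m \<subseteq> I"
  using assms(2)
proof (induction e arbitrary: m)
  case (Const c)
  then show ?case by (cases "c = 0") (auto simp del: single_of_int)
next
  case (Var i)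
  then show ?case using assms(1) by simp
next
  case (Add e e')
  then show ?case using Poly_Mapping.keys_add[of "expr_mpoly v e" "expr_mpoly v e'"] by auto
next
  case (Mult e e')
  then obtain k k' where "m = k + k'" "k \<in> Poly_Mapping.keys (expr_mpoly v e)" "k' \<in> Poly_Mapping.keys (expr_mpoly v e')"
    using keys_mult[of "expr_mpoly v e" "expr_mpoly v e'"] by auto
  then show ?case using Mult.IH Poly_Mapping.keys_add[of k k'] by blast
qed

lemma generic_point_algebraically_independent:
  fixes d :: "'i \<Rightarrow> complex"
  assumes d: "algebraically_independent_over_rat d I"
    and v: "inj_on v {..<n}" "v ` {..<n} \<subseteq> I"
  shows "generic_point n (\<lambda>i. if i < n then d (v i) else 0)"
  unfolding generic_point_def
proof (intro conjI allI impI)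
  fix e and z :: "nat \<Rightarrow> complex"
  assume e: "expr_eval (\<lambda>i. if i < n then d (v i) else 0) e = 0" and z: "\<forall>i\<ge>n. z i = 0"
  define V :: "nat \<Rightarrow> 'i rat_mpoly" where
    "V i = (if i < n then Poly_Mapping.single (Poly_Mapping.single (v i) 1) 1 else 0)" for i
  have V: "rat_mpoly_eval d' (V i) = (if i < n then d' (v i) else 0)" for i and d' :: "'i \<Rightarrow> complex"
    by (simp add: V_def rat_mpoly_eval_single rat_mpoly_eval_zero monomial_eval_def)
  have "rat_mpoly_eval d (expr_mpoly V e) = 0"
    using e by (simp add: rat_mpoly_eval_expr_mpoly V)
  moreover have "Poly_Mapping.keys m \<subseteq> I" if "m \<in> Poly_Mapping.keys (V i)" for i m
    using that v(2) by (auto simp: V_def split: if_splits)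
  then have "\<forall>m\<in>Poly_Mapping.keys (expr_mpoly V e). Poly_Mapping.keys m \<subseteq> I"
    using expr_mpoly_variables by blast
  ultimately have zero: "expr_mpoly V e = 0"
    using d unfolding algebraically_independent_over_rat_def by blast
  \<comment> \<open>This assignment gives the variable \<open>v i\<close> the value
    \<open>z i\<close>, so evaluating the zero polynomial there evaluates \<open>e\<close> at
    \<open>z\<close>.\<close>
  define d' where "d' = z \<circ> inv_into {..<n} v"
  have "(\<lambda>i. rat_mpoly_eval d' (V i)) = z"
    using v(1) z unfolding V d'_def by auto
  then show "expr_eval z e = 0"
    using rat_mpoly_eval_expr_mpoly[of d' V e] zero rat_mpoly_eval_zero by metis
qed auto


section \<open>The quintic of a generic configuration\<close>

text \<open>By induction the products with earlier coefficients of \<open>h\<close> are divisible by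
  \<open>p\<close>, which leaves \<open>coeff h i * coeff k 0\<close>.\<close>

lemma eisenstein_factor:
  fixes h k :: "'a::idom poly"
  assumes p: "prime_elem p" and k0: "\<not> p dvd coeff k 0" and n: "degree h < n"
    and dvd: "\<And>i. i < n \<Longrightarrow> p dvd coeff (h * k) i"
  shows "p dvd coeff h i"
proof (cases "i < n")
  case True
  then show ?thesis
  proof (induction i rule: less_induct)
    case (less i)
    have "coeff (h * k) i = (\<Sum>j<i. coeff h j * coeff k (i - j)) + coeff h i * coeff k 0"
      by (simp add: coeff_mult flip: lessThan_Suc_atMost)
    moreover have "p dvd (\<Sum>j<i. coeff h j * coeff k (i - j))"
      by (intro dvd_sum dvd_mult2 less.IH) (use less.prems in auto)
    ultimately have "p dvd coeff h i * coeff k 0"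
      using dvd[OF less.prems] by (metis dvd_add_right_iff)
    then show ?case using p k0 by (simp add: prime_elem_dvd_mult_iff)
  qed
next
  case False
  then show ?thesis using n by (simp add: coeff_eq_0)
qed

text \<open>The multiple \<open>c\<close> is allowed because the factorisation will come from
  clearing denominators. Gauss's lemma removes it by passing to primitive parts.\<close>

lemma eisenstein:
  fixes f h k :: "int poly"
  assumes p: "prime_elem p" and dvd: "\<And>i. i < degree f \<Longrightarrow> p dvd coeff f i"
    and lead: "\<not> p dvd lead_coeff f" and const: "\<not> p\<^sup>2 dvd coeff f 0"
    and fac: "smult c f = h * k" and c: "c \<noteq> 0"
  shows "degree h = 0 \<or> degree k = 0"
proof (rule ccontr)
  assume "\<not> (degree h = 0 \<or> degree k = 0)"
  then have deg: "degree h > 0" "degree k > 0" by auto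
  define h' k' where "h' = primitive_part h" and "k' = primitive_part k"
  have f0: "f \<noteq> 0" using lead by auto
  have hk0: "h \<noteq> 0" "k \<noteq> 0" using deg by auto
  have fac': "smult (sgn c) (primitive_part f) = h' * k'"
    using arg_cong[OF fac, of primitive_part] primitive_part_mult[of h k]
    by (simp add: primitive_part_smult h'_def k'_def unit_factor_int_def)
  have sgn: "sgn c * sgn c = 1" using c by (simp add: sgn_if)
  have cf: "smult (sgn c * content f) (h' * k') = f"
    using sgn by (simp flip: fac' add: mult_ac)
  have coeff: "sgn c * content f * coeff (h' * k') i = coeff f i" for i
    using arg_cong[OF cf, of "\<lambda>f. coeff f i"] by simp
  \<comment> \<open>The content is prime to \<open>p\<close>, so divisibility by \<open>p\<close>
    passes between the coefficients of \<open>f\<close> and those of the product of primitive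
    parts.\<close>
  have "\<not> p dvd content f" using lead content_dvd_coeff[of f "degree f"] dvd_trans by blast
  moreover have "\<not> p dvd sgn c" using p sgn by (metis dvd_mult2 not_prime_elem_one prime_elem_def)
  ultimately have unit: "\<not> p dvd sgn c * content f" using p c by (simp add: prime_elem_dvd_mult_iff)
  have dvd': "p dvd coeff (h' * k') i" if "i < degree f" for i
    using dvd[OF that] unit p coeff[of i] by (metis prime_elem_dvd_mult_iff)
  have degf: "degree f = degree h + degree k"
    using arg_cong[OF fac, of degree] c hk0 by (simp add: degree_mult_eq)
  have "\<not> p\<^sup>2 dvd coeff (h' * k') 0" using const coeff[of 0] by (metis dvd_mult)
  then have "\<not> p dvd coeff h' 0 \<or> \<not> p dvd coeff k' 0"
    by (auto simp: coeff_mult power2_eq_square mult_dvd_mono)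
  moreover have "\<not> p dvd coeff (h' * k') (degree f)" using lead coeff[of "degree f"] by (metis dvd_mult)
  then have "\<not> p dvd lead_coeff h' * lead_coeff k'"
    unfolding degf h'_def k'_def by (metis coeff_mult_degree_sum degree_primitive_part)
  then have "\<not> p dvd lead_coeff h'" "\<not> p dvd lead_coeff k'" by auto
  moreover have "degree h' < degree f" "degree k' < degree f"
    using deg degf by (simp_all add: h'_def k'_def)
  moreover have "p dvd coeff h' i" if "\<not> p dvd coeff k' 0" "degree h' < degree f" for i
    by (rule eisenstein_factor[OF p that dvd'])
  moreover have "p dvd coeff k' i" if "\<not> p dvd coeff h' 0" "degree k' < degree f" for i
    by (rule eisenstein_factor[OF p that]) (use dvd' in \<open>simp add: mult.commute\<close>)
  ultimately show False by blast
qed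

text \<open>Each coefficient is one fixed integer polynomial in the parameters. Such a family can be
  specialised to integers and carried along correspondences.\<close>

definition expr_poly :: "((nat \<Rightarrow> complex) \<Rightarrow> complex poly) \<Rightarrow> bool" where
  "expr_poly F \<longleftrightarrow> (\<forall>j. \<exists>e. \<forall>z. coeff (F z) j = expr_eval z e)"

lemma expr_poly_0: "expr_poly (\<lambda>_. 0)"
  unfolding expr_poly_def by (auto intro: exI[of _ "Const 0"])

lemma expr_poly_pCons:
  assumes "\<exists>e. \<forall>z. c z = expr_eval z e" "expr_poly F"
  shows "expr_poly (\<lambda>z. pCons (c z) (F z))"
  unfolding expr_poly_def
proof
  fix j
  show "\<exists>e. \<forall>z. coeff (pCons (c z) (F z)) j = expr_eval z e"
    using assms by (cases j) (simp_all add: expr_poly_def)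
qed

lemma expr_poly_add:
  assumes "expr_poly F" "expr_poly G"
  shows "expr_poly (\<lambda>z. F z + G z)"
  unfolding expr_poly_def
proof
  fix j
  obtain e e' where "\<forall>z. coeff (F z) j = expr_eval z e" "\<forall>z. coeff (G z) j = expr_eval z e'"
    using assms unfolding expr_poly_def by meson
  then show "\<exists>e. \<forall>z. coeff (F z + G z) j = expr_eval z e" by (intro exI[of _ "Add e e'"]) auto
qed

lemma expr_poly_diff:
  assumes "expr_poly F" "expr_poly G"
  shows "expr_poly (\<lambda>z. F z - G z)"
  unfolding expr_poly_def
proof
  fix j
  obtain e e' where "\<forall>z. coeff (F z) j = expr_eval z e" "\<forall>z. coeff (G z) j = expr_eval z e'"
    using assms unfolding expr_poly_def by meson
  then show "\<exists>e. \<forall>z. coeff (F z - G z) j = expr_eval z e"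
    by (intro exI[of _ "Add e (Mult (Const (- 1)) e')"]) auto
qed

lemma expr_sum:
  assumes "\<And>i. i \<in> A \<Longrightarrow> \<exists>e. \<forall>z :: nat \<Rightarrow> 'a::comm_ring_1. f i z = expr_eval z e"
  shows "\<exists>e. \<forall>z. (\<Sum>i\<in>A. f i z) = expr_eval z e"
  using assms
proof (induction A rule: infinite_finite_induct)
  case (insert i A)
  then obtain e e' where "\<forall>z. f i z = expr_eval z e" "\<forall>z. (\<Sum>i\<in>A. f i z) = expr_eval z e'" by blast
  with insert show ?case by (intro exI[of _ "Add e e'"]) auto
qed (auto intro: exI[of _ "Const 0"])

lemma expr_poly_mult:
  assumes "expr_poly F" "expr_poly G"
  shows "expr_poly (\<lambda>z. F z * G z)"
  unfolding expr_poly_def coeff_mult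
proof (intro allI expr_sum)
  fix j i
  obtain e e' where "\<forall>z. coeff (F z) i = expr_eval z e" "\<forall>z. coeff (G z) (j - i) = expr_eval z e'"
    using assms unfolding expr_poly_def by meson
  then show "\<exists>e. \<forall>z. coeff (F z) i * coeff (G z) (j - i) = expr_eval z e"
    by (intro exI[of _ "Mult e e'"]) auto
qed

text \<open>A connecting edge joins the tip \<open>(p, q)\<close> of the triangle at \<open>v\<^sub>1\<close> to the tip \<open>(1 + P, 1 + Q)\<close> of the
  triangle at \<open>v\<^sub>2\<close> (isotropic coordinates). After rotating the triangles by \<open>x\<close> and \<open>y\<close>, its squared length
  is unchanged iff \<open>A y\<^sup>2 + C y + x B = 0\<close> with \<open>C = (x - 1) G - A - B\<close>. Eliminating \<open>y\<close> from the two equations of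
  this kind leaves \<open>x - 1\<close> times the quintic. Variables 0 to 7 are the coordinates of \<open>v\<^sub>4\<close>, \<open>v\<^sub>5\<close>,
  \<open>v\<^sub>3 - v\<^sub>2\<close>, \<open>v\<^sub>6 - v\<^sub>2\<close>.\<close>

definition arm_A :: "'a::comm_ring_1 \<Rightarrow> 'a \<Rightarrow> 'a \<Rightarrow> 'a \<Rightarrow> 'a poly" where
  "arm_A p q P Q = [:- (P * q), P:]"
definition arm_B :: "'a::comm_ring_1 \<Rightarrow> 'a \<Rightarrow> 'a \<Rightarrow> 'a \<Rightarrow> 'a poly" where
  "arm_B p q P Q = [:Q, - (Q * p):]"
definition arm_G :: "'a::comm_ring_1 \<Rightarrow> 'a \<Rightarrow> 'a \<Rightarrow> 'a \<Rightarrow> 'a poly" where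
  "arm_G p q P Q = [:P * q - Q + q, - p:]"

definition det_AB :: "(nat \<Rightarrow> complex) \<Rightarrow> complex poly" where
  "det_AB z = arm_A (z 0) (z 1) (z 4) (z 5) * arm_B (z 2) (z 3) (z 6) (z 7)
     - arm_A (z 2) (z 3) (z 6) (z 7) * arm_B (z 0) (z 1) (z 4) (z 5)"
definition det_AG :: "(nat \<Rightarrow> complex) \<Rightarrow> complex poly" where
  "det_AG z = arm_A (z 0) (z 1) (z 4) (z 5) * arm_G (z 2) (z 3) (z 6) (z 7)
     - arm_A (z 2) (z 3) (z 6) (z 7) * arm_G (z 0) (z 1) (z 4) (z 5)"
definition det_GB :: "(nat \<Rightarrow> complex) \<Rightarrow> complex poly" where
  "det_GB z = arm_G (z 0) (z 1) (z 4) (z 5) * arm_B (z 2) (z 3) (z 6) (z 7)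
     - arm_G (z 2) (z 3) (z 6) (z 7) * arm_B (z 0) (z 1) (z 4) (z 5)"

definition quintic :: "(nat \<Rightarrow> complex) \<Rightarrow> complex poly" where
  "quintic z = [:-1, 1:] * det_AG z * det_GB z - det_AB z * (det_AB z + det_AG z + det_GB z)"

lemmas det_defs = det_AB_def det_AG_def det_GB_def arm_A_def arm_B_def arm_G_def

lemma expr_poly_dets: "expr_poly det_AB" "expr_poly det_AG" "expr_poly det_GB"
proof -
  have e: "\<exists>e. \<forall>z :: nat \<Rightarrow> complex. z i = expr_eval z e"
    "\<exists>e. \<forall>z :: nat \<Rightarrow> complex. - (z i * z j) = expr_eval z e"
    "\<exists>e. \<forall>z :: nat \<Rightarrow> complex. z i * z j - z k + z j = expr_eval z e"
    "\<exists>e. \<forall>z :: nat \<Rightarrow> complex. - z i = expr_eval z e" for i j k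
    by (rule exI[of _ "Var i"], simp)
       (rule exI[of _ "Mult (Const (-1)) (Mult (Var i) (Var j))"], simp,
        rule exI[of _ "Add (Mult (Var i) (Var j)) (Add (Mult (Const (-1)) (Var k)) (Var j))"], simp,
        rule exI[of _ "Mult (Const (-1)) (Var i)"], simp)
  have "expr_poly (\<lambda>z. det_AB z)" "expr_poly (\<lambda>z. det_AG z)" "expr_poly (\<lambda>z. det_GB z)"
    unfolding det_defs by (intro expr_poly_diff expr_poly_mult expr_poly_pCons expr_poly_0 e)+
  then show "expr_poly det_AB" "expr_poly det_AG" "expr_poly det_GB" by simp_all
qed

lemma expr_poly_X_minus_1: "expr_poly (\<lambda>z. [:-1, 1:])"
  by (intro expr_poly_pCons expr_poly_0) (auto intro: exI[of _ "Const 1"] exI[of _ "Const (- 1)"])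

lemma expr_poly_quintic: "expr_poly quintic"
proof -
  have "expr_poly (\<lambda>z. quintic z)"
    unfolding quintic_def
    by (intro expr_poly_diff expr_poly_mult expr_poly_add expr_poly_dets expr_poly_X_minus_1)
  then show ?thesis by simp
qed

lemma quintic_eval:
  assumes "\<And>i. i < 8 \<Longrightarrow> z i = of_int ([2, -4, -1, -2, -3, -1, -5, 3] ! i)"
  shows "quintic z = smult 8 [:-28, 28, -70, -140, -28, 13:]"
  using assms[of 0] assms[of 1] assms[of 2] assms[of 3] assms[of 4] assms[of 5] assms[of 6] assms[of 7]
  by (simp add: quintic_def det_defs)

lemma degree_quintic_le: "degree (quintic z) \<le> 5"
proof -
  have "coeff (quintic z) i = 0" if "i > 5" for i
    using that unfolding quintic_def det_defs
    by (simp add: coeff_pCons split: nat.splits)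
  then show ?thesis by (meson degree_le)
qed


lemma generated_subfield_fraction:
  assumes "x \<in> generated_subfield (range z)"
  shows "\<exists>a b. expr_eval z b \<noteq> 0 \<and> x = expr_eval z a / expr_eval z b"
  using assms
proof (induction rule: generated_subfield_induct)
  case one
  show ?case by (intro exI[of _ "Const 1"]) simp
next
  case (incl x)
  then obtain i where "x = z i" by auto
  then show ?case by (intro exI[of _ "Var i"] exI[of _ "Const 1"]) simp
next
  case (uminus x)
  then obtain a b where "expr_eval z b \<noteq> 0 \<and> x = expr_eval z a / expr_eval z b" by blast
  then show ?case by (intro exI[of _ "Mult (Const (- 1)) a"] exI[of _ b]) simp
next
  case (inverse x)
  then obtain a b where "expr_eval z b \<noteq> 0 \<and> x = expr_eval z a / expr_eval z b" by blast
  then show ?case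
    by (cases "expr_eval z a = 0") (auto intro: exI[of _ "Const 0"] exI[of _ "Const 1"] exI[of _ a] exI[of _ b])
next
  case (add x y)
  then obtain a b a' b' where "expr_eval z b \<noteq> 0 \<and> x = expr_eval z a / expr_eval z b"
    "expr_eval z b' \<noteq> 0 \<and> y = expr_eval z a' / expr_eval z b'" by blast
  then show ?case
    by (intro exI[of _ "Add (Mult a b') (Mult a' b)"] exI[of _ "Mult b b'"]) (simp add: add_frac_eq)
next
  case (mult x y)
  then obtain a b a' b' where "expr_eval z b \<noteq> 0 \<and> x = expr_eval z a / expr_eval z b"
    "expr_eval z b' \<noteq> 0 \<and> y = expr_eval z a' / expr_eval z b'" by blast
  then show ?case
    by (intro exI[of _ "Mult a a'"] exI[of _ "Mult b b'"]) simp
qed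

lemma expr_eval_in_generated_subfield: "expr_eval z e \<in> generated_subfield (range z)"
proof (induction e)
  case (Const c)
  have "(of_int c, of_int c) \<in> Id_on (generated_subfield (range z))"
    by (rule corr_of_int[OF field_corr_ring[OF field_corr_Id_on_generated_subfield]])
  then show ?case by auto
qed (auto intro: generated_subfield_incl generated_subfield_closed)

lemma clear_denominators:
  assumes "\<And>i. coeff p i \<in> generated_subfield (range z)"
  shows "\<exists>c h. expr_eval z c \<noteq> 0 \<and> (\<forall>i. expr_eval z c * coeff p i = expr_eval z (h i))"
  using assms
proof (induction p)
  case 0
  show ?case by (intro exI[of _ "Const 1"] exI[of _ "\<lambda>_. Const 0"]) simp
next
  case (pCons x p)
  have "coeff p i \<in> generated_subfield (range z)" for i
    using pCons.prems[of "Suc i"] by simp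
  from pCons.IH[OF this] obtain c h where ch: "expr_eval z c \<noteq> 0" "\<And>i. expr_eval z c * coeff p i = expr_eval z (h i)"
    by blast
  obtain a b where ab: "expr_eval z b \<noteq> 0" "x = expr_eval z a / expr_eval z b"
    using generated_subfield_fraction pCons.prems[of 0] by fastforce
  define h' where "h' i = (case i of 0 \<Rightarrow> Mult c a | Suc i \<Rightarrow> Mult b (h i))" for i
  have "expr_eval z (Mult b c) * coeff (pCons x p) i = expr_eval z (h' i)" for i
    using ab ch(1) by (cases i) (simp_all add: h'_def flip: ch(2))
  then show ?case using ch(1) ab(1) by (intro exI[of _ "Mult b c"] exI[of _ h']) auto
qed

lemma generic_point_identity:
  assumes "generic_point n z" "expr_eval z e = expr_eval z e'" and "\<forall>i\<ge>n. u i = 0"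
  shows "expr_eval u e = expr_eval (u :: nat \<Rightarrow> complex) e'"
proof -
  have "expr_eval z (Add e (Mult (Const (- 1)) e')) = 0" using assms(2) by simp
  then have "expr_eval u (Add e (Mult (Const (- 1)) e')) = 0"
    using assms(1,3) unfolding generic_point_def by blast
  then show ?thesis by simp
qed

lemma expr_eval_nonzero_grid:
  fixes z :: "nat \<Rightarrow> 'a::idom" and A :: "nat \<Rightarrow> 'a set"
  assumes e: "expr_eval z e \<noteq> 0" and z: "\<And>i. i \<ge> n \<Longrightarrow> z i = 0" and inf: "\<And>i. infinite (A i)"
  shows "\<exists>u. (\<forall>i<n. u i \<in> A i) \<and> (\<forall>i\<ge>n. u i = 0) \<and> expr_eval u e \<noteq> 0"
proof (rule ccontr)
  assume *: "\<not> ?thesis"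
  \<comment> \<open>This substitution kills the variables from \<open>n\<close> on, so that the
    unrestricted grid lemma applies.\<close>
  define \<sigma> where "\<sigma> i = (if i < n then Var i else Const 0)" for i
  have \<sigma>: "expr_eval u (expr_subst \<sigma> e) = expr_eval (\<lambda>i. if i < n then u i else 0) e" for u :: "nat \<Rightarrow> 'a"
    unfolding expr_eval_subst by (rule arg_cong[where f = "\<lambda>u. expr_eval u e"]) (auto simp: \<sigma>_def)
  have "expr_eval u (expr_subst \<sigma> e) = 0" if "\<And>i. u i \<in> A i" for u
  proof -
    let ?u = "\<lambda>i. if i < n then u i else 0"
    have "(\<forall>i<n. ?u i \<in> A i) \<and> (\<forall>i\<ge>n. ?u i = 0)" using that by auto
    moreover have "\<not> ((\<forall>i<n. ?u i \<in> A i) \<and> (\<forall>i\<ge>n. ?u i = 0) \<and> expr_eval ?u e \<noteq> 0)"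
      using * by (rule contrapos_nn) (rule exI)
    ultimately show ?thesis unfolding \<sigma> by simp
  qed
  then have "expr_eval z (expr_subst \<sigma> e) = 0"
    by (rule expr_eval_zero_grid[where A = A, OF inf])
  moreover have "(\<lambda>i. if i < n then z i else 0) = z" using z by (auto simp: not_less)
  ultimately show False using e unfolding \<sigma> by simp
qed

lemma expr_eval_cong_int:
  assumes "\<And>i. (m::int) dvd u i - v i"
  shows "m dvd expr_eval u e - expr_eval v e"
proof (induction e)
  case (Add e e')
  have "expr_eval u (Add e e') - expr_eval v (Add e e') = (expr_eval u e - expr_eval v e) + (expr_eval u e' - expr_eval v e')"
    by simp
  then show ?case using Add by (metis dvd_add)
next
  case (Mult e e')
  have "expr_eval u (Mult e e') - expr_eval v (Mult e e') =
      (expr_eval u e - expr_eval v e) * expr_eval u e' + expr_eval v e * (expr_eval u e' - expr_eval v e')"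
    by (simp add: algebra_simps)
  then show ?case using Mult by (metis dvd_add dvd_mult dvd_mult2)
qed (use assms in auto)

text \<open>Here the quintic is an Eisenstein polynomial at 7 up to the factor 8. It changes sign three times on
  the real line, while \<open>c\<^sub>1\<^sup>2 < 2 c\<^sub>0 c\<^sub>2\<close> for its lowest coefficients, so not all of its roots are real.\<close>

definition base_point :: "nat \<Rightarrow> int" where
  "base_point i = (if i < 8 then [2, -4, -1, -2, -3, -1, -5, 3] ! i else 0)"

lemma coeff_quintic_base_point:
  assumes "\<And>z. coeff (quintic z) j = expr_eval z e"
  shows "expr_eval base_point e = coeff (smult 8 [:-28, 28, -70, -140, -28, 13:]) j"
proof -
  have "of_int (expr_eval base_point e) = coeff (quintic (\<lambda>i. of_int (base_point i))) j"
    by (simp add: assms expr_eval_of_int)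
  also have "\<dots> = of_int (coeff (smult 8 [:-28, 28, -70, -140, -28, 13:]) j)"
    by (subst quintic_eval) (auto simp: base_point_def coeff_pCons split: nat.splits)
  finally show ?thesis by (simp only: of_int_eq_iff)
qed

text \<open>The Eisenstein conditions at 7 depend on the coefficients modulo 49 only, so they
  persist at every integer point congruent to \<open>base_point\<close>.\<close>

lemma quintic_over_integers_irreducible:
  assumes cong: "\<And>i. 49 dvd u i - base_point i"
    and u: "\<And>j. coeff (quintic (\<lambda>i. of_int (u i))) j = of_int (coeff f j)"
    and fac: "smult c f = h * k" "c \<noteq> 0"
  shows "degree h = 0 \<or> degree k = 0"
proof (rule eisenstein[of 7 f])
  obtain e where e: "\<And>j z. coeff (quintic z) j = expr_eval z (e j)"
    using expr_poly_quintic unfolding expr_poly_def by metis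
  have f: "coeff f j = expr_eval u (e j)" for j
  proof -
    have "complex_of_int (coeff f j) = of_int (expr_eval u (e j))"
      using u[of j] by (simp add: e expr_eval_of_int)
    then show ?thesis by (simp only: of_int_eq_iff)
  qed
  have mod: "49 dvd coeff f j - coeff (smult 8 [:-28, 28, -70, -140, -28, 13:]) j" for j
    using expr_eval_cong_int[where u = u and v = base_point and e = "e j", OF cong] coeff_quintic_base_point[OF e, of j] f by simp
  have mod': "7 dvd coeff f j - coeff (smult 8 [:-28, 28, -70, -140, -28, 13:]) j" for j
    using mod[of j] by (rule dvd_trans[rotated]) simp
  have "degree f \<le> 5"
  proof (rule degree_le, intro allI impI)
    fix i :: nat assume "5 < i"
    then show "coeff f i = 0"
      using u[of i] degree_quintic_le[of "\<lambda>i. of_int (u i)"] by (simp add: coeff_eq_0)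
  qed
  moreover have c5: "\<not> 7 dvd coeff f 5"
    using mod'[of 5] by (simp add: coeff_pCons numeral_eq_Suc) presburger
  ultimately have deg: "degree f = 5"
    by (metis dvd_0_right le_degree order_antisym)
  show "\<not> 7 dvd lead_coeff f" using c5 deg by simp
  show "7 dvd coeff f i" if "i < degree f" for i
  proof -
    have "i \<in> {0, 1, 2, 3, 4}" using that deg by auto
    then show ?thesis using mod'[of i] by (auto simp: coeff_pCons numeral_eq_Suc) presburger+
  qed
  show "\<not> 7\<^sup>2 dvd coeff f 0"
    using mod[of 0] by (simp add: coeff_pCons) presburger
qed (use fac in auto)

text \<open>A polynomial over Q(z) of smaller degree sharing a root would give a proper
  factorisation. With denominators cleared this is an identity of integer polynomials in the
  parameters, and a suitable integer specialisation contradicts Eisenstein.\<close>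

theorem irreducible_quintic:
  assumes z: "generic_point 8 (z :: nat \<Rightarrow> complex)"
  shows "irreducible_over (range z) (quintic z)" "degree (quintic z) = 5"
proof -
  obtain e where e: "\<And>j z. coeff (quintic z) j = expr_eval z (e j)"
    using expr_poly_quintic unfolding expr_poly_def by metis
  have c5: "coeff (quintic z) 5 \<noteq> 0"
  proof
    assume "coeff (quintic z) 5 = 0"
    then have "expr_eval (\<lambda>i. complex_of_int (base_point i)) (e 5) = 0"
      using z unfolding e generic_point_def by (auto simp: base_point_def)
    then show False using coeff_quintic_base_point[OF e, of 5] unfolding expr_eval_of_int
      by (simp add: coeff_pCons numeral_eq_Suc)
  qed
  show deg: "degree (quintic z) = 5"
    using c5 degree_quintic_le[of z] by (metis le_degree order_antisym)
  let ?K = "generated_subfield (range z)"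
  note eval_K = expr_eval_in_generated_subfield[of z]
  show "irreducible_over (range z) (quintic z)"
  proof
    show coeffs: "coeff (quintic z) i \<in> ?K" for i unfolding e by (rule eval_K)
    show f0: "quintic z \<noteq> 0" using c5 by auto
    fix p0 x assume p0: "\<And>i. coeff p0 i \<in> ?K" "p0 \<noteq> 0" "poly p0 x = 0" and x: "poly (quintic z) x = 0"
    show "degree (quintic z) \<le> degree p0"
    proof (rule ccontr)
      assume small: "\<not> degree (quintic z) \<le> degree p0"
      let ?P = "\<lambda>p. (\<forall>i. coeff p i \<in> ?K) \<and> p \<noteq> 0 \<and> poly p x = 0"
      have "\<exists>p. ?P p \<and> (\<forall>q. ?P q \<longrightarrow> degree p \<le> degree q)"
        using p0 ex_has_least_nat[of ?P p0 degree] by blast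
      then obtain p where p: "\<And>i. coeff p i \<in> ?K" "p \<noteq> 0" "poly p x = 0"
        and min: "\<And>q. \<lbrakk>\<And>i. coeff q i \<in> ?K; q \<noteq> 0; poly q x = 0\<rbrakk> \<Longrightarrow> degree p \<le> degree q" by blast
      have "degree p \<noteq> 0" using p(2,3) by (metis degree_eq_zeroE pCons_0_0 poly_const_conv)
      then have deg_p: "degree p < 5" "degree p > 0"
        using min[OF p0] small deg by auto
      have "(p, p) \<in> poly_corr (Id_on ?K)" "(quintic z, quintic z) \<in> poly_corr (Id_on ?K)"
        using p(1) coeffs by (auto intro: poly_corr_fixed)
      then obtain k k' r r' where kr': "(k, k') \<in> poly_corr (Id_on ?K)" "(r, r') \<in> poly_corr (Id_on ?K)"
        and kr: "quintic z = k * p + r" "r = 0 \<or> degree r < degree p"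
        using poly_corr_divide[OF field_corr_Id_on_generated_subfield _ p(2)] by blast
      have k: "coeff k i \<in> ?K" and r: "coeff r i \<in> ?K" for i
        using kr' by (auto simp: poly_corr_def)
      have "poly r x = 0" using kr(1) x p(3) by simp
      then have "r = 0" using min[OF r] kr(2) by fastforce
      then have fac: "quintic z = k * p" using kr by simp
      then have deg_k: "degree k + degree p = 5" "k \<noteq> 0"
        using deg f0 by (auto simp: degree_mult_eq)
      obtain a h where h: "expr_eval z a \<noteq> 0" "\<And>i. expr_eval z a * coeff k i = expr_eval z (h i)"
        using clear_denominators[OF k] by blast
      obtain b g where g: "expr_eval z b \<noteq> 0" "\<And>i. expr_eval z b * coeff p i = expr_eval z (g i)"
        using clear_denominators[OF p(1)] by blast
      define m n where "m = degree k" and "n = degree p"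
      define Z where "Z i = {complex_of_int c | c. 49 dvd c - base_point i}" for i
      \<comment> \<open>Denominators and leading coefficients are kept nonzero together, so the
        specialised factors do not drop in degree.\<close>
      have "expr_eval z (Mult (Mult a b) (Mult (h m) (g n))) \<noteq> 0"
        using h g deg_k p(2) by (simp add: m_def n_def flip: h(2) g(2))
      moreover have "infinite (Z i)" for i
      proof -
        have "inj (\<lambda>c. complex_of_int (49 * c + base_point i))" by (auto simp: inj_on_def)
        then have "infinite (range (\<lambda>c. complex_of_int (49 * c + base_point i)))"
          using finite_imageD infinite_UNIV_int by blast
        moreover have "range (\<lambda>c. complex_of_int (49 * c + base_point i)) \<subseteq> Z i"
          unfolding Z_def by (rule image_subsetI, rule CollectI, rule exI, rule conjI[OF refl]) simp
        ultimately show ?thesis using finite_subset by blast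
      qed
      moreover have "z i = 0" if "i \<ge> 8" for i using z that unfolding generic_point_def by blast
      ultimately obtain v where v: "\<forall>i<8. v i \<in> Z i" "\<forall>i\<ge>8. v i = 0"
        "expr_eval v (Mult (Mult a b) (Mult (h m) (g n))) \<noteq> 0"
        using expr_eval_nonzero_grid[of z "Mult (Mult a b) (Mult (h m) (g n))" 8 Z] by blast
      have "\<exists>c. v i = complex_of_int c \<and> 49 dvd c - base_point i" for i
        using v(1,2) unfolding Z_def by (cases "i < 8") (auto simp: base_point_def)
      then obtain u where u: "\<And>i. v i = complex_of_int (u i)" "\<And>i. 49 dvd u i - base_point i"
        by metis
      then have v_eq: "v = (\<lambda>i. complex_of_int (u i))" by auto
      define F where "F = (\<Sum>j\<le>5. monom (expr_eval u (e j)) j)"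
      define Hk where "Hk = (\<Sum>j\<le>m. monom (expr_eval u (h j)) j)"
      define Gp where "Gp = (\<Sum>j\<le>n. monom (expr_eval u (g j)) j)"
      define C where "C = expr_eval u (Mult a b)"
      have nz: "C \<noteq> 0" "expr_eval u (h m) \<noteq> 0" "expr_eval u (g n) \<noteq> 0"
        using v(3) unfolding v_eq expr_eval_of_int C_def by auto
      have cF: "coeff F j = (if j \<le> 5 then expr_eval u (e j) else 0)" for j
        unfolding F_def by (simp add: coeff_sum)
      have cH: "coeff Hk j = (if j \<le> m then expr_eval u (h j) else 0)" for j
        unfolding Hk_def by (simp add: coeff_sum)
      have cG: "coeff Gp j = (if j \<le> n then expr_eval u (g j) else 0)" for j
        unfolding Gp_def by (simp add: coeff_sum)
      have F: "coeff (quintic (\<lambda>i. of_int (u i))) j = of_int (coeff F j)" for j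
        unfolding cF using e[of "\<lambda>i. of_int (u i)" j] degree_quintic_le[of "\<lambda>i. of_int (u i)"]
        by (auto simp: expr_eval_of_int coeff_eq_0)
      \<comment> \<open>The cleared coefficients beyond the degree vanish at the generic point,
        hence identically; truncating the sum in \<open>Hk\<close> loses nothing.\<close>
      have hz: "expr_eval (\<lambda>i. of_int (u i)) (h j) = (0::complex)" if "j > m" for j
        using generic_point_identity[OF z, of "h j" "Const 0"] h(2)[of j] that v(2)
        by (simp add: coeff_eq_0 m_def flip: v_eq)
      have gz: "expr_eval (\<lambda>i. of_int (u i)) (g j) = (0::complex)" if "j > n" for j
        using generic_point_identity[OF z, of "g j" "Const 0"] g(2)[of j] that v(2)
        by (simp add: coeff_eq_0 n_def flip: v_eq)
      have cH': "coeff Hk j = expr_eval u (h j)" for j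
        using hz[of j] unfolding cH expr_eval_of_int by auto
      have cG': "coeff Gp j = expr_eval u (g j)" for j
        using gz[of j] unfolding cG expr_eval_of_int by auto
      have "smult C F = Hk * Gp"
      proof (rule poly_eqI)
        fix j
        have "\<exists>s. \<forall>z :: nat \<Rightarrow> complex. (\<Sum>i\<le>j. expr_eval z (Mult (h i) (g (j - i)))) = expr_eval z s"
          by (rule expr_sum) blast
        then obtain s where s: "\<And>z :: nat \<Rightarrow> complex. (\<Sum>i\<le>j. expr_eval z (h i) * expr_eval z (g (j - i))) = expr_eval z s"
          by auto
        have "expr_eval z (Mult (Mult a b) (e j)) = expr_eval z s"
          unfolding s[symmetric]
          by (simp add: fac coeff_mult sum_distrib_left mult_ac flip: e h(2) g(2))
        then have "expr_eval v (Mult (Mult a b) (e j)) = expr_eval v s"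
          using generic_point_identity[OF z] v(2) by blast
        then have "complex_of_int (C * expr_eval u (e j)) = of_int (\<Sum>i\<le>j. expr_eval u (h i) * expr_eval u (g (j - i)))"
          unfolding s[symmetric] unfolding v_eq expr_eval_of_int C_def by simp
        then have "C * expr_eval u (e j) = (\<Sum>i\<le>j. expr_eval u (h i) * expr_eval u (g (j - i)))"
          by (simp only: of_int_eq_iff)
        moreover have "coeff F j = expr_eval u (e j)"
          using F[of j] unfolding e expr_eval_of_int by (simp only: of_int_eq_iff)
        ultimately show "coeff (smult C F) j = coeff (Hk * Gp) j"
          by (simp add: coeff_mult cH' cG')
      qed
      then have "degree Hk = 0 \<or> degree Gp = 0"
        by (rule quintic_over_integers_irreducible[OF u(2) F _ nz(1)])
      moreover have "degree Hk \<ge> m" "degree Gp \<ge> n"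
        using nz cH' cG' by (auto intro!: le_degree)
      ultimately show False using deg_k deg_p by (auto simp: m_def n_def)
    qed
  qed
qed


section \<open>A generic configuration with three real roots\<close>

lemma expr_eval_tendsto:
  fixes x :: "nat \<Rightarrow> nat \<Rightarrow> real"
  assumes "\<And>i. (\<lambda>n. x n i) \<longlonglongrightarrow> y i"
  shows "(\<lambda>n. expr_eval (x n) e) \<longlonglongrightarrow> expr_eval y e"
  by (induction e) (auto intro: assms tendsto_add tendsto_mult)

lemma ex_generic_sequence:
  fixes y :: "nat \<Rightarrow> real"
  assumes "\<And>i. i \<ge> m \<Longrightarrow> y i = 0"
  shows "\<exists>x. (\<forall>n. generic_point m (x n)) \<and> (\<forall>i. (\<lambda>n. x n i) \<longlonglongrightarrow> y i)"
proof -
  have "\<exists>x. generic_point m x \<and> (\<forall>i<m. y i - inverse (real (Suc n)) < x i \<and> x i < y i + inverse (real (Suc n)))" for n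
    by (rule ex_generic_point) (simp add: add.commute less_add_same_cancel1 flip: less_diff_eq)
  then obtain x where x: "\<And>n. generic_point m (x n)"
    "\<And>n i. i < m \<Longrightarrow> y i - inverse (real (Suc n)) < x n i \<and> x n i < y i + inverse (real (Suc n))"
    by metis
  have "(\<lambda>n. x n i) \<longlonglongrightarrow> y i" for i
  proof (cases "i < m")
    case True
    have lim: "(\<lambda>n. y i - inverse (real (Suc n))) \<longlonglongrightarrow> y i" "(\<lambda>n. y i + inverse (real (Suc n))) \<longlonglongrightarrow> y i"
      using tendsto_diff[OF tendsto_const LIMSEQ_inverse_real_of_nat, of "y i"]
        tendsto_add[OF tendsto_const LIMSEQ_inverse_real_of_nat, of "y i"] by simp_all
    show ?thesis
      by (rule tendsto_sandwich[OF _ _ lim]) (use x(2)[OF True] in \<open>auto simp: less_imp_le intro!: always_eventually\<close>)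
  next
    case False
    then have "x n i = y i" for n using x(1)[of n] assms by (auto simp: generic_point_def)
    then show ?thesis by simp
  qed
  with x(1) show ?thesis by blast
qed

text \<open>In elementary symmetric functions of the roots this is e4^2 - 2 e3 e5, the sum of the
  squares of the fourfold products. For real roots and real \<open>l\<close> it cannot be
  negative.\<close>

lemma quintic_product_coeffs:
  fixes l a b c d e :: "'a::field"
  defines "f \<equiv> smult l ([:-a, 1:] * [:-b, 1:] * [:-c, 1:] * [:-d, 1:] * [:-e, 1:])"
  shows "(coeff f 1)\<^sup>2 - 2 * coeff f 0 * coeff f 2 =
    l\<^sup>2 * ((a*b*c*d)\<^sup>2 + (a*b*c*e)\<^sup>2 + (a*b*d*e)\<^sup>2 + (a*c*d*e)\<^sup>2 + (b*c*d*e)\<^sup>2)"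
proof -
  have "coeff f 0 = - l * (a*b*c*d*e)"
    "coeff f 1 = l * (a*b*c*d + a*b*c*e + a*b*d*e + a*c*d*e + b*c*d*e)"
    "coeff f 2 = - l * (a*b*c + a*b*d + a*b*e + a*c*d + a*c*e + a*d*e + b*c*d + b*c*e + b*d*e + c*d*e)"
    unfolding f_def by (simp_all add: numeral_eq_Suc algebra_simps)
  then show ?thesis by (simp only:) (simp add: power2_eq_square algebra_simps)
qed

lemma real_rooted_quintic:
  fixes f :: "complex poly"
  assumes "degree f = 5" and card: "card {x. poly f x = 0} = 5" and sq: "rsquarefree f"
    and real: "{x. poly f x = 0} \<subseteq> \<real>" "lead_coeff f \<in> \<real>"
  shows "Re ((coeff f 1)\<^sup>2 - 2 * coeff f 0 * coeff f 2) \<ge> 0"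
proof -
  obtain a b c d e where abc: "{x. poly f x = 0} = {a, b, c, d, e}" "distinct [a, b, c, d, e]"
  proof -
    have "finite {x. poly f x = 0}" using card card.infinite by fastforce
    then obtain xs where xs: "set xs = {x. poly f x = 0}" "distinct xs"
      using finite_distinct_list by blast
    then have "length xs = 5" using card distinct_card by metis
    then obtain a b c d e where "xs = [a, b, c, d, e]"
      by (auto simp: numeral_eq_Suc length_Suc_conv)
    then show thesis using that[of a b c d e] xs by auto
  qed
  define l where "l = lead_coeff f"
  have "f = smult l (\<Prod>x\<in>{a, b, c, d, e}. [:-x, 1:])"
    using complex_poly_decompose_rsquarefree[OF sq] abc(1) by (simp add: l_def)
  also have "\<dots> = smult l ([:-a, 1:] * [:-b, 1:] * [:-c, 1:] * [:-d, 1:] * [:-e, 1:])"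
    using abc(2) by (simp add: mult_ac del: mult_pCons_left mult_pCons_right)
  finally have f: "f = \<dots>" .
  have "a \<in> \<real>" "b \<in> \<real>" "c \<in> \<real>" "d \<in> \<real>" "e \<in> \<real>" "l \<in> \<real>" using real abc(1) l_def by auto
  then obtain a' b' c' d' e' l' where r: "a = of_real a'" "b = of_real b'" "c = of_real c'" "d = of_real d'"
    "e = of_real e'" "l = of_real l'" by (auto simp: Reals_def)
  have "(coeff f 1)\<^sup>2 - 2 * coeff f 0 * coeff f 2 =
    of_real (l'\<^sup>2 * ((a'*b'*c'*d')\<^sup>2 + (a'*b'*c'*e')\<^sup>2 + (a'*b'*d'*e')\<^sup>2 + (a'*c'*d'*e')\<^sup>2 + (b'*c'*d'*e')\<^sup>2))"
    by (subst (1 2 3) f) (simp only: quintic_product_coeffs, simp add: r)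
  then show ?thesis by simp
qed

text \<open>At a double root the derivative, which has smaller degree and coefficients in
  \<open>K\<close>, would vanish too.\<close>

lemma (in irreducible_over) rsquarefree: "degree f > 0 \<Longrightarrow> rsquarefree f"
  unfolding rsquarefree_roots
proof (intro allI notI)
  fix a assume deg: "degree f > 0" and a: "poly f a = 0 \<and> poly (pderiv f) a = 0"
  have "(of_nat n * coeff f n, of_nat n * coeff f n) \<in> Id_on K" for n
    using field_corr_ring[OF field_corr_Id_on_generated_subfield[of S]] coeffs
    by (intro corr_mult corr_of_nat) auto
  then have "coeff (pderiv f) i \<in> K" for i
    unfolding coeff_pderiv by blast
  moreover have "pderiv f \<noteq> 0" using deg by (simp add: pderiv_eq_0_iff)
  ultimately have "degree f \<le> degree (pderiv f)" using minimal a by blast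
  then show False using deg by (simp add: degree_pderiv)
qed

theorem ex_generic_three_cycles:
  "\<exists>z. generic_point 8 z \<and> card {x. poly (quintic z) x = 0} = 5 \<and>
     three_cycles_over (generated_subfield (range z)) {x. poly (quintic z) x = 0}"
proof -
  obtain e where e: "\<And>j z. coeff (quintic z) j = expr_eval z (e j)"
    using expr_poly_quintic unfolding expr_poly_def by metis
  define y where "y i = real_of_int (base_point i)" for i
  have "\<exists>x. (\<forall>n. generic_point 8 (x n)) \<and> (\<forall>i. (\<lambda>n. x n i) \<longlonglongrightarrow> y i)"
    by (rule ex_generic_sequence) (simp add: y_def base_point_def)
  then obtain x where x: "\<And>n. generic_point 8 (x n)" "\<And>i. (\<lambda>n. x n i) \<longlonglongrightarrow> y i" by blast
  have c: "expr_eval y (e j) = of_int (coeff (smult 8 [:-28, 28, -70, -140, -28, 13:]) j)" for j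
    unfolding y_def expr_eval_of_int using coeff_quintic_base_point[OF e] by simp
  define \<phi> where "\<phi> z t = (\<Sum>j\<le>5. expr_eval z (e j) * t ^ j)" for z and t :: real
  have \<phi>_lim: "(\<lambda>n. \<phi> (x n) t) \<longlonglongrightarrow> \<phi> y t" for t
    unfolding \<phi>_def by (intro tendsto_sum tendsto_mult tendsto_const expr_eval_tendsto x)
  have \<phi>_y: "\<phi> y (-2) < 0" "\<phi> y (-3/2) > 0" "\<phi> y (-1) < 0" "\<phi> y 5 > 0"
    unfolding \<phi>_def c by (simp_all add: numeral_eq_Suc)
  define \<delta> where "\<delta> z = (expr_eval z (e 1))\<^sup>2 - 2 * expr_eval z (e 0) * expr_eval z (e 2)" for z :: "nat \<Rightarrow> real"
  have \<delta>_lim: "(\<lambda>n. \<delta> (x n)) \<longlonglongrightarrow> \<delta> y"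
    unfolding \<delta>_def by (intro tendsto_intros expr_eval_tendsto x)
  have \<delta>_y: "\<delta> y < 0"
    unfolding \<delta>_def c by (simp add: numeral_eq_Suc)
  \<comment> \<open>All conditions are strict inequalities that hold at the base point, so they hold
    at generic real points close enough to it.\<close>
  have "\<forall>\<^sub>F n in sequentially. \<phi> (x n) (-2) < 0 \<and> \<phi> (x n) (-3/2) > 0 \<and> \<phi> (x n) (-1) < 0 \<and> \<phi> (x n) 5 > 0 \<and> \<delta> (x n) < 0"
    by (intro eventually_conj order_tendstoD[OF \<phi>_lim] order_tendstoD[OF \<delta>_lim] \<phi>_y \<delta>_y)
  then obtain n where n: "\<phi> (x n) (-2) < 0" "\<phi> (x n) (-3/2) > 0" "\<phi> (x n) (-1) < 0" "\<phi> (x n) 5 > 0" "\<delta> (x n) < 0"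
    unfolding eventually_sequentially by blast
  define z where "z i = complex_of_real (x n i)" for i
  have z: "generic_point 8 z"
    using x(1)[of n] unfolding generic_point_def z_def expr_eval_of_real by auto
  interpret irreducible_over "range z" "quintic z" by (rule irreducible_quintic[OF z])
  have deg: "degree (quintic z) = 5" by (rule irreducible_quintic[OF z])
  have ez: "coeff (quintic z) j = of_real (expr_eval (x n) (e j))" for j
    unfolding e z_def expr_eval_of_real ..
  have poly_real: "poly (quintic z) (of_real t) = of_real (\<phi> (x n) t)" for t
    unfolding poly_altdef deg \<phi>_def ez by simp
  have cont: "continuous_on A (\<phi> (x n))" for A
    unfolding \<phi>_def by (intro continuous_intros)
  obtain a where a: "-2 \<le> a" "a \<le> -3/2" "\<phi> (x n) a = 0"
    using IVT'[of "\<phi> (x n)" "-2" 0 "-3/2", OF _ _ _ cont] n(1,2) by auto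
  obtain b where b: "-3/2 \<le> b" "b \<le> -1" "\<phi> (x n) b = 0"
    using IVT2'[of "\<phi> (x n)" "-1" 0 "-3/2", OF _ _ _ cont] n(2,3) by auto
  obtain c where c: "-1 \<le> c" "c \<le> 5" "\<phi> (x n) c = 0"
    using IVT'[of "\<phi> (x n)" "-1" 0 "5", OF _ _ _ cont] n(3,4) by auto
  have abc: "a < b" "b < c"
  proof -
    have "a \<noteq> -3/2" "b \<noteq> -1" using a(3) b(3) n(2,3) by auto
    then show "a < b" "b < c" using a b c by auto
  qed
  have sq: "rsquarefree (quintic z)" using rsquarefree deg by simp
  have roots_eq: "roots = {x. poly (quintic z) x = 0}" by (simp add: roots_def)
  have card: "card roots = 5"
  proof -
    have "degree (quintic z) = degree (smult (lead_coeff (quintic z)) (\<Prod>x\<in>roots. [:-x, 1:]))"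
      using complex_poly_decompose_rsquarefree[OF sq] by (simp add: roots_eq)
    also have "\<dots> = card roots" using nonzero by (simp add: degree_prod_sum_eq)
    finally show ?thesis using deg by simp
  qed
  have "\<not> roots \<subseteq> \<real>"
  proof
    assume "roots \<subseteq> \<real>"
    then have "Re ((coeff (quintic z) 1)\<^sup>2 - 2 * coeff (quintic z) 0 * coeff (quintic z) 2) \<ge> 0"
      using real_rooted_quintic[OF deg _ sq] card unfolding roots_eq by (auto simp: ez)
    moreover have "(coeff (quintic z) 1)\<^sup>2 - 2 * coeff (quintic z) 0 * coeff (quintic z) 2 = of_real (\<delta> (x n))"
      unfolding ez \<delta>_def by simp
    ultimately have "Re (of_real (\<delta> (x n))) \<ge> 0" by (simp only:)
    then show False using n(5) by simp
  qed
  then obtain w where w: "w \<in> roots" "w \<notin> \<real>" by blast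
  have "cnj w \<in> roots"
  proof -
    have "cnj (poly (quintic z) w) = poly (quintic z) (cnj w)"
      unfolding poly_altdef by (simp add: ez)
    then show ?thesis using w(1) unfolding roots_def by simp
  qed
  moreover have "{complex_of_real a, of_real b, of_real c} \<subseteq> roots"
    using a b c by (simp add: roots_def poly_real)
  ultimately have sub: "{w, cnj w, of_real a, of_real b, of_real c} \<subseteq> roots" using w by simp
  \<comment> \<open>A conjugate pair and three real roots are five distinct roots, hence all of
    them.\<close>
  have "distinct [w, cnj w, of_real a, of_real b, of_real c]"
  proof -
    have "cnj w \<noteq> of_real t" for t
      using w(2) by (metis Reals_of_real complex_cnj_cnj complex_cnj_complex_of_real)
    then show ?thesis using w(2) abc by (auto simp: Reals_cnj_iff)
  qed
  then have "card {w, cnj w, of_real a, of_real b, of_real c} = 5"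
    using distinct_card[of "[w, cnj w, of_real a, of_real b, of_real c]"] by simp
  then have "roots = {w, cnj w, of_real a, of_real b, of_real c}"
    using card_subset_eq[OF finite_roots sub] card by simp
  then have "roots - {w, cnj w} \<subseteq> \<real>" by auto
  moreover have "range z \<subseteq> \<real>" by (auto simp: z_def)
  ultimately have "three_cycles_over K roots"
    using three_cycles_real[OF _ card w] by blast
  then show ?thesis using z card roots_eq by metis
qed


section \<open>Transfer to the given dimensions\<close>

text \<open>The coefficient of \<open>y\<close> in the edge equation multiplied by x y;
  \<open>k\<close> collects the constants \<open>1 + P * Q + p * q - m\<close>, with
  \<open>m\<close> the squared edge length.\<close>

definition arm_C :: "'a::comm_ring_1 \<Rightarrow> 'a \<Rightarrow> 'a \<Rightarrow> 'a poly" where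
  "arm_C p q k = [:- q, k, - p:]"

lemma arm_equation:
  fixes x y :: "'a::field"
  assumes "x \<noteq> 0" "y \<noteq> 0"
  shows "(1 + P * y - p * x) * (1 + Q / y - q / x) = m \<longleftrightarrow>
    poly (arm_A p q P Q) x * y\<^sup>2 + poly (arm_C p q (1 + P * Q + p * q - m)) x * y + x * poly (arm_B p q P Q) x = 0"
proof -
  have "x * y * ((1 + P * y - p * x) * (1 + Q / y - q / x) - m) =
    (1 + P * y - p * x) * (x * y + Q * x - q * y) - m * x * y"
    using assms by (simp add: field_simps)
  also have "\<dots> = poly (arm_A p q P Q) x * y\<^sup>2 + poly (arm_C p q (1 + P * Q + p * q - m)) x * y + x * poly (arm_B p q P Q) x"
    by (simp add: arm_A_def arm_B_def arm_C_def power2_eq_square algebra_simps)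
  finally show ?thesis using assms by (metis eq_iff_diff_eq_0 mult_eq_0_iff)
qed

text \<open>The resultant in \<open>y\<close> of the two quadratics A y^2 + C y + x B, divided by
  -x.\<close>

definition sextic :: "'a::comm_ring_1 \<Rightarrow> 'a \<Rightarrow> 'a \<Rightarrow> 'a \<Rightarrow> 'a \<Rightarrow> 'a \<Rightarrow> 'a \<Rightarrow> 'a \<Rightarrow> 'a \<Rightarrow> 'a \<Rightarrow> 'a poly" where
  "sextic p1 q1 P1 Q1 k1 p2 q2 P2 Q2 k2 =
    (arm_A p1 q1 P1 Q1 * arm_C p2 q2 k2 - arm_A p2 q2 P2 Q2 * arm_C p1 q1 k1) *
    (arm_C p1 q1 k1 * arm_B p2 q2 P2 Q2 - arm_C p2 q2 k2 * arm_B p1 q1 P1 Q1)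
    - [:0, 1:] * (arm_A p1 q1 P1 Q1 * arm_B p2 q2 P2 Q2 - arm_A p2 q2 P2 Q2 * arm_B p1 q1 P1 Q1)\<^sup>2"

lemma sextic_root:
  fixes x y :: "'a::field"
  assumes "x \<noteq> 0"
    and "poly (arm_A p1 q1 P1 Q1) x * y\<^sup>2 + poly (arm_C p1 q1 k1) x * y + x * poly (arm_B p1 q1 P1 Q1) x = 0"
    and "poly (arm_A p2 q2 P2 Q2) x * y\<^sup>2 + poly (arm_C p2 q2 k2) x * y + x * poly (arm_B p2 q2 P2 Q2) x = 0"
  shows "poly (sextic p1 q1 P1 Q1 k1 p2 q2 P2 Q2 k2) x = 0"
proof -
  have "x * ((a1 * c2 - a2 * c1) * (c1 * b2 - c2 * b1) - x * (a1 * b2 - a2 * b1)\<^sup>2) = 0"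
    if "a1 * y\<^sup>2 + c1 * y + x * b1 = 0" "a2 * y\<^sup>2 + c2 * y + x * b2 = 0" for a1 b1 c1 a2 b2 c2
  proof -
    let ?D = "a1 * c2 - a2 * c1" and ?E = "a1 * b2 - a2 * b1" and ?J = "c1 * b2 - c2 * b1"
    have "?D * y + x * ?E = a1 * (a2 * y\<^sup>2 + c2 * y + x * b2) - a2 * (a1 * y\<^sup>2 + c1 * y + x * b1)"
      "?D * y\<^sup>2 - x * ?J = c2 * (a1 * y\<^sup>2 + c1 * y + x * b1) - c1 * (a2 * y\<^sup>2 + c2 * y + x * b2)"
      by (simp_all add: algebra_simps)
    then have "?D * y = - x * ?E" "?D * y\<^sup>2 = x * ?J"
      by (simp_all add: that eq_neg_iff_add_eq_0)
    then have "(- x * ?E)\<^sup>2 = ?D * (x * ?J)" by (metis power2_eq_square mult.assoc mult.left_commute)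
    then show ?thesis by (simp add: power2_eq_square algebra_simps)
  qed
  from this[OF assms(2,3)] show ?thesis using assms(1) by (simp add: sextic_def)
qed

text \<open>Eliminating the square of \<open>y\<close> forces the given value of \<open>y\<close>;
  at a root of the resultant it solves both quadratics.\<close>

lemma sextic_solve:
  fixes x :: "'a::field"
  assumes "poly (sextic p1 q1 P1 Q1 k1 p2 q2 P2 Q2 k2) x = 0" "x \<noteq> 0"
    and D: "D = poly (arm_A p1 q1 P1 Q1 * arm_C p2 q2 k2 - arm_A p2 q2 P2 Q2 * arm_C p1 q1 k1) x" "D \<noteq> 0"
    and y: "y = - x * poly (arm_A p1 q1 P1 Q1 * arm_B p2 q2 P2 Q2 - arm_A p2 q2 P2 Q2 * arm_B p1 q1 P1 Q1) x / D"
  shows "poly (arm_A p1 q1 P1 Q1) x * y\<^sup>2 + poly (arm_C p1 q1 k1) x * y + x * poly (arm_B p1 q1 P1 Q1) x = 0"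
    "poly (arm_A p2 q2 P2 Q2) x * y\<^sup>2 + poly (arm_C p2 q2 k2) x * y + x * poly (arm_B p2 q2 P2 Q2) x = 0"
proof -
  define a1 b1 c1 where "a1 = poly (arm_A p1 q1 P1 Q1) x" and "b1 = poly (arm_B p1 q1 P1 Q1) x" and "c1 = poly (arm_C p1 q1 k1) x"
  define a2 b2 c2 where "a2 = poly (arm_A p2 q2 P2 Q2) x" and "b2 = poly (arm_B p2 q2 P2 Q2) x" and "c2 = poly (arm_C p2 q2 k2) x"
  note defs = a1_def b1_def c1_def a2_def b2_def c2_def
  have D': "D = a1 * c2 - a2 * c1" using D(1) by (simp add: defs)
  have s: "D * (c1 * b2 - c2 * b1) = x * (a1 * b2 - a2 * b1)\<^sup>2"
    using assms(1) by (simp add: sextic_def D' defs)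
  have yD: "y * D = - x * (a1 * b2 - a2 * b1)" using y D(2) by (simp add: defs)
  \<comment> \<open>The last bracket is the 3x3 determinant with rows (a, c, b), (a1, c1, b1), (a2,
    c2, b2), which vanishes when the first row repeats one of the others.\<close>
  have eliminate: "D\<^sup>2 * (a * y\<^sup>2 + c * y + x * b) =
      x * D * (a * (c1 * b2 - c2 * b1) - c * (a1 * b2 - a2 * b1) + b * D)" for a b c
  proof -
    have "D\<^sup>2 * (a * y\<^sup>2 + c * y + x * b) = a * (y * D)\<^sup>2 + c * D * (y * D) + x * b * D\<^sup>2"
      by (simp add: power2_eq_square algebra_simps)
    also have "\<dots> = a * x * (x * (a1 * b2 - a2 * b1)\<^sup>2) - c * D * x * (a1 * b2 - a2 * b1) + x * b * D\<^sup>2"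
      unfolding yD by (simp add: power2_eq_square algebra_simps)
    also have "\<dots> = x * D * (a * (c1 * b2 - c2 * b1) - c * (a1 * b2 - a2 * b1) + b * D)"
      unfolding s[symmetric] by (simp add: power2_eq_square algebra_simps)
    finally show ?thesis .
  qed
  have "D\<^sup>2 * (a1 * y\<^sup>2 + c1 * y + x * b1) = 0" "D\<^sup>2 * (a2 * y\<^sup>2 + c2 * y + x * b2) = 0"
    unfolding eliminate by (simp_all add: D' algebra_simps)
  then show "poly (arm_A p1 q1 P1 Q1) x * y\<^sup>2 + poly (arm_C p1 q1 k1) x * y + x * poly (arm_B p1 q1 P1 Q1) x = 0"
    "poly (arm_A p2 q2 P2 Q2) x * y\<^sup>2 + poly (arm_C p2 q2 k2) x * y + x * poly (arm_B p2 q2 P2 Q2) x = 0"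
    using D(2) by (simp_all add: defs)
qed

lemma coeff_6_sextic:
  "coeff (sextic p1 q1 P1 Q1 k1 p2 q2 P2 Q2 k2) 6 = (P2 * p1 - P1 * p2) * (p1 * p2 * (Q2 - Q1))"
  by (simp add: sextic_def arm_A_def arm_B_def arm_C_def power2_eq_square coeff_pCons numeral_eq_Suc algebra_simps)

lemma poly_corr_sextic:
  assumes fc: "field_corr \<Phi>"
    and "(p1, p1') \<in> \<Phi>" "(q1, q1') \<in> \<Phi>" "(P1, P1') \<in> \<Phi>" "(Q1, Q1') \<in> \<Phi>" "(k1, k1') \<in> \<Phi>"
    and "(p2, p2') \<in> \<Phi>" "(q2, q2') \<in> \<Phi>" "(P2, P2') \<in> \<Phi>" "(Q2, Q2') \<in> \<Phi>" "(k2, k2') \<in> \<Phi>"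
  shows "(sextic p1 q1 P1 Q1 k1 p2 q2 P2 Q2 k2, sextic p1' q1' P1' Q1' k1' p2' q2' P2' Q2' k2') \<in> poly_corr \<Phi>"
  unfolding sextic_def arm_A_def arm_B_def arm_C_def power2_eq_square
  using field_corr_ring[OF fc]
  by (intro poly_corr_diff poly_corr_mult poly_corr_pCons poly_corr_0 corr_uminus corr_mult corr_one corr_zero assms)

text \<open>Entries are products of differences in isotropic coordinates, where v1 is (0, 0) and v2
  is (1, 1), listed in the order of \<open>doublet_edge\<close>.\<close>

definition sq_lengths :: "(nat \<Rightarrow> 'a::comm_ring_1) \<Rightarrow> nat \<Rightarrow> 'a" where
  "sq_lengths z i = (if i < 8 then
     [z 0 * z 1, z 2 * z 3, (z 0 - z 2) * (z 1 - z 3),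
      z 4 * z 5, z 6 * z 7, (z 4 - z 6) * (z 5 - z 7),
      (1 + z 4 - z 0) * (1 + z 5 - z 1), (1 + z 6 - z 2) * (1 + z 7 - z 3)] ! i else 0)"

lemma sq_lengths_simps:
  "sq_lengths z 0 = z 0 * z 1" "sq_lengths z (Suc 0) = z 2 * z 3" "sq_lengths z 2 = (z 0 - z 2) * (z 1 - z 3)"
  "sq_lengths z 3 = z 4 * z 5" "sq_lengths z 4 = z 6 * z 7" "sq_lengths z 5 = (z 4 - z 6) * (z 5 - z 7)"
  "sq_lengths z 6 = (1 + z 4 - z 0) * (1 + z 5 - z 1)" "sq_lengths z 7 = (1 + z 6 - z 2) * (1 + z 7 - z 3)"
  "i \<ge> 8 \<Longrightarrow> sq_lengths z i = 0"
  by (simp_all add: sq_lengths_def)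

lemma less_8_cases: "(i::nat) < 8 \<Longrightarrow> i = 0 \<or> i = Suc 0 \<or> i = 2 \<or> i = 3 \<or> i = 4 \<or> i = 5 \<or> i = 6 \<or> i = 7"
  by auto

lemma eq_sq_lengthsI:
  assumes "\<And>i. i \<ge> 8 \<Longrightarrow> d i = 0"
    and "d 0 = z 0 * z 1" "d 1 = z 2 * z 3" "d 2 = (z 0 - z 2) * (z 1 - z 3)"
      "d 3 = z 4 * z 5" "d 4 = z 6 * z 7" "d 5 = (z 4 - z 6) * (z 5 - z 7)"
      "d 6 = (1 + z 4 - z 0) * (1 + z 5 - z 1)" "d 7 = (1 + z 6 - z 2) * (1 + z 7 - z 3)"
  shows "d = sq_lengths z"
proof
  fix i
  show "d i = sq_lengths z i"
    using less_8_cases[of i] assms by (cases "i < 8") (auto simp: sq_lengths_simps)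
qed

lemma sq_lengths_expr: "\<exists>\<sigma>. \<forall>z :: nat \<Rightarrow> 'a::comm_ring_1. \<forall>i. expr_eval z (\<sigma> i) = sq_lengths z i"
proof -
  let ?d = "\<lambda>e e'. Add e (Mult (Const (- 1)) e')"
  define \<sigma> where "\<sigma> i = (if i < 8 then
     [Mult (Var 0) (Var 1), Mult (Var 2) (Var 3), Mult (?d (Var 0) (Var 2)) (?d (Var 1) (Var 3)),
      Mult (Var 4) (Var 5), Mult (Var 6) (Var 7), Mult (?d (Var 4) (Var 6)) (?d (Var 5) (Var 7)),
      Mult (?d (Add (Const 1) (Var 4)) (Var 0)) (?d (Add (Const 1) (Var 5)) (Var 1)),
      Mult (?d (Add (Const 1) (Var 6)) (Var 2)) (?d (Add (Const 1) (Var 7)) (Var 3))] ! i else Const 0)" for i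
  have "expr_eval z (\<sigma> i) = sq_lengths z i" for z :: "nat \<Rightarrow> 'a" and i
    using less_8_cases[of i] by (cases "i < 8") (auto simp: sq_lengths_simps \<sigma>_def)
  then show ?thesis by blast
qed

lemma complex_quadratic_root:
  assumes "(a::complex) \<noteq> 0"
  shows "\<exists>y. a * y\<^sup>2 + b * y + c = 0"
proof -
  have "\<not> constant (poly [:c, b, a:])" using assms by (simp add: constant_degree)
  then obtain y where "poly [:c, b, a:] y = 0" using fundamental_theorem_of_algebra by blast
  then show ?thesis by (intro exI[of _ y]) (simp add: power2_eq_square algebra_simps)
qed

text \<open>A triangle with a vertex at the origin and squared side lengths \<open>a\<close>, \<open>b\<close>, \<open>c\<close> is, up to rotation,
  \<open>(1, a)\<close>, \<open>(\<rho>, b / \<rho>)\<close> in isotropic coordinates.\<close>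

lemma triangle_shape:
  assumes "(a::complex) \<noteq> 0" "b \<noteq> 0"
  obtains \<rho> where "\<rho> \<noteq> 0" "(1 - \<rho>) * (a - b / \<rho>) = c"
proof -
  obtain \<rho> where \<rho>: "(- a) * \<rho>\<^sup>2 + (a + b - c) * \<rho> + - b = 0"
    using complex_quadratic_root[of "- a" "a + b - c" "- b"] assms by auto
  then have "\<rho> \<noteq> 0" using assms by auto
  moreover have "(1 - \<rho>) * (a - b / \<rho>) = c"
    using \<rho> \<open>\<rho> \<noteq> 0\<close> by (simp add: field_simps power2_eq_square)
  ultimately show thesis using that by blast
qed

text \<open>With both shapes fixed, almost every rotation \<open>x\<close> of the first triangle can
  be completed by a \<open>y\<close> that realises \<open>d 6\<close>, and then produces some value
  \<open>s\<close> of the last length. Each \<open>s\<close> arises from at most six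
  \<open>x\<close>, the roots of a nonzero sextic.\<close>

lemma sq_lengths_infinitely_many:
  fixes d :: "nat \<Rightarrow> complex"
  assumes d: "\<And>i. i \<ge> 8 \<Longrightarrow> d i = 0" "d 0 \<noteq> 0" "d 1 \<noteq> 0" "d 3 \<noteq> 0" "d 4 \<noteq> 0" "d 5 \<noteq> 0"
    and \<rho>: "\<rho> \<noteq> 0" "(1 - \<rho>) * (d 0 - d 1 / \<rho>) = d 2"
    and \<tau>: "\<tau> \<noteq> 0" "(1 - \<tau>) * (d 3 - d 4 / \<tau>) = d 5" and neq: "\<rho> \<noteq> \<tau>"
  shows "infinite {s. \<exists>z. (\<forall>i\<ge>8. z i = 0) \<and> d(7 := s) = sq_lengths z}" (is "infinite ?A")
proof
  assume fin: "finite ?A"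
  define f where "f s = sextic 1 (d 0) 1 (d 3) (1 + 1 * d 3 + 1 * d 0 - d 6) \<rho> (d 1 / \<rho>) \<tau> (d 4 / \<tau>) (1 + \<tau> * (d 4 / \<tau>) + \<rho> * (d 1 / \<rho>) - s)" for s
  have "d 4 / \<tau> \<noteq> d 3" using \<tau>(2) d(6) by auto
  then have "coeff (f s) 6 \<noteq> 0" for s
    unfolding f_def coeff_6_sextic using \<rho>(1) neq by simp
  then have "f s \<noteq> 0" for s by (metis coeff_0)
  then have "finite (\<Union>s\<in>?A. {x. poly (f s) x = 0})"
    using fin poly_roots_finite by blast
  moreover have "UNIV - {0, 1, d 0} \<subseteq> (\<Union>s\<in>?A. {x. poly (f s) x = 0})"
  proof
    fix x assume "x \<in> UNIV - {0, 1, d 0}"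
    then have x: "x \<noteq> 0" "x \<noteq> 1" "x \<noteq> d 0" by auto
    have A0: "poly (arm_A 1 (d 0) 1 (d 3)) x \<noteq> 0" using x by (simp add: arm_A_def)
    obtain y where y: "poly (arm_A 1 (d 0) 1 (d 3)) x * y\<^sup>2 + poly (arm_C 1 (d 0) (1 + 1 * d 3 + 1 * d 0 - d 6)) x * y
        + x * poly (arm_B 1 (d 0) 1 (d 3)) x = 0"
      using complex_quadratic_root[OF A0] by blast
    \<comment> \<open>Excluding \<open>x = 1\<close> keeps the constant term of the quadratic
      nonzero, hence \<open>y\<close> too.\<close>
    have "poly (arm_B 1 (d 0) 1 (d 3)) x = d 3 * (1 - x)" by (simp add: arm_B_def algebra_simps)
    then have y0: "y \<noteq> 0" using y x d(4) by auto
    define s where "s = (1 + \<tau> * y - \<rho> * x) * (1 + d 4 / \<tau> / y - d 1 / \<rho> / x)"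
    define z where "z i = (if i < 8 then [x, d 0 / x, \<rho> * x, d 1 / (\<rho> * x), y, d 3 / y, \<tau> * y, d 4 / (\<tau> * y)] ! i else 0)" for i
    have z: "z 0 = x" "z 1 = d 0 / x" "z (Suc 0) = d 0 / x" "z 2 = \<rho> * x" "z 3 = d 1 / (\<rho> * x)"
      "z 4 = y" "z 5 = d 3 / y" "z 6 = \<tau> * y" "z 7 = d 4 / (\<tau> * y)" "\<forall>i\<ge>8. z i = 0" by (simp_all add: z_def)
    have d6: "(1 + 1 * y - 1 * x) * (1 + d 3 / y - d 0 / x) = d 6"
      using arm_equation[OF x(1) y0] y by metis
    have "d(7 := s) = sq_lengths z"
    proof (rule eq_sq_lengthsI)
      show "(d(7 := s)) 2 = (z 0 - z 2) * (z 1 - z 3)"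
        unfolding z using \<rho> x by (simp add: field_simps flip: \<rho>(2))
      show "(d(7 := s)) 5 = (z 4 - z 6) * (z 5 - z 7)"
        unfolding z using \<tau> y0 by (simp add: field_simps flip: \<tau>(2))
      show "(d(7 := s)) 6 = (1 + z 4 - z 0) * (1 + z 5 - z 1)"
        unfolding z using d6 by simp
      show "(d(7 := s)) 7 = (1 + z 6 - z 2) * (1 + z 7 - z 3)"
        unfolding z s_def by simp
    qed (use x y0 \<rho>(1) \<tau>(1) d(1) in \<open>simp_all add: z\<close>)
    then have "s \<in> ?A" using z(10) by blast
    moreover have "poly (f s) x = 0"
      unfolding f_def
    proof (rule sextic_root[OF x(1) y])
      show "poly (arm_A \<rho> (d 1 / \<rho>) \<tau> (d 4 / \<tau>)) x * y\<^sup>2 +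
        poly (arm_C \<rho> (d 1 / \<rho>) (1 + \<tau> * (d 4 / \<tau>) + \<rho> * (d 1 / \<rho>) - s)) x * y +
        x * poly (arm_B \<rho> (d 1 / \<rho>) \<tau> (d 4 / \<tau>)) x = 0"
        using arm_equation[OF x(1) y0] s_def by metis
    qed
    ultimately show "x \<in> (\<Union>s\<in>?A. {x. poly (f s) x = 0})" by blast
  qed
  ultimately have "finite (UNIV - {0, 1, d 0})" by (rule finite_subset[rotated])
  then show False by (simp add: infinite_UNIV_char_0)
qed

text \<open>For fixed \<open>d 5\<close> outside a finite set, infinitely many values of \<open>d 7\<close> are attained, so the polynomial
  vanishes identically in these two variables.\<close>

lemma sq_lengths_dominant:
  fixes d :: "nat \<Rightarrow> complex"
  assumes d: "\<And>i. i \<ge> 8 \<Longrightarrow> d i = 0" "d 0 \<noteq> 0" "d 1 \<noteq> 0" "d 3 \<noteq> 0" "d 4 \<noteq> 0"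
    and zero: "\<And>z :: nat \<Rightarrow> complex. (\<forall>i\<ge>8. z i = 0) \<Longrightarrow> expr_eval (sq_lengths z) e = 0"
  shows "expr_eval d e = 0"
proof -
  obtain \<rho> where \<rho>: "\<rho> \<noteq> 0" "(1 - \<rho>) * (d 0 - d 1 / \<rho>) = d 2"
    using triangle_shape[OF d(2,3)] .
  \<comment> \<open>Besides 0, the excluded value is the one \<open>d 5\<close> takes when both
    triangles have the same parameter \<rho>.\<close>
  have "expr_eval (d(5 := s)) e = 0" if s: "s \<in> - {0, (1 - \<rho>) * (d 3 - d 4 / \<rho>)}" for s
  proof -
    obtain \<tau> where \<tau>: "\<tau> \<noteq> 0" "(1 - \<tau>) * (d 3 - d 4 / \<tau>) = s"
      using triangle_shape[OF d(4,5)] .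
    have "\<rho> \<noteq> \<tau>" using s \<tau>(2) by auto
    then have "infinite {t. \<exists>z. (\<forall>i\<ge>8. z i = 0) \<and> (d(5 := s))(7 := t) = sq_lengths z}"
      using s d \<rho> \<tau> by (intro sq_lengths_infinitely_many[where \<rho> = \<rho> and \<tau> = \<tau>]) auto
    moreover have "expr_eval ((d(5 := s))(7 := t)) e = 0"
      if "t \<in> {t. \<exists>z. (\<forall>i\<ge>8. z i = 0) \<and> (d(5 := s))(7 := t) = sq_lengths z}" for t
      using that zero by auto
    ultimately have "expr_eval ((d(5 := s))(7 := (d(5 := s)) 7)) e = 0"
      by (rule expr_eval_zero_infinite)
    then show ?thesis by (simp only: fun_upd_triv)
  qed
  moreover have "infinite (- {0, (1 - \<rho>) * (d 3 - d 4 / \<rho>)})"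
    by (simp add: Compl_eq_Diff_UNIV infinite_UNIV_char_0)
  ultimately have "expr_eval (d(5 := d 5)) e = 0"
    using expr_eval_zero_infinite[of "- {0, (1 - \<rho>) * (d 3 - d 4 / \<rho>)}" d 5 e "d 5"] by blast
  then show ?thesis by simp
qed


section \<open>Carrying a generic configuration to prescribed lengths\<close>

lemma expr_eval_corr:
  assumes rc: "ring_corr \<Phi>" and "\<And>i. (z i, w i) \<in> \<Phi>"
  shows "(expr_eval z e, expr_eval w e) \<in> \<Phi>"
  using assms(2) by (induction e) (auto intro: corr_of_int[OF rc] corr_add[OF rc] corr_mult[OF rc])

lemma sq_lengths_corr:
  fixes z w :: "nat \<Rightarrow> 'a::field"
  assumes "ring_corr \<Phi>" "\<And>i. (z i, w i) \<in> \<Phi>"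
  shows "(sq_lengths z i, sq_lengths w i) \<in> \<Phi>"
proof -
  obtain \<sigma> where "\<forall>z :: nat \<Rightarrow> 'a. \<forall>i. expr_eval z (\<sigma> i) = sq_lengths z i"
    using sq_lengths_expr by blast
  moreover have "(expr_eval z (\<sigma> i), expr_eval w (\<sigma> i)) \<in> \<Phi>"
    by (rule expr_eval_corr) (rule assms)+
  ultimately show ?thesis by simp
qed

lemma ring_corr_evaluations:
  fixes x y :: "nat \<Rightarrow> 'a::field"
  assumes "\<And>e. expr_eval x e = 0 \<longleftrightarrow> expr_eval y e = 0"
  shows "ring_corr {(expr_eval x e, expr_eval y e) | e. True}"
  unfolding ring_corr_def
proof (intro conjI allI impI)
  show "(1, 1) \<in> {(expr_eval x e, expr_eval y e) | e. True}"
    by (auto intro!: exI[of _ "Const 1"])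
  fix a b assume "(a, b) \<in> {(expr_eval x e, expr_eval y e) | e. True}"
  then obtain e where e: "a = expr_eval x e" "b = expr_eval y e" by blast
  show "a = 0 \<longleftrightarrow> b = 0" unfolding e by (rule assms)
  fix a' b' assume "(a', b') \<in> {(expr_eval x e, expr_eval y e) | e. True}"
  then obtain e' where e': "a' = expr_eval x e'" "b' = expr_eval y e'" by blast
  show "(a - a', b - b') \<in> {(expr_eval x e, expr_eval y e) | e. True}"
    unfolding e e' by (auto intro!: exI[of _ "Add e (Mult (Const (- 1)) e')"])
  show "(a * a', b * b') \<in> {(expr_eval x e, expr_eval y e) | e. True}"
    unfolding e e' by (auto intro!: exI[of _ "Mult e e'"])
qed

text \<open>An expression vanishing at a generic point vanishes at \<open>base_point\<close>, so one
  numerical value there is a certificate.\<close>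

lemma generic_nonzero:
  assumes "generic_point 8 (z :: nat \<Rightarrow> complex)" "expr_eval base_point e \<noteq> 0"
  shows "expr_eval z e \<noteq> 0"
proof
  assume "expr_eval z e = 0"
  then have "expr_eval (\<lambda>i. complex_of_int (base_point i)) e = 0"
    using assms(1) unfolding generic_point_def by (simp add: base_point_def)
  then show False using assms(2) unfolding expr_eval_of_int by simp
qed

lemma generic_nonzeros:
  assumes z: "generic_point 8 (z :: nat \<Rightarrow> complex)"
  shows "i < 8 \<Longrightarrow> z i \<noteq> 0" "z 1 \<noteq> 1" "z 7 \<noteq> z 5" "z 6 * z 0 \<noteq> z 4 * z 2"
    "z 6 * (z 5 * z 0) \<noteq> z 4 * (z 7 * z 2)"
proof -
  show "z i \<noteq> 0" if "i < 8"
    using generic_nonzero[OF z, of "Var i"] less_8_cases[OF that] by (auto simp: base_point_def)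
  show "z 1 \<noteq> 1"
    using generic_nonzero[OF z, of "Add (Var 1) (Const (- 1))"] by (auto simp: base_point_def)
  show "z 7 \<noteq> z 5"
    using generic_nonzero[OF z, of "Add (Var 7) (Mult (Const (- 1)) (Var 5))"] by (auto simp: base_point_def)
  show "z 6 * z 0 \<noteq> z 4 * z 2"
    using generic_nonzero[OF z, of "Add (Mult (Var 6) (Var 0)) (Mult (Const (- 1)) (Mult (Var 4) (Var 2)))"]
    by (auto simp: base_point_def)
  show "z 6 * (z 5 * z 0) \<noteq> z 4 * (z 7 * z 2)"
    using generic_nonzero[OF z, of "Add (Mult (Var 6) (Mult (Var 5) (Var 0)))
        (Mult (Const (- 1)) (Mult (Var 4) (Mult (Var 7) (Var 2))))"]
    by (auto simp: base_point_def)
qed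

text \<open>Both length vectors satisfy only trivial relations, so Q(sq_lengths z) and Q(d) are
  isomorphic. The isomorphism is extended through \<rho> and \<tau> (quadratic), \<open>z 0\<close>
  (root of the sextic) and \<open>z 4\<close> (quadratic); the other coordinates are rational in
  these.\<close>

lemma generic_configuration_corr:
  fixes z d :: "nat \<Rightarrow> complex"
  assumes z: "generic_point 8 z" and d: "generic_point 8 d"
  shows "\<exists>\<Psi> w. field_corr \<Psi> \<and> (\<forall>i. (z i, w i) \<in> \<Psi>) \<and> d = sq_lengths w"
proof -
  define c where "c = sq_lengths z"
  have nz: "z i \<noteq> 0" if "i < 8" for i using generic_nonzeros(1)[OF z that] .
  have cz: "c 0 = z 0 * z 1" "c 1 = z 2 * z 3" "c 2 = (z 0 - z 2) * (z 1 - z 3)"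
    "c 3 = z 4 * z 5" "c 4 = z 6 * z 7" "c 5 = (z 4 - z 6) * (z 5 - z 7)"
    "c 6 = (1 + z 4 - z 0) * (1 + z 5 - z 1)" "c 7 = (1 + z 6 - z 2) * (1 + z 7 - z 3)"
    "\<And>i. i \<ge> 8 \<Longrightarrow> c i = 0" "c (Suc 0) = z 2 * z 3"
    by (simp_all add: c_def sq_lengths_simps)
  obtain \<sigma> where \<sigma>: "\<And>(z :: nat \<Rightarrow> complex) i. expr_eval z (\<sigma> i) = sq_lengths z i"
    using sq_lengths_expr by blast
  have subst: "expr_eval u (expr_subst \<sigma> e) = expr_eval (sq_lengths u) e" for u :: "nat \<Rightarrow> complex" and e
    by (simp add: expr_eval_subst \<sigma>)
  have d_nz: "d i \<noteq> 0" if "i < 8" for i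
  proof
    assume "d i = 0"
    then have "expr_eval d (Var i) = 0" by simp
    then have "\<forall>z :: nat \<Rightarrow> complex. (\<forall>i\<ge>8. z i = 0) \<longrightarrow> expr_eval z (Var i) = 0"
      using d unfolding generic_point_def by blast
    from this[rule_format, of "\<lambda>j. if j < 8 then 1 else 0"] show False using that by simp
  qed
  have "expr_eval c e = 0 \<longleftrightarrow> expr_eval d e = 0" for e
  proof
    assume "expr_eval c e = 0"
    then have "expr_eval z (expr_subst \<sigma> e) = 0" by (simp add: subst c_def)
    then have vanish: "expr_eval (sq_lengths u) e = 0" if "\<forall>i\<ge>8. u i = 0" for u :: "nat \<Rightarrow> complex"
      using z that unfolding generic_point_def subst[symmetric] by blast
    show "expr_eval d e = 0"
    proof (rule sq_lengths_dominant)
      show "d i = 0" if "i \<ge> 8" for i using d that unfolding generic_point_def by blast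
    qed (simp_all add: d_nz vanish)
  next
    assume "expr_eval d e = 0"
    then show "expr_eval c e = 0" using d cz(9) unfolding generic_point_def by blast
  qed
  then have "ring_corr {(expr_eval c e, expr_eval d e) | e. True}"
    by (rule ring_corr_evaluations)
  then obtain \<Phi> where \<Phi>: "field_corr \<Phi>" "{(expr_eval c e, expr_eval d e) | e. True} \<subseteq> \<Phi>"
    by (rule fraction_corr)
  have cd: "(c i, d i) \<in> \<Phi>" for i
  proof -
    have "(expr_eval c (Var i), expr_eval d (Var i)) \<in> \<Phi>" using \<Phi>(2) by blast
    then show ?thesis by simp
  qed
  have quadratic: "\<exists>b \<Psi>. field_corr \<Psi> \<and> \<Phi> \<subseteq> \<Psi> \<and> (a, b) \<in> \<Psi>"
    if \<Phi>: "field_corr \<Phi>" "(l0, m0) \<in> \<Phi>" "(l1, m1) \<in> \<Phi>" "(l2, m2) \<in> \<Phi>" and l: "l2 \<noteq> 0" "l2 * a\<^sup>2 + l1 * a + l0 = 0"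
    for \<Phi> l0 l1 l2 m0 m1 m2 and a :: complex
  proof (rule field_corr_extend[OF \<Phi>(1)])
    show "([:l0, l1, l2:], [:m0, m1, m2:]) \<in> poly_corr \<Phi>"
      using field_corr_ring[OF \<Phi>(1)] by (intro poly_corr_pCons poly_corr_0 \<Phi>)
    show "poly [:l0, l1, l2:] a = 0" using l(2) by (simp add: power2_eq_square algebra_simps)
  qed (use l in simp)
  \<comment> \<open>The shape parameters of the two triangles; \<open>z 0\<close> and
    \<open>z 4\<close> act as their rotation scalars.\<close>
  define \<rho> \<tau> where "\<rho> = z 2 / z 0" and "\<tau> = z 6 / z 4"
  have zr: "z 2 = \<rho> * z 0" "z 6 = \<tau> * z 4" using nz by (simp_all add: \<rho>_def \<tau>_def)
  note rc = field_corr_ring[OF \<Phi>(1)]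
  have "\<exists>r \<Psi>. field_corr \<Psi> \<and> \<Phi> \<subseteq> \<Psi> \<and> (\<rho>, r) \<in> \<Psi>"
  proof (rule quadratic[OF \<Phi>(1)])
    show "(- c 1, - d 1) \<in> \<Phi>" "(c 0 + c 1 - c 2, d 0 + d 1 - d 2) \<in> \<Phi>" "(- c 0, - d 0) \<in> \<Phi>"
      by (intro corr_uminus corr_diff corr_add rc cd)+
    show "- c 0 \<noteq> 0" using nz by (simp add: cz(1))
    show "- c 0 * \<rho>\<^sup>2 + (c 0 + c 1 - c 2) * \<rho> + - c 1 = 0"
      by (simp add: cz(1,2,3,10) zr(1) algebra_simps power2_eq_square)
  qed
  then obtain r \<Phi>1 where \<Phi>1: "field_corr \<Phi>1" "\<Phi> \<subseteq> \<Phi>1" "(\<rho>, r) \<in> \<Phi>1" by blast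
  have cd1: "(c i, d i) \<in> \<Phi>1" for i using cd \<Phi>1(2) by blast
  note rc1 = field_corr_ring[OF \<Phi>1(1)]
  have "\<exists>t \<Psi>. field_corr \<Psi> \<and> \<Phi>1 \<subseteq> \<Psi> \<and> (\<tau>, t) \<in> \<Psi>"
  proof (rule quadratic[OF \<Phi>1(1)])
    show "(- c 4, - d 4) \<in> \<Phi>1" "(c 3 + c 4 - c 5, d 3 + d 4 - d 5) \<in> \<Phi>1" "(- c 3, - d 3) \<in> \<Phi>1"
      by (intro corr_uminus corr_diff corr_add rc1 cd1)+
    show "- c 3 \<noteq> 0" using nz by (simp add: cz(4))
    show "- c 3 * \<tau>\<^sup>2 + (c 3 + c 4 - c 5) * \<tau> + - c 4 = 0"
      by (simp add: cz(4,5,6) zr(2) algebra_simps power2_eq_square)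
  qed
  then obtain t \<Phi>2 where \<Phi>2: "field_corr \<Phi>2" "\<Phi>1 \<subseteq> \<Phi>2" "(\<tau>, t) \<in> \<Phi>2" by blast
  have cd2: "(c i, d i) \<in> \<Phi>2" for i using cd1 \<Phi>2(2) by blast
  have rt: "(\<rho>, r) \<in> \<Phi>2" "(\<tau>, t) \<in> \<Phi>2" using \<Phi>1 \<Phi>2 by auto
  note rc2 = field_corr_ring[OF \<Phi>2(1)]
  let ?k1 = "\<lambda>c. 1 + 1 * c 3 + 1 * c 0 - c 6"
  let ?k2 = "\<lambda>c \<rho> \<tau>. 1 + \<tau> * (c 4 / \<tau>) + \<rho> * (c 1 / \<rho>) - c 7"
  let ?S = "\<lambda>c \<rho> \<tau>. sextic 1 (c 0) 1 (c 3) (?k1 c) \<rho> (c 1 / \<rho>) \<tau> (c 4 / \<tau>) (?k2 c \<rho> \<tau>)"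
  have nz': "\<rho> \<noteq> 0" "\<tau> \<noteq> 0" using nz by (simp_all add: \<rho>_def \<tau>_def)
  have arm1: "poly (arm_A 1 (c 0) 1 (c 3)) (z 0) * (z 4)\<^sup>2 + poly (arm_C 1 (c 0) (?k1 c)) (z 0) * z 4
      + z 0 * poly (arm_B 1 (c 0) 1 (c 3)) (z 0) = 0"
    using arm_equation[of "z 0" "z 4" 1 1 "c 3" "c 0" "c 6"] nz by (simp add: cz)
  have arm2: "poly (arm_A \<rho> (c 1 / \<rho>) \<tau> (c 4 / \<tau>)) (z 0) * (z 4)\<^sup>2
      + poly (arm_C \<rho> (c 1 / \<rho>) (?k2 c \<rho> \<tau>)) (z 0) * z 4
      + z 0 * poly (arm_B \<rho> (c 1 / \<rho>) \<tau> (c 4 / \<tau>)) (z 0) = 0"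
  proof -
    have "(1 + \<tau> * z 4 - \<rho> * z 0) * (1 + (c 4 / \<tau>) / z 4 - (c 1 / \<rho>) / z 0) = c 7"
      using nz by (simp add: \<rho>_def \<tau>_def cz)
    then show ?thesis by (rule iffD1[OF arm_equation[OF nz nz], rotated 2]) simp_all
  qed
  have "\<exists>x \<Psi>. field_corr \<Psi> \<and> \<Phi>2 \<subseteq> \<Psi> \<and> (z 0, x) \<in> \<Psi>"
  proof (rule field_corr_extend[OF \<Phi>2(1)])
    show "(?S c \<rho> \<tau>, ?S d r t) \<in> poly_corr \<Phi>2"
      by (intro poly_corr_sextic[OF \<Phi>2(1)] corr_divide[OF \<Phi>2(1)] corr_diff corr_add corr_mult corr_one rc2 cd2 rt)
    have "c 4 / \<tau> - c 3 = z 4 * (z 7 - z 5)"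
      using nz by (simp add: \<tau>_def cz(4,5) algebra_simps)
    moreover have "\<tau> \<noteq> \<rho>"
      using generic_nonzeros(4)[OF z] nz by (simp add: \<rho>_def \<tau>_def frac_eq_eq mult.commute)
    ultimately have "coeff (?S c \<rho> \<tau>) 6 \<noteq> 0"
      unfolding coeff_6_sextic using nz nz' generic_nonzeros(3)[OF z] by simp
    then show "?S c \<rho> \<tau> \<noteq> 0" by (metis coeff_0)
    show "poly (?S c \<rho> \<tau>) (z 0) = 0"
      by (rule sextic_root[OF _ arm1 arm2]) (use nz in simp)
  qed
  then obtain x \<Phi>3 where \<Phi>3: "field_corr \<Phi>3" "\<Phi>2 \<subseteq> \<Phi>3" "(z 0, x) \<in> \<Phi>3" by blast
  have cd3: "(c i, d i) \<in> \<Phi>3" for i using cd2 \<Phi>3(2) by blast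
  note rc3 = field_corr_ring[OF \<Phi>3(1)]
  have "\<exists>y \<Psi>. field_corr \<Psi> \<and> \<Phi>3 \<subseteq> \<Psi> \<and> (z 4, y) \<in> \<Psi>"
  proof (rule quadratic[OF \<Phi>3(1)])
    show "(z 0 * poly (arm_B 1 (c 0) 1 (c 3)) (z 0), x * poly (arm_B 1 (d 0) 1 (d 3)) x) \<in> \<Phi>3"
      "(poly (arm_C 1 (c 0) (?k1 c)) (z 0), poly (arm_C 1 (d 0) (?k1 d)) x) \<in> \<Phi>3"
      "(poly (arm_A 1 (c 0) 1 (c 3)) (z 0), poly (arm_A 1 (d 0) 1 (d 3)) x) \<in> \<Phi>3"
      unfolding arm_A_def arm_B_def arm_C_def
      by (intro corr_poly corr_mult poly_corr_pCons poly_corr_0 corr_uminus corr_add corr_diff corr_one rc3 cd3 \<Phi>3(3))+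
    show "poly (arm_A 1 (c 0) 1 (c 3)) (z 0) \<noteq> 0"
      using nz generic_nonzeros(2)[OF z] by (simp add: arm_A_def cz)
  qed (use arm1 in simp)
  then obtain y \<Psi> where \<Psi>: "field_corr \<Psi>" "\<Phi>3 \<subseteq> \<Psi>" "(z 4, y) \<in> \<Psi>" by blast
  have cd\<Psi>: "(c i, d i) \<in> \<Psi>" for i using cd3 \<Psi>(2) by blast
  have p: "(z 0, x) \<in> \<Psi>" "(\<rho>, r) \<in> \<Psi>" "(\<tau>, t) \<in> \<Psi>" using \<Phi>3 \<Psi> rt by auto
  note rc\<Psi> = field_corr_ring[OF \<Psi>(1)]
  define w where "w i = (if i < 8 then [x, d 0 / x, r * x, d 1 / (r * x), y, d 3 / y, t * y, d 4 / (t * y)] ! i else 0)" for i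
  have z_eq: "z 1 = c 0 / z 0" "z 2 = \<rho> * z 0" "z 3 = c 1 / (\<rho> * z 0)" "z 5 = c 3 / z 4" "z 6 = \<tau> * z 4" "z 7 = c 4 / (\<tau> * z 4)"
    using nz by (simp_all add: \<rho>_def \<tau>_def cz)
  have "(z 1, d 0 / x) \<in> \<Psi>" "(z 2, r * x) \<in> \<Psi>" "(z 3, d 1 / (r * x)) \<in> \<Psi>"
    "(z 5, d 3 / y) \<in> \<Psi>" "(z 6, t * y) \<in> \<Psi>" "(z 7, d 4 / (t * y)) \<in> \<Psi>"
    unfolding z_eq by (intro corr_divide[OF \<Psi>(1)] corr_mult rc\<Psi> cd\<Psi> p \<Psi>(3))+
  then have zw: "(z i, w i) \<in> \<Psi>" for i
    using less_8_cases[of i] p \<Psi>(3) corr_zero[OF rc\<Psi>] z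
    by (cases "i < 8") (auto simp: w_def generic_point_def)
  \<comment> \<open>Both sides correspond to \<open>c i\<close>, and the correspondence is
    single-valued.\<close>
  have "d i = sq_lengths w i" for i
    using sq_lengths_corr[of \<Psi> z w i] rc\<Psi> zw cd\<Psi>[of i] corr_left_unique[OF rc\<Psi>] unfolding c_def by blast
  then show ?thesis using \<Psi>(1) zw by blast
qed

text \<open>Conjugating a correspondence by \<Psi> carries fixed elements and cycles to their
  images.\<close>

lemma three_cycles_over_transport:
  assumes R: "three_cycles_over (generated_subfield S) R" and fc: "field_corr \<Psi>"
    and S: "S' \<subseteq> \<Psi> `` S" and g: "bij_betw g R R'" "\<And>x. x \<in> R \<Longrightarrow> (x, g x) \<in> \<Psi>"
  shows "three_cycles_over (generated_subfield S') R'"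
  unfolding three_cycles_over_def
proof (intro allI impI)
  fix a b c e f assume abc: "R' = {a, b, c, e, f}" "distinct [a, b, c, e, f]"
  define h where "h = inv_into R g"
  have R_eq: "R = {h a, h b, h c, h e, h f}"
    using bij_betw_imp_surj_on[OF bij_betw_inv_into[OF g(1)]] unfolding h_def abc(1) by auto
  have gh: "g (h x) = x" "h x \<in> R" if "x \<in> {a, b, c, e, f}" for x
    using g(1) that unfolding h_def abc(1)[symmetric] by (auto simp: bij_betw_def inv_into_into f_inv_into_f)
  have dist: "distinct [h a, h b, h c, h e, h f]"
    using abc(2) gh(1)[of a] gh(1)[of b] gh(1)[of c] gh(1)[of e] gh(1)[of f] by auto
  obtain \<Phi> where \<Phi>: "field_corr \<Phi>" "Id_on (generated_subfield S) \<subseteq> \<Phi>"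
    "{(h a, h b), (h b, h c), (h c, h a), (h e, h e), (h f, h f)} \<subseteq> \<Phi>"
    using R[unfolded three_cycles_over_def, rule_format, OF R_eq dist] by blast
  let ?\<Theta> = "(\<Psi>\<inverse> O \<Phi>) O \<Psi>"
  have \<Theta>: "field_corr ?\<Theta>" by (intro field_corr_relcomp field_corr_converse \<Phi> fc)
  have h\<Psi>: "(h x, x) \<in> \<Psi>" if "x \<in> {a, b, c, e, f}" for x
    using g(2)[OF gh(2)[OF that]] gh(1)[OF that] by simp
  have "(x, y) \<in> ?\<Theta>" if "(h x, h y) \<in> \<Phi>" "x \<in> {a, b, c, e, f}" "y \<in> {a, b, c, e, f}" for x y
    using that(1) h\<Psi>[OF that(2)] h\<Psi>[OF that(3)] by blast
  then have "{(a, b), (b, c), (c, a), (e, e), (f, f)} \<subseteq> ?\<Theta>" using \<Phi>(3) by simp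
  moreover have "Id_on S' \<subseteq> ?\<Theta>"
  proof
    fix p assume "p \<in> Id_on S'"
    then obtain s s' where "p = (s', s')" "s \<in> S" "(s, s') \<in> \<Psi>" using S by blast
    moreover from this have "(s, s) \<in> \<Phi>" using \<Phi>(2) by (auto intro: generated_subfield_incl)
    ultimately show "p \<in> ?\<Theta>" by blast
  qed
  then have "Id_on (generated_subfield S') \<subseteq> ?\<Theta>" by (rule generated_subfield_fixed[OF \<Theta>])
  ultimately show "\<exists>\<Phi>. field_corr \<Phi> \<and> Id_on (generated_subfield S') \<subseteq> \<Phi> \<and>
      {(a, b), (b, c), (c, a), (e, e), (f, f)} \<subseteq> \<Phi>" using \<Theta> by blast
qed


section \<open>Points of the constraint variety\<close>

lemma arm_C_eq:
  assumes "k = p + q - P - Q + P * q + p * (Q::'a::comm_ring_1)"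
  shows "arm_C p q k = [:-1, 1:] * arm_G p q P Q - arm_A p q P Q - arm_B p q P Q"
  using assms by (simp add: arm_C_def arm_G_def arm_A_def arm_B_def algebra_simps)

text \<open>The triangles of \<open>w\<close> are rotated by \<open>r\<close> and by the
  \<open>y\<close> that solves both edge equations. The last hypothesis is the nonzero denominator
  of \<open>y\<close>, and \<open>det_AB\<close> not vanishing gives a nonzero
  \<open>y\<close>.\<close>

lemma ex_second_configuration:
  fixes w :: "nat \<Rightarrow> complex"
  assumes r: "poly (quintic w) r = 0" "r \<noteq> 0" "poly (det_AB w) r \<noteq> 0"
    and D: "poly ([:-1, 1:] * det_AG w - det_AB w) r \<noteq> 0"
  shows "\<exists>u. u 0 = w 0 * r \<and> sq_lengths u = sq_lengths w"
proof -
  define k1 where "k1 = 1 + w 4 * w 5 + w 0 * w 1 - (1 + w 4 - w 0) * (1 + w 5 - w 1)"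
  define k2 where "k2 = 1 + w 6 * w 7 + w 2 * w 3 - (1 + w 6 - w 2) * (1 + w 7 - w 3)"
  have C: "arm_C (w 0) (w 1) k1 = [:-1, 1:] * arm_G (w 0) (w 1) (w 4) (w 5) - arm_A (w 0) (w 1) (w 4) (w 5) - arm_B (w 0) (w 1) (w 4) (w 5)"
    "arm_C (w 2) (w 3) k2 = [:-1, 1:] * arm_G (w 2) (w 3) (w 6) (w 7) - arm_A (w 2) (w 3) (w 6) (w 7) - arm_B (w 2) (w 3) (w 6) (w 7)"
    by (rule arm_C_eq, simp add: k1_def k2_def algebra_simps)+
  define D where "D = poly (arm_A (w 0) (w 1) (w 4) (w 5) * arm_C (w 2) (w 3) k2 - arm_A (w 2) (w 3) (w 6) (w 7) * arm_C (w 0) (w 1) k1) r"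
  have D_eq: "D = poly ([:-1, 1:] * det_AG w - det_AB w) r"
    unfolding D_def C det_AG_def det_AB_def by (simp add: algebra_simps)
  \<comment> \<open>The identity rotation solves the edge equations of \<open>w\<close>, so the
    sextic has the factor r - 1. Writing C through G, A and B exposes it.\<close>
  have "poly (sextic (w 0) (w 1) (w 4) (w 5) k1 (w 2) (w 3) (w 6) (w 7) k2) r = (r - 1) * poly (quintic w) r"
  proof -
    define a1 b1 g1 where "a1 = poly (arm_A (w 0) (w 1) (w 4) (w 5)) r" and "b1 = poly (arm_B (w 0) (w 1) (w 4) (w 5)) r"
      and "g1 = poly (arm_G (w 0) (w 1) (w 4) (w 5)) r"
    define a2 b2 g2 where "a2 = poly (arm_A (w 2) (w 3) (w 6) (w 7)) r" and "b2 = poly (arm_B (w 2) (w 3) (w 6) (w 7)) r"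
      and "g2 = poly (arm_G (w 2) (w 3) (w 6) (w 7)) r"
    note defs = a1_def b1_def g1_def a2_def b2_def g2_def
    define E H J where "E = a1 * b2 - a2 * b1" and "H = a1 * g2 - a2 * g1" and "J = g1 * b2 - g2 * b1"
    have c: "poly (arm_C (w 0) (w 1) k1) r = (r - 1) * g1 - a1 - b1" "poly (arm_C (w 2) (w 3) k2) r = (r - 1) * g2 - a2 - b2"
      unfolding C by (simp_all add: defs algebra_simps)
    have "poly (sextic (w 0) (w 1) (w 4) (w 5) k1 (w 2) (w 3) (w 6) (w 7) k2) r =
      (a1 * ((r - 1) * g2 - a2 - b2) - a2 * ((r - 1) * g1 - a1 - b1)) *
      (((r - 1) * g1 - a1 - b1) * b2 - ((r - 1) * g2 - a2 - b2) * b1) - r * E\<^sup>2"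
      by (simp add: sextic_def E_def c defs del: One_nat_def)
    also have "a1 * ((r - 1) * g2 - a2 - b2) - a2 * ((r - 1) * g1 - a1 - b1) = (r - 1) * H - E"
      by (simp add: E_def H_def algebra_simps)
    also have "((r - 1) * g1 - a1 - b1) * b2 - ((r - 1) * g2 - a2 - b2) * b1 = (r - 1) * J - E"
      by (simp add: E_def J_def algebra_simps)
    also have "((r - 1) * H - E) * ((r - 1) * J - E) - r * E\<^sup>2 = (r - 1) * ((r - 1) * H * J - E * (E + H + J))"
      by (simp add: power2_eq_square algebra_simps)
    also have "(r - 1) * H * J - E * (E + H + J) = poly (quintic w) r"
    proof -
      have "poly (det_AB w) r = E" "poly (det_AG w) r = H" "poly (det_GB w) r = J"
        by (simp_all add: det_AB_def det_AG_def det_GB_def E_def H_def J_def defs)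
      then show ?thesis by (simp add: quintic_def algebra_simps)
    qed
    finally show ?thesis .
  qed
  then have s: "poly (sextic (w 0) (w 1) (w 4) (w 5) k1 (w 2) (w 3) (w 6) (w 7) k2) r = 0" using r(1) by simp
  have D0: "D \<noteq> 0" using D D_eq by simp
  define y where "y = - r * poly (arm_A (w 0) (w 1) (w 4) (w 5) * arm_B (w 2) (w 3) (w 6) (w 7)
     - arm_A (w 2) (w 3) (w 6) (w 7) * arm_B (w 0) (w 1) (w 4) (w 5)) r / D"
  have y0: "y \<noteq> 0" using r(2,3) D0 unfolding y_def det_AB_def by simp
  note arms = sextic_solve[OF s r(2) D_def D0 y_def]
  define u where "u i = (if i < 8 then [w 0 * r, w 1 / r, w 2 * r, w 3 / r, w 4 * y, w 5 / y, w 6 * y, w 7 / y] ! i else 0)" for i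
  have u: "u 0 = w 0 * r" "u 1 = w 1 / r" "u (Suc 0) = w 1 / r" "u 2 = w 2 * r" "u 3 = w 3 / r" "u 4 = w 4 * y" "u 5 = w 5 / y"
    "u 6 = w 6 * y" "u 7 = w 7 / y" by (simp_all add: u_def)
  have "sq_lengths w = sq_lengths u"
  proof (rule eq_sq_lengthsI)
    show "sq_lengths w 6 = (1 + u 4 - u 0) * (1 + u 5 - u 1)"
      using iffD2[OF arm_equation[OF r(2) y0] arms(1)[unfolded k1_def]] by (simp add: sq_lengths_simps u)
    show "sq_lengths w 7 = (1 + u 6 - u 2) * (1 + u 7 - u 3)"
      using iffD2[OF arm_equation[OF r(2) y0] arms(2)[unfolded k2_def]] by (simp add: sq_lengths_simps u)
  qed (use r(2) y0 in \<open>simp_all add: sq_lengths_simps u field_simps\<close>)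
  then show ?thesis using u(1) by metis
qed

text \<open>The point of \<open>\<complex>\<^sup>2\<close> with isotropic coordinates \<open>x + \<i> y = a\<close>, \<open>x - \<i> y = b\<close>.\<close>

definition isotropic_point :: "complex \<Rightarrow> complex \<Rightarrow> complex \<times> complex" where
  "isotropic_point a b = ((a + b) / 2, (a - b) / (2 * \<i>))"

lemma isotropic_point_dist:
  "(fst (isotropic_point a b) - fst (isotropic_point a' b'))\<^sup>2
    + (snd (isotropic_point a b) - snd (isotropic_point a' b'))\<^sup>2 = (a - a') * (b - b')"
proof -
  have "(a + b) / 2 - (a' + b') / 2 = ((a - a') + (b - b')) / 2"
    "(a - b) / (2 * \<i>) - (a' - b') / (2 * \<i>) = ((a - a') - (b - b')) / (2 * \<i>)"
    by (simp_all add: field_simps)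
  then show ?thesis
    by (simp add: isotropic_point_def power_divide power_mult_distrib) (simp add: power2_eq_square field_simps)
qed

section \<open>From isotropic configurations to points of the doublet variety\<close>

definition doublet_edge :: "nat \<Rightarrow> nat set" where
  "doublet_edge i = [{1, 4}, {1, 5}, {4, 5}, {2, 3}, {2, 6}, {3, 6}, {3, 4}, {5, 6}] ! i"

lemma less_8_set: "{..<8::nat} = {0, 1, 2, 3, 4, 5, 6, 7}"
  by auto

lemma doublet_edge: "inj_on doublet_edge {..<8}" "doublet_edge ` {..<8} = doublet_edges - {{1, 2}}"
proof -
  show "inj_on doublet_edge {..<8}"
    unfolding less_8_set doublet_edge_def by (simp add: inj_on_def doubleton_eq_iff)
  show "doublet_edge ` {..<8} = doublet_edges - {{1, 2}}"
    unfolding less_8_set doublet_edge_def doublet_edges_def by (simp add: doubleton_eq_iff insert_Diff_if)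
qed

lemma ex_point_of_variety:
  assumes u: "\<And>i. i < 8 \<Longrightarrow> sq_lengths u i = d (doublet_edge i)"
  shows "\<exists>p \<in> constraint_variety doublet_vertices doublet_edges 1 2 d. p 4 = isotropic_point (u 0) (u 1)"
proof -
  \<comment> \<open>Entry \<open>v\<close> holds an isotropic coordinate of vertex \<open>v\<close>;
    entry 0 is padding because vertices are numbered from 1.\<close>
  define Z W where "Z = [0, 0, 1, 1 + u 4, u 0, u 2, 1 + u 6]" and "W = [0, 0, 1, 1 + u 5, u 1, u 3, 1 + u 7]"
  define p where "p = restrict (\<lambda>v. isotropic_point (Z ! v) (W ! v)) {3, 4, 5, 6}"
  have V: "doublet_vertices - {1, 2} = {3, 4, 5, 6}"
    unfolding doublet_vertices_def by auto
  have place: "place 1 2 p v = isotropic_point (Z ! v) (W ! v)" if "v \<in> {1, 2, 3, 4, 5, 6}" for v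
    using that by (auto simp: place_def p_def Z_def W_def isotropic_point_def)
  have edge: "(Z ! v - Z ! w) * (W ! v - W ! w) = d {v, w} \<and> v \<in> {1, 2, 3, 4, 5, 6} \<and> w \<in> {1, 2, 3, 4, 5, 6}"
    if vw: "{v, w} \<in> doublet_edges - {{1, 2}}" for v w
  proof -
    obtain i where i: "i < 8" "{v, w} = doublet_edge i"
      using vw unfolding doublet_edge(2)[symmetric] by auto
    then have "d {v, w} = sq_lengths u i" using u by simp
    then show ?thesis
      using i less_8_cases[OF i(1)]
      by (auto simp: doublet_edge_def doubleton_eq_iff sq_lengths_simps Z_def W_def algebra_simps)
  qed
  have "p \<in> constraint_variety doublet_vertices doublet_edges 1 2 d"
    unfolding constraint_variety_def V
  proof (intro CollectI conjI allI impI)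
    show "p \<in> {3, 4, 5, 6} \<rightarrow>\<^sub>E UNIV" unfolding p_def by simp
    fix v w assume "{v, w} \<in> doublet_edges - {{1, 2}}"
    note e = edge[OF this]
    show "(fst (place 1 2 p v) - fst (place 1 2 p w))\<^sup>2 + (snd (place 1 2 p v) - snd (place 1 2 p w))\<^sup>2 - d {v, w} = 0"
      using e by (simp only: place isotropic_point_dist) simp
  qed
  moreover have "p 4 = isotropic_point (u 0) (u 1)"
    by (simp add: p_def Z_def W_def)
  ultimately show ?thesis by blast
qed

text \<open>The image in Q(w) of the special configuration keeps all 3-cycles on the roots of its
  quintic, and one of these roots is the ratio of the coordinates \<open>u 0\<close> and
  \<open>w 0\<close>.\<close>

lemma ex_nonsoluble_configuration:
  fixes d :: "nat \<Rightarrow> complex"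
  assumes d: "generic_point 8 d"
  shows "\<exists>w u R. d = sq_lengths w \<and> sq_lengths u = d \<and> w 0 \<noteq> 0 \<and> u 0 / w 0 \<in> R \<and> card R = 5 \<and>
    three_cycles_over (generated_subfield (range w)) R"
proof -
  obtain z where z: "generic_point 8 z" "card {x. poly (quintic z) x = 0} = 5"
    "three_cycles_over (generated_subfield (range z)) {x. poly (quintic z) x = 0}"
    using ex_generic_three_cycles by blast
  obtain \<Phi> w where \<Phi>: "field_corr \<Phi>" "\<forall>i. (z i, w i) \<in> \<Phi>" "d = sq_lengths w"
    using generic_configuration_corr[OF z(1) d] by blast
  interpret irreducible_over "range z" "quintic z" by (rule irreducible_quintic[OF z(1)])
  have deg: "degree (quintic z) = 5" by (rule irreducible_quintic[OF z(1)])
  have expr_poly_corr: "(F z, F w) \<in> poly_corr \<Psi>" if F: "expr_poly F" "field_corr \<Psi>" "\<Phi> \<subseteq> \<Psi>" for F \<Psi>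
  proof -
    have "(coeff (F z) j, coeff (F w) j) \<in> \<Psi>" for j
    proof -
      obtain e where "\<And>z. coeff (F z) j = expr_eval z e" using F(1) unfolding expr_poly_def by blast
      moreover have "(expr_eval z e, expr_eval w e) \<in> \<Psi>"
        by (rule expr_eval_corr) (use F \<Phi>(2) in auto)
      ultimately show ?thesis by simp
    qed
    then show ?thesis unfolding poly_corr_def by simp
  qed
  obtain \<Psi> where \<Psi>: "field_corr \<Psi>" "\<Phi> \<subseteq> \<Psi>" "roots \<subseteq> Domain \<Psi>"
    using field_corr_extend_finite[OF finite_roots \<Phi>(1) expr_poly_corr[OF expr_poly_quintic \<Phi>(1) order_refl] nonzero]
    unfolding roots_def by blast
  note rc = field_corr_ring[OF \<Psi>(1)]
  define g where "g x = (SOME y. (x, y) \<in> \<Psi>)" for x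
  have g: "(x, g x) \<in> \<Psi>" if "x \<in> roots" for x
    using \<Psi>(3) that unfolding g_def by (meson DomainE someI subsetD)
  have "inj_on g roots" by (rule inj_onI) (metis g corr_right_unique[OF rc])
  then have bij: "bij_betw g roots (g ` roots)" by (simp add: bij_betw_def)
  have card: "card roots = 5" using z(2) by (simp add: roots_def)
  have "range w \<subseteq> \<Psi> `` range z" using \<Phi>(2) \<Psi>(2) by blast
  then have R: "three_cycles_over (generated_subfield (range w)) (g ` roots)"
    using three_cycles_over_transport[OF _ \<Psi>(1) _ bij g] z(3) unfolding roots_def by blast
  obtain x where x: "x \<in> roots" using card by fastforce
  \<comment> \<open>By irreducibility a nonzero polynomial over Q(z) of degree below 5 cannot vanish
    at a root of the quintic. This settles all side conditions of
    \<open>ex_second_configuration\<close>.\<close>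
  have nonvanishing: "poly (F w) (g x) \<noteq> 0" if F: "expr_poly F" "F z \<noteq> 0" "degree (F z) < 5" for F
  proof -
    have "coeff (F z) i \<in> K" for i
      using F(1) expr_eval_in_generated_subfield unfolding expr_poly_def by metis
    then have "poly (F z) x \<noteq> 0"
      using minimal[of "F z" x] F(2,3) x deg unfolding roots_def by auto
    then show ?thesis
      using corr_eq_0_iff[OF rc corr_poly[OF rc expr_poly_corr[OF F(1) \<Psi>(1,2)] g[OF x]]] by simp
  qed
  have "poly (quintic w) (g x) = 0"
    using corr_eq_0_iff[OF rc corr_poly[OF rc expr_poly_corr[OF expr_poly_quintic \<Psi>(1,2)] g[OF x]]] x
    unfolding roots_def by simp
  moreover have "expr_poly (\<lambda>_. [:0, 1:])"
    by (intro expr_poly_pCons expr_poly_0, rule exI[of _ "Const 0"], simp, rule exI[of _ "Const 1"], simp)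
  then have "poly [:0, 1:] (g x) \<noteq> 0"
    by (rule nonvanishing) simp_all
  then have "g x \<noteq> 0" by simp
  moreover have "poly (det_AB w) (g x) \<noteq> 0"
  proof (rule nonvanishing[OF expr_poly_dets(1)])
    have "coeff (det_AB z) 2 = z 6 * (z 5 * z 0) - z 4 * (z 7 * z 2)"
      by (simp add: det_defs coeff_pCons numeral_eq_Suc algebra_simps)
    then show "det_AB z \<noteq> 0" using generic_nonzeros(5)[OF z(1)] by force
    have "degree (det_AB z) \<le> 2"
      by (rule degree_le) (simp add: det_defs coeff_pCons split: nat.splits)
    then show "degree (det_AB z) < 5" by simp
  qed
  moreover have "poly ([:-1, 1:] * det_AG w - det_AB w) (g x) \<noteq> 0"
  proof (rule nonvanishing[where F = "\<lambda>z. [:-1, 1:] * det_AG z - det_AB z"])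
    show "expr_poly (\<lambda>z. [:-1, 1:] * det_AG z - det_AB z)"
      by (intro expr_poly_diff expr_poly_mult expr_poly_dets expr_poly_X_minus_1)
    have "coeff ([:-1, 1:] * det_AG z - det_AB z) 3 = z 6 * z 0 - z 4 * z 2"
      by (simp add: det_defs coeff_pCons numeral_eq_Suc algebra_simps)
    then show "[:-1, 1:] * det_AG z - det_AB z \<noteq> 0"
      using generic_nonzeros(4)[OF z(1)] by (metis coeff_0 eq_iff_diff_eq_0)
    have "degree ([:-1, 1:] * det_AG z - det_AB z) \<le> 3"
      by (rule degree_le) (simp add: det_defs coeff_pCons split: nat.splits)
    then show "degree ([:-1, 1:] * det_AG z - det_AB z) < 5" by simp
  qed
  ultimately obtain u where u: "u 0 = w 0 * g x" "sq_lengths u = sq_lengths w"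
    using ex_second_configuration by blast
  have "(z 0, w 0) \<in> \<Psi>" using \<Phi>(2) \<Psi>(2) by blast
  then have "w 0 \<noteq> 0" using corr_eq_0_iff[OF rc] generic_nonzeros(1)[OF z(1), of 0] by auto
  moreover from this have "u 0 / w 0 \<in> g ` roots" using u(1) x by simp
  moreover have "card (g ` roots) = 5" using card bij by (simp add: bij_betw_same_card)
  ultimately show ?thesis using \<Phi>(3) u(2) R by metis
qed

theorem theorem8p4:
  fixes d :: "nat set \<Rightarrow> complex"
  assumes "algebraically_independent_over_rat d (doublet_edges - {{1, 2}})"
  shows "\<not> soluble_by_radicals doublet_vertices doublet_edges 1 2 d"
proof
  assume sol: "soluble_by_radicals doublet_vertices doublet_edges 1 2 d"
  define \<delta> where "\<delta> i = (if i < 8 then d (doublet_edge i) else 0)" for i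
  have "generic_point 8 \<delta>"
    unfolding \<delta>_def using doublet_edge
    by (intro generic_point_algebraically_independent[OF assms]) simp_all
  then obtain w u R where w: "\<delta> = sq_lengths w" and u: "sq_lengths u = \<delta>" and w0: "w 0 \<noteq> 0"
    and uR: "u 0 / w 0 \<in> R" and R: "card R = 5" "three_cycles_over (generated_subfield (range w)) R"
    using ex_nonsoluble_configuration by blast
  obtain p where p: "p \<in> constraint_variety doublet_vertices doublet_edges 1 2 d" "p 4 = isotropic_point (u 0) (u 1)"
    using ex_point_of_variety[of u d] u by (auto simp: \<delta>_def)
  define F where "F = generated_subfield (d ` (doublet_edges - {{1, 2}}))"
  have "4 \<in> doublet_vertices - {1, 2}" by (simp add: doublet_vertices_def)
  then obtain L1 L2 where L: "radical_extension F L1" "fst (p 4) \<in> L1" "radical_extension F L2" "snd (p 4) \<in> L2"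
    using sol p(1) unfolding soluble_by_radicals_def F_def by (metis insertI1 insertI2)
  \<comment> \<open>The imaginary unit recovers isotropic coordinates from Cartesian ones, and
    adjoining it is itself a radical step.\<close>
  have "\<i> ^ 2 \<in> F"
    unfolding F_def power2_i by (intro generated_subfield_closed generated_subfield_one)
  then have L3: "radical_extension F (generated_subfield (insert \<i> F))"
    by (intro radical_extension.adjoin_root[where n = 2] radical_extension.base) auto
  have F: "F \<subseteq> generated_subfield (range w)"
    unfolding F_def
  proof (rule generated_subfield_least, rule image_subsetI)
    fix e assume "e \<in> doublet_edges - {{1, 2}}"
    then obtain i where "i < 8" "e = doublet_edge i" unfolding doublet_edge(2)[symmetric] by auto
    then have "d e = sq_lengths w i" using w by (metis \<delta>_def)
    then show "d e \<in> generated_subfield (range w)"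
      using sq_lengths_expr expr_eval_in_generated_subfield by metis
  qed
  \<comment> \<open>The two coordinates may lie in unrelated towers over \<open>F\<close>; these and
    the tower for the imaginary unit are absorbed in turn, starting from Q(w).\<close>
  obtain K1 where K1: "three_cycles_over (generated_subfield K1) R"
    "generated_subfield (range w) \<subseteq> generated_subfield K1" "L1 \<subseteq> generated_subfield K1"
    using three_cycles_over_radical_extension[OF L(1) R(2) F] by blast
  obtain K2 where K2: "three_cycles_over (generated_subfield K2) R"
    "generated_subfield K1 \<subseteq> generated_subfield K2" "L2 \<subseteq> generated_subfield K2"
    using three_cycles_over_radical_extension[OF L(3) K1(1)] F K1(2) by blast
  obtain K3 where K3: "three_cycles_over (generated_subfield K3) R"
    "generated_subfield K2 \<subseteq> generated_subfield K3" "generated_subfield (insert \<i> F) \<subseteq> generated_subfield K3"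
    using three_cycles_over_radical_extension[OF L3 K2(1)] F K1(2) K2(2) by blast
  have "w 0 \<in> generated_subfield (range w)" "\<i> \<in> generated_subfield (insert \<i> F)"
    by (rule generated_subfield_incl, simp)+
  then have "\<i> \<in> generated_subfield K3" "fst (p 4) \<in> generated_subfield K3" "snd (p 4) \<in> generated_subfield K3"
    "w 0 \<in> generated_subfield K3"
    using L K1 K2 K3 by blast+
  moreover have "u 0 = fst (p 4) + \<i> * snd (p 4)"
    unfolding p(2) isotropic_point_def by (simp add: field_simps)
  then have "u 0 / w 0 = (fst (p 4) + \<i> * snd (p 4)) * inverse (w 0)"
    by (simp add: divide_inverse)
  ultimately have "u 0 / w 0 \<in> generated_subfield K3"
    by (simp only: generated_subfield_closed)
  then show False using three_cycles_over_disjoint[OF K3(1) R(1)] uR by blast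
qed

end
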